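(* Two finite $\Delta$-complexes $X$ and $Y$ have the same strong homotopy type if and only if they are strongly equivalent ($X\sim Y$).
   Context: For a set $S$, $2^S_n$ is the set of subsets of $S$ with exactly $n+1$ elements. A $\Delta$-complex $X$ consists of sets $X_n$ ($n\ge 0$); maps $V\colon X_n\to 2^{X_0}_n$, with $V(v)=\{v\}$ for $v\in X_0$; and, for $n\ge1$ and $v\in X_0$, a map $d_v\colon X_n(v)\to X_{n-1}$, where $X_n(v)=\{\sigma\in X_n: v\in V(\sigma)\}$, such that (1) $V(d_v\sigma)=V(\sigma)\setminus\{v\}$ for $n\ge 1$, and (2) $d_vd_w\sigma=d_wd_v\sigma$ for $\sigma\in X_n$, $n\ge2$, and distinct $v,w\in V(\sigma)$. It is finite if it has finitely many simplices in total; all $\Delta$-complexes considered are finite. Elements of $X_n$ are $n$-simplices; elements of $X_0$ are vertices. Let $\preceq$ be the partial order on the set of all simplices generated by $d_v(\tau)\preceq\tau$ for $v\in V(\tau)$. For a vertex $v$, $X\setminus v$ is the subcomplex obtained by deleting all simplices $\sigma$ with $v\preceq\sigma$. A $\Delta$-map $f\colon X\to Y$ assigns to each $\sigma\in X_n$ a simplex $f(\sigma)\in Y_{k(\sigma)}$ with $k(\sigma)\le n$ such that (1) $V(f(\sigma))=\{f(v):v\in V(\sigma)\}$; and (2) for $n\ge1$ and $w\in V(\sigma)$, $f(d_w\sigma)=d_{f(w)}(f(\sigma))$ if $f(w)\neq f(u)$ for all $u\in V(\sigma)\setminus\{w\}$, and $f(d_w\sigma)=f(\sigma)$ otherwise.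 $\Delta$-maps $f,g\colon X\to Y$ are contiguous, $f\sim_c g$, if for every simplex $\sigma$ of $X$ there is a unique simplex $\tau$ of $Y$ with $V(\tau)=V(f(\sigma))\cup V(g(\sigma))$, $f(\sigma)\preceq\tau$ and $g(\sigma)\preceq\tau$. Let $\sim$ be the equivalence relation on $\Delta$-maps $X\to Y$ generated by $\sim_c$. $X$ and $Y$ are strongly equivalent, $X\sim Y$, if there are $\Delta$-maps $f\colon X\to Y$ and $g\colon Y\to X$ with $g\circ f\sim 1_X$ and $f\circ g\sim 1_Y$. A vertex $v$ is dominated by another vertex $v'$ if for every simplex $\sigma$ with $v\preceq\sigma$ there is a unique simplex $\tau$ with $V(\tau)=V(\sigma)\cup\{v'\}$ and $\sigma\preceq\tau$. If $v$ is dominated by some other vertex there is an elementary strong collapse from $X$ to $X\setminus v$. Write $X\searrow\!\!\!\searrow Y$ if a (possibly empty) finite sequence of elementary strong collapses leads from $X$ to its subcomplex $Y$. $X$ and $Y$ have the same strong homotopy type if there is a finite sequence of $\Delta$-complexes $X=Z_0,\dots,Z_n=Y$ with $Z_i\searrow\!\!\!\searrow Z_{i+1}$ or $Z_{i+1}\searrow\!\!\!\searrow Z_i$ for each $i$. *)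

theory Defs
  imports Main "HOL-Library.FuncSet"
begin

text \<open>
  The sets \<open>simps X n\<close> of \<open>n\<close>-simplices live in one ambient type. The maps \<open>V\<close> and \<open>d\<^sub>v\<close> are given
  for all dimensions at once; since \<open>V \<sigma>\<close> has \<open>n + 1\<close> elements for an \<open>n\<close>-simplex \<open>\<sigma>\<close>, the sets
  \<open>simps X n\<close> are automatically disjoint for distinct \<open>n\<close>.
\<close>

record 'a dcomplex =
  simps :: "nat \<Rightarrow> 'a set"
  verts :: "'a \<Rightarrow> 'a set"
  dface :: "'a \<Rightarrow> 'a \<Rightarrow> 'a"

definition subsets_n :: "'a set \<Rightarrow> nat \<Rightarrow> 'a set set" where
  "subsets_n S n = {A. A \<subseteq> S \<and> card A = n + 1}"

definition simplices :: "'a dcomplex \<Rightarrow> 'a set" where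
  "simplices X = (\<Union>n. simps X n)"

definition simps_at :: "'a dcomplex \<Rightarrow> nat \<Rightarrow> 'a \<Rightarrow> 'a set" where
  "simps_at X n v = {\<sigma> \<in> simps X n. v \<in> verts X \<sigma>}"

text \<open>
  The two \<open>extensional\<close> conditions fix the values of \<open>verts\<close> and \<open>dface\<close> outside their mathematical
  domains, so that equality of records is equality of complexes.
\<close>

definition delta_complex :: "'a dcomplex \<Rightarrow> bool" where
  "delta_complex X \<longleftrightarrow>
     (\<forall>n. verts X \<in> simps X n \<rightarrow> subsets_n (simps X 0) n) \<and>
     verts X \<in> extensional (simplices X) \<and>
     (\<forall>v \<in> simps X 0. verts X v = {v}) \<and>
     (\<forall>n \<ge> 1. \<forall>v \<in> simps X 0. dface X v \<in> simps_at X n v \<rightarrow> simps X (n - 1)) \<and>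
     (\<forall>v. dface X v \<in> extensional (\<Union>n \<in> {1..}. simps_at X n v)) \<and>
     (\<forall>n \<ge> 1. \<forall>v \<in> simps X 0. \<forall>\<sigma> \<in> simps_at X n v.
        verts X (dface X v \<sigma>) = verts X \<sigma> - {v}) \<and>
     (\<forall>n \<ge> 2. \<forall>\<sigma> \<in> simps X n. \<forall>v \<in> verts X \<sigma>. \<forall>w \<in> verts X \<sigma>.
        v \<noteq> w \<longrightarrow> dface X v (dface X w \<sigma>) = dface X w (dface X v \<sigma>))"

definition finite_delta_complex :: "'a dcomplex \<Rightarrow> bool" where
  "finite_delta_complex X \<longleftrightarrow> delta_complex X \<and> finite (simplices X)"

definition elem_face :: "'a dcomplex \<Rightarrow> 'a \<Rightarrow> 'a \<Rightarrow> bool" where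
  "elem_face X \<sigma> \<tau> \<longleftrightarrow> (\<exists>n \<ge> 1. \<tau> \<in> simps X n \<and> (\<exists>v \<in> verts X \<tau>. \<sigma> = dface X v \<tau>))"

definition face_le :: "'a dcomplex \<Rightarrow> 'a \<Rightarrow> 'a \<Rightarrow> bool" where
  "face_le X \<sigma> \<tau> \<longleftrightarrow> \<sigma> \<in> simplices X \<and> \<tau> \<in> simplices X \<and> (elem_face X)\<^sup>*\<^sup>* \<sigma> \<tau>"

definition delete_vertex :: "'a dcomplex \<Rightarrow> 'a \<Rightarrow> 'a dcomplex" where
  "delete_vertex X v =
     (let S = (\<lambda>n. {\<sigma> \<in> simps X n. \<not> face_le X v \<sigma>}) in
      \<lparr>simps = S,
       verts = restrict (verts X) (\<Union>n. S n),
       dface = (\<lambda>w. restrict (dface X w) (\<Union>n \<in> {1..}. {\<sigma> \<in> S n. w \<in> verts X \<sigma>}))\<rparr>)"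

definition delta_map :: "'a dcomplex \<Rightarrow> 'b dcomplex \<Rightarrow> ('a \<Rightarrow> 'b) \<Rightarrow> bool" where
  "delta_map X Y f \<longleftrightarrow>
     (\<forall>n. \<forall>\<sigma> \<in> simps X n.
        (\<exists>k \<le> n. f \<sigma> \<in> simps Y k) \<and>
        verts Y (f \<sigma>) = f ` verts X \<sigma> \<and>
        (n \<ge> 1 \<longrightarrow> (\<forall>w \<in> verts X \<sigma>.
           f (dface X w \<sigma>) =
             (if \<forall>u \<in> verts X \<sigma> - {w}. f w \<noteq> f u then dface Y (f w) (f \<sigma>) else f \<sigma>))))"

definition contiguous :: "'a dcomplex \<Rightarrow> 'b dcomplex \<Rightarrow> ('a \<Rightarrow> 'b) \<Rightarrow> ('a \<Rightarrow> 'b) \<Rightarrow> bool" where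
  "contiguous X Y f g \<longleftrightarrow>
     delta_map X Y f \<and> delta_map X Y g \<and>
     (\<forall>\<sigma> \<in> simplices X. \<exists>!\<tau>. \<tau> \<in> simplices Y \<and>
        verts Y \<tau> = verts Y (f \<sigma>) \<union> verts Y (g \<sigma>) \<and>
        face_le Y (f \<sigma>) \<tau> \<and> face_le Y (g \<sigma>) \<tau>)"

text \<open>
  Values of maps outside \<open>simplices X\<close> do not matter: Delta-maps that agree on \<open>simplices X\<close>
  are contiguous.
\<close>

definition map_equiv :: "'a dcomplex \<Rightarrow> 'b dcomplex \<Rightarrow> ('a \<Rightarrow> 'b) \<Rightarrow> ('a \<Rightarrow> 'b) \<Rightarrow> bool" where
  "map_equiv X Y f g \<longleftrightarrow>
     delta_map X Y f \<and> delta_map X Y g \<and> equivclp (contiguous X Y) f g"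

definition strongly_equivalent :: "'a dcomplex \<Rightarrow> 'b dcomplex \<Rightarrow> bool" where
  "strongly_equivalent X Y \<longleftrightarrow>
     (\<exists>f g. delta_map X Y f \<and> delta_map Y X g \<and>
        map_equiv X X (g \<circ> f) id \<and> map_equiv Y Y (f \<circ> g) id)"

definition dominated_by :: "'a dcomplex \<Rightarrow> 'a \<Rightarrow> 'a \<Rightarrow> bool" where
  "dominated_by X v v' \<longleftrightarrow>
     v \<in> simps X 0 \<and> v' \<in> simps X 0 \<and> v' \<noteq> v \<and>
     (\<forall>\<sigma> \<in> simplices X. face_le X v \<sigma> \<longrightarrow>
        (\<exists>!\<tau>. \<tau> \<in> simplices X \<and> verts X \<tau> = verts X \<sigma> \<union> {v'} \<and> face_le X \<sigma> \<tau>))"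

definition elem_strong_collapse :: "'a dcomplex \<Rightarrow> 'a dcomplex \<Rightarrow> bool" where
  "elem_strong_collapse X Y \<longleftrightarrow> (\<exists>v v'. dominated_by X v v' \<and> Y = delete_vertex X v)"

definition strong_collapse :: "'a dcomplex \<Rightarrow> 'a dcomplex \<Rightarrow> bool" where
  "strong_collapse = elem_strong_collapse\<^sup>*\<^sup>*"

text \<open>
  The complexes in the sequence need room for new simplices: the relation is the intended one
  when the ambient type is infinite, the type playing the role of the universe of sets.
\<close>

definition same_strong_homotopy_type :: "'a dcomplex \<Rightarrow> 'a dcomplex \<Rightarrow> bool" where
  "same_strong_homotopy_type X Y \<longleftrightarrow>
     (\<exists>n Z. Z 0 = X \<and> Z n = Y \<and>
        (\<forall>i \<le> (n::nat). finite_delta_complex (Z i)) \<and>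
        (\<forall>i < n. strong_collapse (Z i) (Z (Suc i)) \<or> strong_collapse (Z (Suc i)) (Z i)))"

end

theory Submission
  imports Defs
begin

text \<open>
  Replacing uniqueness in the definition of contiguity by a choice of joining simplices that is
  monotone with respect to faces gives a weaker, coherent, contiguity that is preserved by
  composition on both sides. A complex without dominated vertices is rigid: a map
  coherently contiguous to the identity and different from it at \<open>v\<close> shows that \<open>v\<close> is dominated by
  its image. An elementary strong collapse has a retraction contiguous to the identity. Hence
  either of the two relations forces the cores of \<open>X\<close> and \<open>Y\<close> to be isomorphic. Conversely, if the
  cores are isomorphic, then the retractions and inclusions yield a strong equivalence, and a
  cylinder that strongly collapses to both of its ends joins the cores.
\<close>

section \<open>Faces and Delta-maps\<close>

text \<open>Simplices of a Delta-complex are not determined by their vertices, but the faces of one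
  fixed simplex are. Most arguments take the face of a given simplex on a prescribed vertex set and
  identify it by this local uniqueness; in particular, Delta-maps become monotone maps compatible
  with vertex sets. The cores serve in both directions because strong equivalences cannot simply be
  composed: uniqueness of joining simplices may be lost under postcomposition. On cores the round
  trips are the identity on every simplex, and the only contiguities that remain are those of the
  collapse retractions, which are genuine. \<open>same_strong_homotopy_type\<close> links records of
  a single type, and a collapse ends in a literal subcomplex, so isomorphic complexes are not
  related for free. A cylinder must therefore have the two given complexes themselves as its ends.
  It is copied into the ambient type, whose infinity supplies names for the remaining simplices, and
  complexes that overlap are joined through a third copy disjoint from both.\<close>

definition mk_dc :: "'a set \<Rightarrow> ('a \<Rightarrow> 'a set) \<Rightarrow> ('a \<Rightarrow> 'a \<Rightarrow> 'a) \<Rightarrow> 'a dcomplex" where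
  "mk_dc P V D = \<lparr>simps = \<lambda>n. {\<sigma> \<in> P. card (V \<sigma>) = n + 1}, verts = restrict V P,
     dface = \<lambda>w. restrict (D w) {\<sigma> \<in> P. w \<in> V \<sigma> \<and> 2 \<le> card (V \<sigma>)}\<rparr>"

text \<open>The axioms without the grading: dimension is read off from the number of vertices, so
  the bounds 2 and 3 on cardinalities stand for dimension at least 1 and at least 2.
  \<open>mk_dc\<close> restores the grading, and its restrictions give the normal form that the
  extensionality conditions demand.\<close>

definition face_data :: "'a set \<Rightarrow> ('a \<Rightarrow> 'a set) \<Rightarrow> ('a \<Rightarrow> 'a \<Rightarrow> 'a) \<Rightarrow> bool" where
  "face_data P V D \<longleftrightarrow>
     (\<forall>\<sigma>\<in>P. finite (V \<sigma>) \<and> V \<sigma> \<noteq> {} \<and>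
        (\<forall>v\<in>V \<sigma>. v \<in> P \<and> V v = {v}) \<and>
        (card (V \<sigma>) = 1 \<longrightarrow> V \<sigma> = {\<sigma>}) \<and>
        (\<forall>v\<in>V \<sigma>. 2 \<le> card (V \<sigma>) \<longrightarrow> D v \<sigma> \<in> P \<and> V (D v \<sigma>) = V \<sigma> - {v}) \<and>
        (\<forall>v\<in>V \<sigma>. \<forall>w\<in>V \<sigma>. v \<noteq> w \<and> 3 \<le> card (V \<sigma>) \<longrightarrow> D v (D w \<sigma>) = D w (D v \<sigma>)))"

lemma
  assumes "face_data P V D" "\<sigma> \<in> P"
  shows face_data_finite: "finite (V \<sigma>)" and face_data_nonempty: "V \<sigma> \<noteq> {}"
    and face_data_vertex: "v \<in> V \<sigma> \<Longrightarrow> v \<in> P \<and> V v = {v}"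
    and face_data_card_1: "card (V \<sigma>) = 1 \<Longrightarrow> V \<sigma> = {\<sigma>}"
    and face_data_face: "v \<in> V \<sigma> \<Longrightarrow> 2 \<le> card (V \<sigma>) \<Longrightarrow> D v \<sigma> \<in> P \<and> V (D v \<sigma>) = V \<sigma> - {v}"
    and face_data_commute: "v \<in> V \<sigma> \<Longrightarrow> w \<in> V \<sigma> \<Longrightarrow> v \<noteq> w \<Longrightarrow> 3 \<le> card (V \<sigma>)
      \<Longrightarrow> D v (D w \<sigma>) = D w (D v \<sigma>)"
  using assms unfolding face_data_def by blast+

lemma simplices_mk_dc:
  assumes "face_data P V D"
  shows "simplices (mk_dc P V D) = P"
proof -
  have "\<exists>n. card (V \<sigma>) = n + 1" if "\<sigma> \<in> P" for \<sigma>
    using face_data_finite[OF assms that] face_data_nonempty[OF assms that]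
    by (intro exI[of _ "card (V \<sigma>) - 1"]) (simp add: Suc_leI card_gt_0_iff)
  then show ?thesis by (auto simp: simplices_def mk_dc_def)
qed

lemma verts_mk_dc: "\<sigma> \<in> P \<Longrightarrow> verts (mk_dc P V D) \<sigma> = V \<sigma>"
  by (simp add: mk_dc_def)

lemma dface_mk_dc:
  "\<sigma> \<in> P \<Longrightarrow> w \<in> V \<sigma> \<Longrightarrow> 2 \<le> card (V \<sigma>) \<Longrightarrow> dface (mk_dc P V D) w \<sigma> = D w \<sigma>"
  by (simp add: mk_dc_def)

lemma delta_complex_mk_dc:
  assumes "face_data P V D"
  shows "delta_complex (mk_dc P V D)"
proof -
  let ?X = "mk_dc P V D"
  have s: "simps ?X n = {\<sigma> \<in> P. card (V \<sigma>) = n + 1}" for n by (simp add: mk_dc_def)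
  have s0: "v \<in> simps ?X 0 \<longleftrightarrow> v \<in> P \<and> V v = {v}" for v
    unfolding s using face_data_card_1[OF assms, of v] by fastforce
  have at: "simps_at ?X n v = {\<sigma> \<in> P. v \<in> V \<sigma> \<and> card (V \<sigma>) = n + 1}" for n v
    by (auto simp: simps_at_def s verts_mk_dc)
  have U: "(\<Union>n \<in> {1..}. simps_at ?X n v) = {\<sigma> \<in> P. v \<in> V \<sigma> \<and> 2 \<le> card (V \<sigma>)}" for v
  proof -
    have "\<exists>n\<ge>1. card (V \<sigma>) = n + 1" if "2 \<le> card (V \<sigma>)" for \<sigma>
      using that by (intro exI[of _ "card (V \<sigma>) - 1"]) simp
    then show ?thesis by (auto simp: at)
  qed
  have D: "D v \<sigma> \<in> P" "V (D v \<sigma>) = V \<sigma> - {v}" "card (V (D v \<sigma>)) = n"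
    if "\<sigma> \<in> P" "v \<in> V \<sigma>" "n \<ge> 1" "card (V \<sigma>) = n + 1" for \<sigma> v n
  proof -
    show "D v \<sigma> \<in> P" "V (D v \<sigma>) = V \<sigma> - {v}"
      using face_data_face[OF assms that(1,2)] that(3,4) by simp_all
    then show "card (V (D v \<sigma>)) = n" using face_data_finite[OF assms that(1)] that by simp
  qed
  have comm: "dface ?X v (dface ?X w \<sigma>) = dface ?X w (dface ?X v \<sigma>)"
    if h: "n \<ge> 2" "\<sigma> \<in> simps ?X n" "v \<in> V \<sigma>" "w \<in> V \<sigma>" "v \<noteq> w" for n \<sigma> v w
  proof -
    have \<sigma>: "\<sigma> \<in> P" "card (V \<sigma>) = n + 1" using h by (auto simp: s)
    have c: "dface ?X v (dface ?X w \<sigma>) = D v (D w \<sigma>)"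
      if "v \<in> V \<sigma>" "w \<in> V \<sigma>" "v \<noteq> w" for v w
    proof -
      have "dface ?X w \<sigma> = D w \<sigma>" using \<sigma> that h by (simp add: dface_mk_dc)
      moreover have "dface ?X v (D w \<sigma>) = D v (D w \<sigma>)"
        using D[of \<sigma> w n] \<sigma> that h by (intro dface_mk_dc) auto
      ultimately show ?thesis by simp
    qed
    have "D v (D w \<sigma>) = D w (D v \<sigma>)" using face_data_commute[OF assms \<sigma>(1)] \<sigma>(2) h by simp
    then show ?thesis using c[of v w] c[of w v] h by simp
  qed
  show ?thesis
    unfolding delta_complex_def
  proof (intro conjI allI ballI impI)
    show "verts ?X \<in> simps ?X n \<rightarrow> subsets_n (simps ?X 0) n" for n
    proof
      fix \<sigma> assume "\<sigma> \<in> simps ?X n"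
      then have \<sigma>: "\<sigma> \<in> P" "card (V \<sigma>) = n + 1" by (auto simp: s)
      moreover have "V \<sigma> \<subseteq> simps ?X 0" using face_data_vertex[OF assms \<sigma>(1)] s0 by blast
      ultimately show "verts ?X \<sigma> \<in> subsets_n (simps ?X 0) n"
        by (simp add: subsets_n_def verts_mk_dc)
    qed
    show "verts ?X \<in> extensional (simplices ?X)"
      unfolding simplices_mk_dc[OF assms] by (simp add: mk_dc_def)
    show "verts ?X v = {v}" if "v \<in> simps ?X 0" for v
      using that s0 by (simp add: verts_mk_dc)
    show "dface ?X v \<in> simps_at ?X n v \<rightarrow> simps ?X (n - 1)" if "1 \<le> n" for n v
      using that D[of _ v n] by (auto simp: at s dface_mk_dc)
    show "dface ?X v \<in> extensional (\<Union>n \<in> {1..}. simps_at ?X n v)" for v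
      unfolding U by (simp add: mk_dc_def)
    show "verts ?X (dface ?X v \<sigma>) = verts ?X \<sigma> - {v}"
      if "1 \<le> n" "\<sigma> \<in> simps_at ?X n v" for n v \<sigma>
      using that D[of \<sigma> v n] by (auto simp: at s dface_mk_dc verts_mk_dc)
    show "dface ?X v (dface ?X w \<sigma>) = dface ?X w (dface ?X v \<sigma>)"
      if "2 \<le> n" "\<sigma> \<in> simps ?X n" "v \<in> verts ?X \<sigma>" "w \<in> verts ?X \<sigma>" "v \<noteq> w" for n \<sigma> v w
      using that comm[of n \<sigma> v w] by (auto simp: s verts_mk_dc)
  qed
qed

lemma
  assumes "delta_complex X"
  shows delta_complexD_verts:
      "\<sigma> \<in> simps X n \<Longrightarrow> verts X \<sigma> \<subseteq> simps X 0"
      "\<sigma> \<in> simps X n \<Longrightarrow> card (verts X \<sigma>) = n + 1"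
      "v \<in> simps X 0 \<Longrightarrow> verts X v = {v}"
    and delta_complexD_dface:
      "1 \<le> n \<Longrightarrow> v \<in> simps X 0 \<Longrightarrow> \<sigma> \<in> simps_at X n v \<Longrightarrow> dface X v \<sigma> \<in> simps X (n - 1)"
      "1 \<le> n \<Longrightarrow> v \<in> simps X 0 \<Longrightarrow> \<sigma> \<in> simps_at X n v \<Longrightarrow> verts X (dface X v \<sigma>) = verts X \<sigma> - {v}"
      "2 \<le> n \<Longrightarrow> \<sigma> \<in> simps X n \<Longrightarrow> v \<in> verts X \<sigma> \<Longrightarrow> w \<in> verts X \<sigma> \<Longrightarrow> v \<noteq> w
        \<Longrightarrow> dface X v (dface X w \<sigma>) = dface X w (dface X v \<sigma>)"
    and delta_complexD_extensional:
      "verts X \<in> extensional (simplices X)"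
      "dface X v \<in> extensional (\<Union>n \<in> {1..}. simps_at X n v)"
proof -
  note c1 = assms[unfolded delta_complex_def, THEN conjunct1]
    and d1 = assms[unfolded delta_complex_def, THEN conjunct2]
  note c2 = d1[THEN conjunct1] and d2 = d1[THEN conjunct2]
  note c3 = d2[THEN conjunct1] and d3 = d2[THEN conjunct2]
  note c4 = d3[THEN conjunct1] and d4 = d3[THEN conjunct2]
  note c5 = d4[THEN conjunct1] and d5 = d4[THEN conjunct2]
  note c6 = d5[THEN conjunct1] and c7 = d5[THEN conjunct2]
  show "verts X \<sigma> \<subseteq> simps X 0" "card (verts X \<sigma>) = n + 1" if "\<sigma> \<in> simps X n"
    using funcset_mem[OF c1[rule_format] that] by (auto simp: subsets_n_def)
  show "verts X v = {v}" if "v \<in> simps X 0" using c3 that by blast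
  show "dface X v \<sigma> \<in> simps X (n - 1)"
    if "1 \<le> n" "v \<in> simps X 0" "\<sigma> \<in> simps_at X n v"
    by (rule funcset_mem[OF c4[rule_format, OF that(1,2)] that(3)])
  show "verts X (dface X v \<sigma>) = verts X \<sigma> - {v}"
    if "1 \<le> n" "v \<in> simps X 0" "\<sigma> \<in> simps_at X n v"
    by (rule c6[rule_format, OF that])
  show "dface X v (dface X w \<sigma>) = dface X w (dface X v \<sigma>)"
    if "2 \<le> n" "\<sigma> \<in> simps X n" "v \<in> verts X \<sigma>" "w \<in> verts X \<sigma>" "v \<noteq> w"
    by (rule c7[rule_format, OF that])
  show "verts X \<in> extensional (simplices X)" by (rule c2)
  show "dface X v \<in> extensional (\<Union>n \<in> {1..}. simps_at X n v)" by (rule c5[rule_format])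
qed

lemma simps_iff:
  assumes "delta_complex X"
  shows "\<sigma> \<in> simps X n \<longleftrightarrow> \<sigma> \<in> simplices X \<and> card (verts X \<sigma>) = n + 1"
  using delta_complexD_verts(2)[OF assms, of \<sigma>] by (auto simp: simplices_def)

lemma face_data_of_delta_complex:
  assumes "delta_complex X"
  shows "face_data (simplices X) (verts X) (dface X)"
  unfolding face_data_def
proof (intro ballI conjI impI)
  fix \<sigma> assume "\<sigma> \<in> simplices X"
  then obtain n where n: "\<sigma> \<in> simps X n" by (auto simp: simplices_def)
  note V = delta_complexD_verts(1,2)[OF assms n]
  show "finite (verts X \<sigma>)" "verts X \<sigma> \<noteq> {}" using V(2) card.infinite by fastforce+
  show v: "v \<in> simplices X" "verts X v = {v}" if "v \<in> verts X \<sigma>" for v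
    using that V(1) delta_complexD_verts(3)[OF assms, of v] by (auto simp: simplices_def)
  show "verts X \<sigma> = {\<sigma>}" if "card (verts X \<sigma>) = 1"
    using that n V delta_complexD_verts(3)[OF assms] by simp
  show "dface X v \<sigma> \<in> simplices X" "verts X (dface X v \<sigma>) = verts X \<sigma> - {v}"
    if v: "v \<in> verts X \<sigma>" "2 \<le> card (verts X \<sigma>)" for v
  proof -
    have "1 \<le> n" "v \<in> simps X 0" "\<sigma> \<in> simps_at X n v"
      using v V n by (auto simp: simps_at_def)
    then show "dface X v \<sigma> \<in> simplices X" "verts X (dface X v \<sigma>) = verts X \<sigma> - {v}"
      using delta_complexD_dface[OF assms] by (auto simp: simplices_def)
  qed
  show "dface X v (dface X w \<sigma>) = dface X w (dface X v \<sigma>)"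
    if "v \<in> verts X \<sigma>" "w \<in> verts X \<sigma>" "v \<noteq> w \<and> 3 \<le> card (verts X \<sigma>)" for v w
  proof -
    have "2 \<le> n" using that V by simp
    then show ?thesis using that n delta_complexD_dface(3)[OF assms] by blast
  qed
qed

lemma simps_at_Union:
  assumes "delta_complex X"
  shows "(\<Union>n \<in> {1..}. simps_at X n v)
    = {\<sigma> \<in> simplices X. v \<in> verts X \<sigma> \<and> 2 \<le> card (verts X \<sigma>)}"
proof -
  have "\<exists>n\<ge>1. card (verts X \<sigma>) = n + 1" if "2 \<le> card (verts X \<sigma>)" for \<sigma>
    using that by (intro exI[of _ "card (verts X \<sigma>) - 1"]) simp
  then show ?thesis by (auto simp: simps_at_def simps_iff[OF assms])
qed

text \<open>The extensionality conditions in \<open>delta_complex\<close> let the ungraded data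
  determine the record. Together with \<open>mk_dc_cong\<close> this reduces equality of complexes
  to agreement of simplices, vertices and meaningful faces.\<close>

lemma mk_dc_of_delta_complex:
  assumes "delta_complex X"
  shows "mk_dc (simplices X) (verts X) (dface X) = X"
proof -
  have "restrict (verts X) (simplices X) = verts X"
    by (rule extensional_restrict[OF delta_complexD_extensional(1)[OF assms]])
  moreover have "restrict (dface X w) {\<sigma> \<in> simplices X. w \<in> verts X \<sigma> \<and> 2 \<le> card (verts X \<sigma>)}
      = dface X w" for w
    by (rule extensional_restrict[OF delta_complexD_extensional(2)[OF assms, of w,
          unfolded simps_at_Union[OF assms]]])
  moreover have "{\<sigma> \<in> simplices X. card (verts X \<sigma>) = n + 1} = simps X n" for n
    using simps_iff[OF assms] by auto
  ultimately show ?thesis by (simp add: mk_dc_def)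
qed

lemma mk_dc_cong:
  assumes "P = P'" "\<And>\<sigma>. \<sigma> \<in> P \<Longrightarrow> V \<sigma> = V' \<sigma>"
    and "\<And>\<sigma> w. \<sigma> \<in> P \<Longrightarrow> w \<in> V \<sigma> \<Longrightarrow> 2 \<le> card (V \<sigma>) \<Longrightarrow> D w \<sigma> = D' w \<sigma>"
  shows "mk_dc P V D = mk_dc P' V' D'"
proof -
  have "{\<sigma> \<in> P. card (V \<sigma>) = n + 1} = {\<sigma> \<in> P'. card (V' \<sigma>) = n + 1}" for n
    using assms by auto
  moreover have "restrict V P = restrict V' P'" using assms by (auto simp: restrict_def fun_eq_iff)
  moreover have "restrict (D w) {\<sigma> \<in> P. w \<in> V \<sigma> \<and> 2 \<le> card (V \<sigma>)}
     = restrict (D' w) {\<sigma> \<in> P'. w \<in> V' \<sigma> \<and> 2 \<le> card (V' \<sigma>)}" for w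
    using assms by (auto simp: restrict_def fun_eq_iff)
  ultimately show ?thesis by (simp add: mk_dc_def)
qed

lemma
  assumes "delta_complex X" "\<sigma> \<in> simplices X"
  shows finite_verts: "finite (verts X \<sigma>)" and verts_nonempty: "verts X \<sigma> \<noteq> {}"
    and vertex_of_simplex: "v \<in> verts X \<sigma> \<Longrightarrow> v \<in> simplices X"
    and verts_vertex: "v \<in> verts X \<sigma> \<Longrightarrow> verts X v = {v}"
    and verts_card_1: "card (verts X \<sigma>) = 1 \<Longrightarrow> verts X \<sigma> = {\<sigma>}"
    and dface_simplex: "v \<in> verts X \<sigma> \<Longrightarrow> 2 \<le> card (verts X \<sigma>) \<Longrightarrow> dface X v \<sigma> \<in> simplices X"
    and verts_dface:
      "v \<in> verts X \<sigma> \<Longrightarrow> 2 \<le> card (verts X \<sigma>) \<Longrightarrow> verts X (dface X v \<sigma>) = verts X \<sigma> - {v}"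
    and dface_commute: "v \<in> verts X \<sigma> \<Longrightarrow> w \<in> verts X \<sigma> \<Longrightarrow> v \<noteq> w \<Longrightarrow> 3 \<le> card (verts X \<sigma>)
      \<Longrightarrow> dface X v (dface X w \<sigma>) = dface X w (dface X v \<sigma>)"
  using face_data_of_delta_complex[OF assms(1)] assms(2) unfolding face_data_def by blast+

lemma vertex_iff:
  assumes "delta_complex X"
  shows "v \<in> simps X 0 \<longleftrightarrow> v \<in> simplices X \<and> verts X v = {v}"
  unfolding simps_iff[OF assms] using verts_card_1[OF assms, of v] by fastforce

lemma verts_subset: "delta_complex X \<Longrightarrow> \<sigma> \<in> simplices X \<Longrightarrow> verts X \<sigma> \<subseteq> simps X 0"
  using vertex_of_simplex verts_vertex vertex_iff by (metis subsetI)

section \<open>The face order\<close>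

lemma elem_face_iff:
  assumes "delta_complex X"
  shows "elem_face X \<tau> \<sigma> \<longleftrightarrow>
    \<sigma> \<in> simplices X \<and> 2 \<le> card (verts X \<sigma>) \<and> (\<exists>v \<in> verts X \<sigma>. \<tau> = dface X v \<sigma>)"
proof -
  have "\<exists>n\<ge>1. card (verts X \<sigma>) = n + 1" if "2 \<le> card (verts X \<sigma>)"
    using that by (intro exI[of _ "card (verts X \<sigma>) - 1"]) simp
  then show ?thesis by (auto simp: elem_face_def simps_iff[OF assms])
qed

lemma face_le_refl: "\<sigma> \<in> simplices X \<Longrightarrow> face_le X \<sigma> \<sigma>"
  by (simp add: face_le_def)

lemma face_le_trans: "face_le X \<rho> \<tau> \<Longrightarrow> face_le X \<tau> \<sigma> \<Longrightarrow> face_le X \<rho> \<sigma>"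
  by (auto simp: face_le_def)

lemma face_le_simplices:
  "face_le X \<tau> \<sigma> \<Longrightarrow> \<tau> \<in> simplices X" "face_le X \<tau> \<sigma> \<Longrightarrow> \<sigma> \<in> simplices X"
  by (auto simp: face_le_def)

lemma elem_face_simplices:
  assumes "delta_complex X" "elem_face X \<tau> \<sigma>"
  shows "\<tau> \<in> simplices X" "\<sigma> \<in> simplices X"
  using assms dface_simplex by (auto simp: elem_face_iff)

lemma elem_face_le: "delta_complex X \<Longrightarrow> elem_face X \<tau> \<sigma> \<Longrightarrow> face_le X \<tau> \<sigma>"
  using elem_face_simplices by (auto simp: face_le_def)

lemma face_le_induct [consumes 2, case_names refl step]:
  assumes "delta_complex X" "face_le X \<tau> \<sigma>"
    and "\<tau> \<in> simplices X \<Longrightarrow> P \<tau>"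
    and "\<And>\<rho> \<sigma>'. face_le X \<tau> \<rho> \<Longrightarrow> elem_face X \<rho> \<sigma>' \<Longrightarrow> P \<rho> \<Longrightarrow> P \<sigma>'"
  shows "P \<sigma>"
proof -
  have "(elem_face X)\<^sup>*\<^sup>* \<tau> \<sigma>" "\<tau> \<in> simplices X" using assms(2) by (auto simp: face_le_def)
  then have "face_le X \<tau> \<sigma> \<and> P \<sigma>"
  proof induction
    case base
    then show ?case using assms(2,3) face_le_refl by (simp add: face_le_def)
  next
    case (step \<rho> \<sigma>')
    then have "P \<sigma>'" using assms(4)[of \<rho> \<sigma>'] by simp
    moreover have "face_le X \<tau> \<sigma>'"
      using step elem_face_le[OF assms(1), of \<rho> \<sigma>'] face_le_trans by metis
    ultimately show ?case by simp
  qed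
  then show ?thesis ..
qed

lemma face_le_verts:
  assumes "delta_complex X" "face_le X \<tau> \<sigma>"
  shows "verts X \<tau> \<subseteq> verts X \<sigma>"
  using assms
proof (induction rule: face_le_induct)
  case (step \<rho> \<sigma>')
  then show ?case using verts_dface[OF assms(1)] by (auto simp: elem_face_iff[OF assms(1)])
qed simp

text \<open>Peels off the outermost elementary face of a chain. The vertex removed there cannot
  reappear lower down, because vertex sets only shrink.\<close>

lemma face_le_cases:
  assumes "delta_complex X" "face_le X \<tau> \<sigma>"
  obtains "\<tau> = \<sigma>"
    | v where "v \<in> verts X \<sigma>" "v \<notin> verts X \<tau>" "2 \<le> card (verts X \<sigma>)" "face_le X \<tau> (dface X v \<sigma>)"
proof -
  have "\<tau> = \<sigma> \<or> (\<exists>v. v \<in> verts X \<sigma> \<and> v \<notin> verts X \<tau> \<and> 2 \<le> card (verts X \<sigma>) \<and> face_le X \<tau> (dface X v \<sigma>))"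
    using assms
  proof (induction rule: face_le_induct)
    case (step \<rho> \<sigma>')
    then obtain v where v: "v \<in> verts X \<sigma>'" "2 \<le> card (verts X \<sigma>')" "\<rho> = dface X v \<sigma>'" "\<sigma>' \<in> simplices X"
      by (auto simp: elem_face_iff[OF assms(1)])
    then have "v \<notin> verts X \<tau>"
      using face_le_verts[OF assms(1) step(1)] verts_dface[OF assms(1)] by auto
    then show ?case using v step by auto
  qed simp
  then show thesis using that by blast
qed

lemma face_le_verts_eq:
  assumes "delta_complex X" "face_le X \<tau> \<sigma>" "verts X \<tau> = verts X \<sigma>"
  shows "\<tau> = \<sigma>"
  using assms(1,2) by (cases rule: face_le_cases) (use assms(3) in auto)

text \<open>Delete the vertices outside \<open>A\<close> one at a time. A nonempty \<open>A\<close>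
  together with a vertex outside it provides the two vertices that each deletion requires.\<close>

lemma face_exists:
  assumes X: "delta_complex X" and "\<sigma> \<in> simplices X" "A \<subseteq> verts X \<sigma>" "A \<noteq> {}"
  shows "\<exists>\<tau>. face_le X \<tau> \<sigma> \<and> verts X \<tau> = A"
  using assms(2-)
proof (induction "card (verts X \<sigma>)" arbitrary: \<sigma> rule: less_induct)
  case less
  show ?case
  proof (cases "A = verts X \<sigma>")
    case True
    then show ?thesis using face_le_refl[OF less.prems(1)] by blast
  next
    case False
    then obtain v where v: "v \<in> verts X \<sigma>" "v \<notin> A" using less.prems(2) by blast
    have fin: "finite (verts X \<sigma>)" by (rule finite_verts[OF X less.prems(1)])
    have "card (insert v A) \<le> card (verts X \<sigma>)" using v less.prems fin by (intro card_mono) auto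
    moreover have "card A > 0" using less.prems finite_subset[OF less.prems(2) fin] by (simp add: card_gt_0_iff)
    moreover have "finite A" by (rule finite_subset[OF less.prems(2) fin])
    ultimately have c: "2 \<le> card (verts X \<sigma>)" using v by simp
    have d: "dface X v \<sigma> \<in> simplices X" "verts X (dface X v \<sigma>) = verts X \<sigma> - {v}"
      using dface_simplex[OF X less.prems(1) v(1) c] verts_dface[OF X less.prems(1) v(1) c] .
    have "card (verts X (dface X v \<sigma>)) < card (verts X \<sigma>)"
      unfolding d using v fin by (intro psubset_card_mono) auto
    then obtain \<tau> where "face_le X \<tau> (dface X v \<sigma>)" "verts X \<tau> = A"
      using less.hyps[OF _ d(1)] less.prems(2,3) d(2) v by blast
    moreover have "face_le X (dface X v \<sigma>) \<sigma>"
      using less.prems(1) v c by (intro elem_face_le[OF X]) (auto simp: elem_face_iff[OF X])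
    ultimately show ?thesis using face_le_trans by metis
  qed
qed

text \<open>A diamond argument by induction on the number of vertices of \<open>\<sigma>\<close>;
  here the commutation axiom (2) does its work. If \<open>\<tau>\<close> and \<open>\<tau>'\<close>
  lie under different faces of \<open>\<sigma>\<close>, omitting \<open>v\<close> and
  \<open>w\<close> respectively, both are compared with a simplex below the common face that omits
  \<open>v\<close> and \<open>w\<close>.\<close>

lemma face_unique:
  assumes X: "delta_complex X" and "face_le X \<tau> \<sigma>" "face_le X \<tau>' \<sigma>" "verts X \<tau> = verts X \<tau>'"
  shows "\<tau> = \<tau>'"
  using assms(2-)
proof (induction "card (verts X \<sigma>)" arbitrary: \<sigma> \<tau> \<tau>' rule: less_induct)
  case less
  from X less.prems(1) show ?case
  proof (cases rule: face_le_cases)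
    case 1
    then show ?thesis using less.prems face_le_verts_eq[OF X] by metis
  next
    case v: (2 v)
    from X less.prems(2) show ?thesis
    proof (cases rule: face_le_cases)
      case 1
      then show ?thesis using v less.prems face_le_verts_eq[OF X] by metis
    next
      case w: (2 w)
      have \<sigma>: "\<sigma> \<in> simplices X" using less.prems(1) face_le_simplices by metis
      have fin: "finite (verts X \<sigma>)" using finite_verts[OF X] \<sigma> by blast
      have lt: "card (verts X (dface X u \<sigma>)) < card (verts X \<sigma>)" if "u \<in> verts X \<sigma>" for u
        unfolding verts_dface[OF X \<sigma> that v(3)] by (rule card_Diff1_less[OF fin that])
      show ?thesis
      proof (cases "v = w")
        case True
        then show ?thesis using less.hyps[OF lt[OF v(1)] v(4)] w(4) less.prems(3) by metis
      next
        case False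
        have "\<tau> \<in> simplices X" using less.prems(1) face_le_simplices by metis
        then have ne: "verts X \<tau> \<noteq> {}" using verts_nonempty[OF X] by blast
        have sub: "verts X \<tau> \<subseteq> verts X \<sigma> - {v} - {w}"
          using face_le_verts[OF X less.prems(1)] v(2) w(2) less.prems(3) by auto
        have cd: "card (verts X \<sigma> - {v} - {w}) > 0"
          using fin sub ne by (auto simp: card_gt_0_iff)
        \<comment> \<open>Commutation asks for three vertices: besides \<open>v\<close> and
          \<open>w\<close> there is a vertex of \<open>\<tau>\<close>, which avoids both.\<close>
        then have c3: "3 \<le> card (verts X \<sigma>)"
          using v w False fin by (auto simp: card_gt_0_iff)
        have d: "dface X u \<sigma> \<in> simplices X" "verts X (dface X u \<sigma>) = verts X \<sigma> - {u}"
          "2 \<le> card (verts X \<sigma> - {u})"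
          if "u \<in> verts X \<sigma>" for u
          using dface_simplex[OF X \<sigma>] verts_dface[OF X \<sigma>] that v c3 fin by (auto simp del: One_nat_def)
        have *: "elem_face X (dface X w (dface X v \<sigma>)) (dface X v \<sigma>)"
          "elem_face X (dface X v (dface X w \<sigma>)) (dface X w \<sigma>)"
          unfolding elem_face_iff[OF X] using d[of v] d[of w] v w False by auto
        have vs: "verts X (dface X w (dface X v \<sigma>)) = verts X \<sigma> - {v} - {w}"
          using verts_dface[OF X, of "dface X v \<sigma>" w] d[of v] v w False by auto
        \<comment> \<open>By commutation the double face lies below both single faces, so the
          induction hypothesis applies to \<open>\<rho>\<close> once in each of them.\<close>
        obtain \<rho> where \<rho>: "face_le X \<rho> (dface X w (dface X v \<sigma>))" "verts X \<rho> = verts X \<tau>"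
          using face_exists[OF X elem_face_simplices(1)[OF X *(1)], of "verts X \<tau>"] sub ne vs by auto
        have "face_le X \<rho> (dface X v \<sigma>)" "face_le X \<rho> (dface X w \<sigma>)"
          using \<rho>(1) *[THEN elem_face_le[OF X]] dface_commute[OF X \<sigma>, of v w] v w False c3
            face_le_trans by metis+
        then have "\<tau> = \<rho>" "\<rho> = \<tau>'"
          using less.hyps[OF lt[OF v(1)] v(4)] less.hyps[OF lt[OF w(1)] _ w(4)] \<rho>(2) less.prems(3)
          by metis+
        then show ?thesis by simp
      qed
    qed
  qed
qed

text \<open>The face of \<open>\<tau>'\<close> on the vertices of \<open>\<tau>\<close> is also a
  face of \<open>\<sigma>\<close>, and so it equals \<open>\<tau>\<close>. Within one simplex,
  comparing faces thus amounts to comparing vertex sets.\<close>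

lemma face_le_of_verts:
  assumes "delta_complex X" "face_le X \<tau> \<sigma>" "face_le X \<tau>' \<sigma>" "verts X \<tau> \<subseteq> verts X \<tau>'"
  shows "face_le X \<tau> \<tau>'"
proof -
  obtain \<rho> where "face_le X \<rho> \<tau>'" "verts X \<rho> = verts X \<tau>"
    using face_exists assms face_le_simplices verts_nonempty by metis
  then show ?thesis using face_unique[OF assms(1)] assms face_le_trans by metis
qed

lemma vertex_face_le_iff:
  assumes "delta_complex X" "v \<in> simps X 0" "\<sigma> \<in> simplices X"
  shows "face_le X v \<sigma> \<longleftrightarrow> v \<in> verts X \<sigma>"
proof
  have v: "v \<in> simplices X" "verts X v = {v}" using assms(2) unfolding vertex_iff[OF assms(1)] by simp_all
  then show "face_le X v \<sigma> \<Longrightarrow> v \<in> verts X \<sigma>" using face_le_verts[OF assms(1), of v \<sigma>] by simp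
  assume "v \<in> verts X \<sigma>"
  then obtain \<tau> where \<tau>: "face_le X \<tau> \<sigma>" "verts X \<tau> = {v}"
    using face_exists[OF assms(1,3), of "{v}"] by auto
  then have "\<tau> = v" using verts_card_1[OF assms(1), of \<tau>] face_le_simplices(1)[OF \<tau>(1)] by simp
  then show "face_le X v \<sigma>" using \<tau> by simp
qed

text \<open>Undefined unless \<open>A\<close> is a nonempty subset of the vertices of \<open>\<sigma>\<close>.\<close>

definition span_face :: "'a dcomplex \<Rightarrow> 'a set \<Rightarrow> 'a \<Rightarrow> 'a" where
  "span_face X A \<sigma> = (THE \<tau>. face_le X \<tau> \<sigma> \<and> verts X \<tau> = A)"

lemma span_face:
  assumes "delta_complex X" "\<sigma> \<in> simplices X" "A \<subseteq> verts X \<sigma>" "A \<noteq> {}"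
  shows "face_le X (span_face X A \<sigma>) \<sigma>" "verts X (span_face X A \<sigma>) = A"
proof -
  have "\<exists>!\<tau>. face_le X \<tau> \<sigma> \<and> verts X \<tau> = A"
    using face_exists[OF assms] face_unique[OF assms(1)] by blast
  from theI'[OF this]
  show "face_le X (span_face X A \<sigma>) \<sigma>" "verts X (span_face X A \<sigma>) = A"
    unfolding span_face_def by auto
qed

lemma span_face_eqI:
  assumes "delta_complex X" "face_le X \<tau> \<sigma>" "verts X \<tau> = A"
  shows "span_face X A \<sigma> = \<tau>"
  unfolding span_face_def
proof (rule the_equality)
  show "face_le X \<tau> \<sigma> \<and> verts X \<tau> = A" using assms(2,3) by simp
  show "\<rho> = \<tau>" if "face_le X \<rho> \<sigma> \<and> verts X \<rho> = A" for \<rho>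
    using face_unique[OF assms(1), of \<rho> \<sigma> \<tau>] that assms(2,3) by simp
qed

section \<open>Delta-maps as monotone maps\<close>

lemma
  assumes "delta_map X Y f" "\<sigma> \<in> simps X n"
  shows delta_map_simplex: "\<exists>k\<le>n. f \<sigma> \<in> simps Y k"
    and delta_map_verts: "verts Y (f \<sigma>) = f ` verts X \<sigma>"
    and delta_map_dface: "1 \<le> n \<Longrightarrow> w \<in> verts X \<sigma> \<Longrightarrow> f (dface X w \<sigma>) =
       (if \<forall>u\<in>verts X \<sigma> - {w}. f w \<noteq> f u then dface Y (f w) (f \<sigma>) else f \<sigma>)"
proof -
  note f = assms(1)[unfolded delta_map_def, rule_format, OF assms(2)]
  show "\<exists>k\<le>n. f \<sigma> \<in> simps Y k" using f[THEN conjunct1] .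
  show "verts Y (f \<sigma>) = f ` verts X \<sigma>" using f[THEN conjunct2, THEN conjunct1] .
  show "f (dface X w \<sigma>) =
       (if \<forall>u\<in>verts X \<sigma> - {w}. f w \<noteq> f u then dface Y (f w) (f \<sigma>) else f \<sigma>)"
    if "1 \<le> n" "w \<in> verts X \<sigma>"
    using f[THEN conjunct2, THEN conjunct2] that by blast
qed

text \<open>For a monotone \<open>f\<close>, the simplex \<open>f (dface X w \<sigma>)\<close> is a
  face of \<open>f \<sigma>\<close> whose vertex set is the image of
  \<open>verts X \<sigma> - {w}\<close>. If another vertex of \<open>\<sigma>\<close> has the same
  image as \<open>w\<close>, this is the whole vertex set of \<open>f \<sigma>\<close>; otherwise
  just \<open>f w\<close> is missing. Uniqueness of faces turns this alternative into the two cases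
  of condition (2), and the dimension bound follows by counting vertices.\<close>

lemma delta_map_iff:
  assumes X: "delta_complex X" and Y: "delta_complex Y"
  shows "delta_map X Y f \<longleftrightarrow>
     (\<forall>\<sigma>\<in>simplices X. f \<sigma> \<in> simplices Y \<and> verts Y (f \<sigma>) = f ` verts X \<sigma>) \<and>
     (\<forall>\<tau> \<sigma>. face_le X \<tau> \<sigma> \<longrightarrow> face_le Y (f \<tau>) (f \<sigma>))" (is "_ \<longleftrightarrow> ?A \<and> ?B")
proof (intro iffI conjI)
  assume f: "delta_map X Y f"
  show A: ?A
  proof
    fix \<sigma> assume "\<sigma> \<in> simplices X"
    then obtain n where "\<sigma> \<in> simps X n" by (auto simp: simplices_def)
    from delta_map_simplex[OF f this] delta_map_verts[OF f this]
    show "f \<sigma> \<in> simplices Y \<and> verts Y (f \<sigma>) = f ` verts X \<sigma>"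
      by (auto simp: simplices_def)
  qed
  show ?B
  proof (intro allI impI)
    fix \<tau> \<sigma> assume "face_le X \<tau> \<sigma>"
    with X show "face_le Y (f \<tau>) (f \<sigma>)"
    proof (induction rule: face_le_induct)
      case refl
      then show ?case using A face_le_refl by metis
    next
      case (step \<rho> \<sigma>)
      then obtain w where w: "w \<in> verts X \<sigma>" "2 \<le> card (verts X \<sigma>)" "\<rho> = dface X w \<sigma>" "\<sigma> \<in> simplices X"
        by (auto simp: elem_face_iff[OF X])
      have "\<sigma> \<in> simps X (card (verts X \<sigma>) - 1)" "card (verts X \<sigma>) - 1 \<ge> 1"
        using w by (auto simp: simps_iff[OF X])
      then have eq: "f \<rho> = (if \<forall>u \<in> verts X \<sigma> - {w}. f w \<noteq> f u then dface Y (f w) (f \<sigma>) else f \<sigma>)"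
        using delta_map_dface[OF f _ _ w(1)] unfolding w(3) by blast
      have fs: "f \<sigma> \<in> simplices Y" "verts Y (f \<sigma>) = f ` verts X \<sigma>" using A w(4) by simp_all
      have "face_le Y (f \<rho>) (f \<sigma>)"
      proof (cases "\<forall>u \<in> verts X \<sigma> - {w}. f w \<noteq> f u")
        case True
        \<comment> \<open>A second vertex of \<open>\<sigma>\<close> has an image different from
          \<open>f w\<close>, so \<open>f \<sigma>\<close> has at least two vertices and
          \<open>dface Y (f w)\<close> is applied inside its domain.\<close>
        have "verts X \<sigma> \<noteq> {w}" using w(2) by auto
        then obtain u where "u \<in> verts X \<sigma>" "u \<noteq> w" using w(1) by blast
        then have "{f w, f u} \<subseteq> verts Y (f \<sigma>)" "f w \<noteq> f u" using w True fs by auto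
        then have "2 \<le> card (verts Y (f \<sigma>))"
          using card_mono[OF finite_verts[OF Y fs(1)], of "{f w, f u}"] by auto
        then have "elem_face Y (f \<rho>) (f \<sigma>)"
          unfolding elem_face_iff[OF Y] using fs w eq True by auto
        then show ?thesis by (rule elem_face_le[OF Y])
      next
        case False
        then show ?thesis using eq fs face_le_refl by auto
      qed
      then show ?case using step(3) face_le_trans by metis
    qed
  qed
next
  assume AB: "?A \<and> ?B"
  show "delta_map X Y f"
    unfolding delta_map_def
  proof (intro allI ballI conjI impI)
    fix n \<sigma> assume \<sigma>n: "\<sigma> \<in> simps X n"
    then have \<sigma>: "\<sigma> \<in> simplices X" "card (verts X \<sigma>) = n + 1" by (auto simp: simps_iff[OF X])
    then have fs: "f \<sigma> \<in> simplices Y" "verts Y (f \<sigma>) = f ` verts X \<sigma>" using AB by auto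
    then show "verts Y (f \<sigma>) = f ` verts X \<sigma>" by simp
    have "card (verts Y (f \<sigma>)) \<le> n + 1" using fs \<sigma> card_image_le finite_verts[OF X] by metis
    moreover have "card (verts Y (f \<sigma>)) > 0"
      using finite_verts[OF Y fs(1)] verts_nonempty[OF Y fs(1)] by (simp add: card_gt_0_iff)
    ultimately show "\<exists>k\<le>n. f \<sigma> \<in> simps Y k"
      using fs(1) by (intro exI[of _ "card (verts Y (f \<sigma>)) - 1"]) (auto simp: simps_iff[OF Y])
    fix w assume n: "1 \<le> n" and w: "w \<in> verts X \<sigma>"
    have c: "2 \<le> card (verts X \<sigma>)" using n \<sigma> by simp
    have d: "verts X (dface X w \<sigma>) = verts X \<sigma> - {w}" "elem_face X (dface X w \<sigma>) \<sigma>"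
      using verts_dface[OF X \<sigma>(1) w c] \<sigma> w c by (auto simp: elem_face_iff[OF X])
    have fd: "face_le Y (f (dface X w \<sigma>)) (f \<sigma>)"
      "verts Y (f (dface X w \<sigma>)) = f ` (verts X \<sigma> - {w})"
      using AB d elem_face_le[OF X d(2)] elem_face_simplices[OF X d(2)] by simp_all
    show "f (dface X w \<sigma>) =
       (if \<forall>u\<in>verts X \<sigma> - {w}. f w \<noteq> f u then dface Y (f w) (f \<sigma>) else f \<sigma>)"
    proof (cases "\<forall>u\<in>verts X \<sigma> - {w}. f w \<noteq> f u")
      case True
      have "verts X \<sigma> \<noteq> {w}" using c by auto
      then obtain u where "u \<in> verts X \<sigma>" "u \<noteq> w" using w(1) by blast
      then have "{f w, f u} \<subseteq> verts Y (f \<sigma>)" "f w \<noteq> f u" using w True fs by auto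
      then have c2: "2 \<le> card (verts Y (f \<sigma>))"
        using card_mono[OF finite_verts[OF Y fs(1)], of "{f w, f u}"] by auto
      then have "elem_face Y (dface Y (f w) (f \<sigma>)) (f \<sigma>)"
        unfolding elem_face_iff[OF Y] using fs w by auto
      moreover have "verts Y (dface Y (f w) (f \<sigma>)) = verts Y (f \<sigma>) - {f w}"
        using verts_dface[OF Y fs(1) _ c2] fs(2) w by simp
      moreover have "f ` (verts X \<sigma> - {w}) = verts Y (f \<sigma>) - {f w}"
        unfolding fs(2) using True w by (auto simp del: ball_simps) (metis DiffI singletonD)
      ultimately have "f (dface X w \<sigma>) = dface Y (f w) (f \<sigma>)"
        using face_unique[OF Y fd(1) elem_face_le[OF Y]] fd(2) by simp
      then show ?thesis using True by simp
    next
      case False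
      then have "f w \<in> f ` (verts X \<sigma> - {w})" by blast
      then have "f ` (verts X \<sigma> - {w}) = f ` verts X \<sigma>" by blast
      then have "f (dface X w \<sigma>) = f \<sigma>" using fd(2) fs(2) face_le_verts_eq[OF Y fd(1)] by simp
      with False show ?thesis by metis
    qed
  qed
qed

section \<open>Coherent contiguity\<close>

lemma
  assumes "delta_complex X" "delta_complex Y" "delta_map X Y f"
  shows delta_map_in: "\<sigma> \<in> simplices X \<Longrightarrow> f \<sigma> \<in> simplices Y"
    and delta_map_verts_eq: "\<sigma> \<in> simplices X \<Longrightarrow> verts Y (f \<sigma>) = f ` verts X \<sigma>"
    and delta_map_mono: "face_le X \<tau> \<sigma> \<Longrightarrow> face_le Y (f \<tau>) (f \<sigma>)"
  using assms(3) unfolding delta_map_iff[OF assms(1,2)] by simp_all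

lemma delta_mapI:
  assumes "delta_complex X" "delta_complex Y"
    and "\<And>\<sigma>. \<sigma> \<in> simplices X \<Longrightarrow> f \<sigma> \<in> simplices Y"
    and "\<And>\<sigma>. \<sigma> \<in> simplices X \<Longrightarrow> verts Y (f \<sigma>) = f ` verts X \<sigma>"
    and "\<And>\<tau> \<sigma>. face_le X \<tau> \<sigma> \<Longrightarrow> face_le Y (f \<tau>) (f \<sigma>)"
  shows "delta_map X Y f"
  using assms(3-) unfolding delta_map_iff[OF assms(1,2)] by simp

lemma delta_map_id: "delta_complex X \<Longrightarrow> delta_map X X id"
  by (rule delta_mapI) simp_all

lemma delta_map_comp:
  assumes "delta_complex X" "delta_complex Y" "delta_complex Z" "delta_map X Y f" "delta_map Y Z g"
  shows "delta_map X Z (g \<circ> f)"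
  using assms(4,5) unfolding delta_map_iff[OF assms(1,2)] delta_map_iff[OF assms(2,3)]
    delta_map_iff[OF assms(1,3)] by (simp add: image_comp)

lemma delta_map_cong:
  assumes "delta_complex X" "delta_complex Y" "delta_map X Y f"
    and eq: "\<And>\<sigma>. \<sigma> \<in> simplices X \<Longrightarrow> f \<sigma> = g \<sigma>"
  shows "delta_map X Y g"
proof (rule delta_mapI[OF assms(1,2)])
  note f = delta_map_in[OF assms(1-3)] delta_map_verts_eq[OF assms(1-3)] delta_map_mono[OF assms(1-3)]
  show "g \<sigma> \<in> simplices Y" if "\<sigma> \<in> simplices X" for \<sigma> using f(1) eq that by metis
  show "verts Y (g \<sigma>) = g ` verts X \<sigma>" if "\<sigma> \<in> simplices X" for \<sigma>
  proof -
    have "f ` verts X \<sigma> = g ` verts X \<sigma>"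
      using eq vertex_of_simplex[OF assms(1) that] by (intro image_cong) auto
    then show ?thesis using f(2)[OF that] eq[OF that] by simp
  qed
  show "face_le Y (g \<tau>) (g \<sigma>)" if "face_le X \<tau> \<sigma>" for \<tau> \<sigma>
    using f(3)[OF that] eq[of \<tau>] eq[of \<sigma>] face_le_simplices[OF that] by simp
qed

text \<open>
  Contiguity itself is not preserved by postcomposition: if the two vertices of an edge of \<open>Y\<close>
  acquire a second common edge in \<open>Z\<close>, the joining simplex is no longer unique.
\<close>

definition coh_contiguous :: "'a dcomplex \<Rightarrow> 'b dcomplex \<Rightarrow> ('a \<Rightarrow> 'b) \<Rightarrow> ('a \<Rightarrow> 'b) \<Rightarrow> bool" where
  "coh_contiguous X Y f g \<longleftrightarrow> delta_map X Y f \<and> delta_map X Y g \<and>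
     (\<exists>T. (\<forall>\<sigma>\<in>simplices X. verts Y (T \<sigma>) = verts Y (f \<sigma>) \<union> verts Y (g \<sigma>) \<and>
             face_le Y (f \<sigma>) (T \<sigma>) \<and> face_le Y (g \<sigma>) (T \<sigma>)) \<and>
          (\<forall>\<tau> \<sigma>. face_le X \<tau> \<sigma> \<longrightarrow> face_le Y (T \<tau>) (T \<sigma>)))"

lemma coh_contiguousI:
  assumes "delta_map X Y f" "delta_map X Y g"
    and "\<And>\<sigma>. \<sigma> \<in> simplices X \<Longrightarrow> verts Y (T \<sigma>) = verts Y (f \<sigma>) \<union> verts Y (g \<sigma>)"
    and "\<And>\<sigma>. \<sigma> \<in> simplices X \<Longrightarrow> face_le Y (f \<sigma>) (T \<sigma>)"
    and "\<And>\<sigma>. \<sigma> \<in> simplices X \<Longrightarrow> face_le Y (g \<sigma>) (T \<sigma>)"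
    and "\<And>\<tau> \<sigma>. face_le X \<tau> \<sigma> \<Longrightarrow> face_le Y (T \<tau>) (T \<sigma>)"
  shows "coh_contiguous X Y f g"
  unfolding coh_contiguous_def using assms by (intro conjI exI[of _ T]) simp_all

lemma coh_contiguousE:
  assumes "coh_contiguous X Y f g"
  obtains T where "delta_map X Y f" "delta_map X Y g"
    and "\<And>\<sigma>. \<sigma> \<in> simplices X \<Longrightarrow> verts Y (T \<sigma>) = verts Y (f \<sigma>) \<union> verts Y (g \<sigma>)"
    and "\<And>\<sigma>. \<sigma> \<in> simplices X \<Longrightarrow> face_le Y (f \<sigma>) (T \<sigma>)"
    and "\<And>\<sigma>. \<sigma> \<in> simplices X \<Longrightarrow> face_le Y (g \<sigma>) (T \<sigma>)"
    and "\<And>\<tau> \<sigma>. face_le X \<tau> \<sigma> \<Longrightarrow> face_le Y (T \<tau>) (T \<sigma>)"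
proof -
  obtain T where "\<forall>\<sigma>\<in>simplices X. verts Y (T \<sigma>) = verts Y (f \<sigma>) \<union> verts Y (g \<sigma>) \<and>
      face_le Y (f \<sigma>) (T \<sigma>) \<and> face_le Y (g \<sigma>) (T \<sigma>)"
    "\<forall>\<tau> \<sigma>. face_le X \<tau> \<sigma> \<longrightarrow> face_le Y (T \<tau>) (T \<sigma>)" "delta_map X Y f" "delta_map X Y g"
    using assms unfolding coh_contiguous_def by (elim conjE exE)
  then show thesis by (intro that[of T]) simp_all
qed

lemma coh_contiguous_sym:
  assumes "coh_contiguous X Y f g"
  shows "coh_contiguous X Y g f"
  using assms
proof (cases rule: coh_contiguousE)
  case (1 T)
  then show ?thesis by (intro coh_contiguousI[of X Y g f T]) auto
qed

text \<open>Uniqueness makes the choice monotone: the face of \<open>T \<sigma>\<close> on the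
  vertices of \<open>f \<tau>\<close> and \<open>g \<tau>\<close> joins these two simplices, so it
  is the only candidate for \<open>T \<tau>\<close>.\<close>

lemma coh_contiguous_of_contiguous:
  assumes X: "delta_complex X" and Y: "delta_complex Y" and fg: "contiguous X Y f g"
  shows "coh_contiguous X Y f g"
proof -
  have f: "delta_map X Y f" and g: "delta_map X Y g" using fg by (auto simp: contiguous_def)
  define Q where "Q \<sigma> \<tau> \<longleftrightarrow> \<tau> \<in> simplices Y \<and> verts Y \<tau> = verts Y (f \<sigma>) \<union> verts Y (g \<sigma>) \<and>
    face_le Y (f \<sigma>) \<tau> \<and> face_le Y (g \<sigma>) \<tau>" for \<sigma> \<tau>
  define T where "T \<sigma> = (THE \<tau>. Q \<sigma> \<tau>)" for \<sigma>
  have ex1: "\<exists>!\<tau>. Q \<sigma> \<tau>" if "\<sigma> \<in> simplices X" for \<sigma>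
    using fg that unfolding contiguous_def Q_def by simp
  have T: "Q \<sigma> (T \<sigma>)" if "\<sigma> \<in> simplices X" for \<sigma>
    unfolding T_def by (rule theI'[OF ex1[OF that]])
  have "face_le Y (T \<tau>) (T \<sigma>)" if ts: "face_le X \<tau> \<sigma>" for \<tau> \<sigma>
  proof -
    note s = face_le_simplices[OF ts]
    let ?A = "verts Y (f \<tau>) \<union> verts Y (g \<tau>)"
    note mf = delta_map_mono[OF X Y f ts] and mg = delta_map_mono[OF X Y g ts]
    have le: "face_le Y (f \<tau>) (T \<sigma>)" "face_le Y (g \<tau>) (T \<sigma>)"
      using face_le_trans[OF mf] face_le_trans[OF mg] T[OF s(2)] unfolding Q_def by auto
    have "?A \<subseteq> verts Y (T \<sigma>)" using le face_le_verts[OF Y] by blast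
    moreover have "?A \<noteq> {}" using verts_nonempty[OF Y face_le_simplices(1)[OF le(1)]] by simp
    ultimately obtain \<rho> where \<rho>: "face_le Y \<rho> (T \<sigma>)" "verts Y \<rho> = ?A"
      using face_exists[OF Y face_le_simplices(2)[OF le(1)], of ?A] by auto
    have "face_le Y (f \<tau>) \<rho>" "face_le Y (g \<tau>) \<rho>"
      using face_le_of_verts[OF Y le(1) \<rho>(1)] face_le_of_verts[OF Y le(2) \<rho>(1)] \<rho>(2) by auto
    then have "Q \<tau> \<rho>" using \<rho>(2) face_le_simplices[OF \<rho>(1)] by (simp add: Q_def)
    then have "T \<tau> = \<rho>" using ex1[OF s(1)] T[OF s(1)] by auto
    then show ?thesis using \<rho>(1) by simp
  qed
  then show ?thesis using T unfolding Q_def by (intro coh_contiguousI[OF f g, of T]) simp_all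
qed

text \<open>The simplices \<open>h (T \<sigma>)\<close> join the images, and the choice stays
  monotone because \<open>h\<close> is monotone. Other joining simplices in \<open>Z\<close> do no
  harm.\<close>

lemma coh_contiguous_comp_left:
  assumes X: "delta_complex X" and Y: "delta_complex Y" and Z: "delta_complex Z"
    and fg: "coh_contiguous X Y f g" and h: "delta_map Y Z h"
  shows "coh_contiguous X Z (h \<circ> f) (h \<circ> g)"
proof -
  obtain T where f: "delta_map X Y f" and g: "delta_map X Y g"
    and T: "\<And>\<sigma>. \<sigma> \<in> simplices X \<Longrightarrow> verts Y (T \<sigma>) = verts Y (f \<sigma>) \<union> verts Y (g \<sigma>)"
      "\<And>\<sigma>. \<sigma> \<in> simplices X \<Longrightarrow> face_le Y (f \<sigma>) (T \<sigma>)"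
      "\<And>\<sigma>. \<sigma> \<in> simplices X \<Longrightarrow> face_le Y (g \<sigma>) (T \<sigma>)"
    and mono: "\<And>\<tau> \<sigma>. face_le X \<tau> \<sigma> \<Longrightarrow> face_le Y (T \<tau>) (T \<sigma>)"
    by (rule coh_contiguousE[OF fg]) (rule that; simp)
  note hv = delta_map_verts_eq[OF Y Z h] and hm = delta_map_mono[OF Y Z h]
  have "verts Z (h (T \<sigma>)) = verts Z (h (f \<sigma>)) \<union> verts Z (h (g \<sigma>))" if "\<sigma> \<in> simplices X" for \<sigma>
    using hv[OF face_le_simplices(1)[OF T(2)[OF that]]] hv[OF face_le_simplices(1)[OF T(3)[OF that]]]
      hv[OF face_le_simplices(2)[OF T(2)[OF that]]] T(1)[OF that] by (simp add: image_Un)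
  then show ?thesis
    using hm[OF T(2)] hm[OF T(3)] hm[OF mono]
    by (intro coh_contiguousI[OF delta_map_comp[OF X Y Z f h] delta_map_comp[OF X Y Z g h],
          of "h \<circ> T"]) simp_all
qed

lemma coh_contiguous_comp_right:
  assumes W: "delta_complex W" and X: "delta_complex X" and Y: "delta_complex Y"
    and fg: "coh_contiguous X Y f g" and k: "delta_map W X k"
  shows "coh_contiguous W Y (f \<circ> k) (g \<circ> k)"
proof -
  obtain T where f: "delta_map X Y f" and g: "delta_map X Y g"
    and T: "\<And>\<sigma>. \<sigma> \<in> simplices X \<Longrightarrow> verts Y (T \<sigma>) = verts Y (f \<sigma>) \<union> verts Y (g \<sigma>)"
      "\<And>\<sigma>. \<sigma> \<in> simplices X \<Longrightarrow> face_le Y (f \<sigma>) (T \<sigma>)"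
      "\<And>\<sigma>. \<sigma> \<in> simplices X \<Longrightarrow> face_le Y (g \<sigma>) (T \<sigma>)"
    and mono: "\<And>\<tau> \<sigma>. face_le X \<tau> \<sigma> \<Longrightarrow> face_le Y (T \<tau>) (T \<sigma>)"
    by (rule coh_contiguousE[OF fg]) (rule that; simp)
  note ki = delta_map_in[OF W X k] and km = delta_map_mono[OF W X k]
  show ?thesis
    using T[OF ki] mono[OF km]
    by (intro coh_contiguousI[OF delta_map_comp[OF W X Y k f] delta_map_comp[OF W X Y k g],
          of "T \<circ> k"]) simp_all
qed

lemma coh_contiguous_of_eq:
  assumes "delta_complex X" "delta_complex Y" "delta_map X Y f"
    and "\<And>\<sigma>. \<sigma> \<in> simplices X \<Longrightarrow> f \<sigma> = g \<sigma>"
  shows "coh_contiguous X Y f g"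
  using delta_map_in[OF assms(1-3)] delta_map_mono[OF assms(1-3)]
  by (intro coh_contiguousI[OF assms(3) delta_map_cong[OF assms], of f])
    (simp_all add: assms(4)[symmetric] face_le_refl)

section \<open>Homotopy and equivalence for coherent contiguity\<close>

abbreviation coh_homotopic :: "'a dcomplex \<Rightarrow> 'b dcomplex \<Rightarrow> ('a \<Rightarrow> 'b) \<Rightarrow> ('a \<Rightarrow> 'b) \<Rightarrow> bool" where
  "coh_homotopic X Y \<equiv> (coh_contiguous X Y)\<^sup>*\<^sup>*"

lemma coh_homotopic_sym: "coh_homotopic X Y f g \<Longrightarrow> coh_homotopic X Y g f"
  using coh_contiguous_sym by (metis sympD sympI symp_rtranclp)

text \<open>Coherent contiguity is symmetric, so its reflexive transitive closure absorbs the
  backward steps of \<open>equivclp\<close>.\<close>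

lemma coh_homotopic_of_equivclp:
  assumes "delta_complex X" "delta_complex Y" "equivclp (contiguous X Y) f g"
  shows "coh_homotopic X Y f g"
  using assms(3)
proof (induction rule: equivclp_induct)
  case (step g h)
  then have "coh_contiguous X Y g h"
    using coh_contiguous_of_contiguous[OF assms(1,2)] coh_contiguous_sym by metis
  then show ?case using step(3) by simp
qed simp

lemma coh_homotopic_comp_left:
  assumes "delta_complex X" "delta_complex Y" "delta_complex Z" "delta_map Y Z h"
    and "coh_homotopic X Y f g"
  shows "coh_homotopic X Z (h \<circ> f) (h \<circ> g)"
  using assms(5)
proof induction
  case (step g g')
  from step(3) coh_contiguous_comp_left[OF assms(1-3) step(2) assms(4)] show ?case
    by (simp add: rtranclp.rtrancl_into_rtrancl del: comp_apply)
qed simp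

lemma coh_homotopic_comp_right:
  assumes "delta_complex W" "delta_complex X" "delta_complex Y" "delta_map W X k"
    and "coh_homotopic X Y f g"
  shows "coh_homotopic W Y (f \<circ> k) (g \<circ> k)"
  using assms(5)
proof induction
  case (step g g')
  from step(3) coh_contiguous_comp_right[OF assms(1-3) step(2) assms(4)] show ?case
    by (simp add: rtranclp.rtrancl_into_rtrancl del: comp_apply)
qed simp

definition coh_equivalent :: "'a dcomplex \<Rightarrow> 'b dcomplex \<Rightarrow> bool" where
  "coh_equivalent X Y \<longleftrightarrow> (\<exists>f g. delta_map X Y f \<and> delta_map Y X g \<and>
     coh_homotopic X X (g \<circ> f) id \<and> coh_homotopic Y Y (f \<circ> g) id)"

lemma coh_equivalent_refl: "delta_complex X \<Longrightarrow> coh_equivalent X X"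
  unfolding coh_equivalent_def using delta_map_id by (intro exI[of _ id]) auto

lemma coh_equivalent_sym: "coh_equivalent X Y \<Longrightarrow> coh_equivalent Y X"
  unfolding coh_equivalent_def by blast

text \<open>The inner round trip is replaced by the identity while it sits between the outer maps,
  which takes composition on both sides. Composition on the left is the operation that plain
  contiguity does not allow in general.\<close>

lemma coh_equivalent_trans:
  assumes X: "delta_complex X" and Y: "delta_complex Y" and Z: "delta_complex Z"
    and "coh_equivalent X Y" "coh_equivalent Y Z"
  shows "coh_equivalent X Z"
proof -
  obtain f g where fg: "delta_map X Y f" "delta_map Y X g"
      "coh_homotopic X X (g \<circ> f) id" "coh_homotopic Y Y (f \<circ> g) id"
    using assms(4) unfolding coh_equivalent_def by blast
  obtain h k where hk: "delta_map Y Z h" "delta_map Z Y k"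
      "coh_homotopic Y Y (k \<circ> h) id" "coh_homotopic Z Z (h \<circ> k) id"
    using assms(5) unfolding coh_equivalent_def by blast
  have 1: "coh_homotopic X X ((g \<circ> k) \<circ> (h \<circ> f)) (g \<circ> f)"
    using coh_homotopic_comp_left[OF X Y X fg(2) coh_homotopic_comp_right[OF X Y Y fg(1) hk(3)]]
    by (simp add: comp_assoc)
  have 2: "coh_homotopic Z Z ((h \<circ> f) \<circ> (g \<circ> k)) (h \<circ> k)"
    using coh_homotopic_comp_left[OF Z Y Z hk(1) coh_homotopic_comp_right[OF Z Y Y hk(2) fg(4)]]
    by (simp add: comp_assoc)
  show ?thesis
    unfolding coh_equivalent_def
    using delta_map_comp[OF X Y Z fg(1) hk(1)] delta_map_comp[OF Z Y X hk(2) fg(2)]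
      rtranclp_trans[OF 1 fg(3)] rtranclp_trans[OF 2 hk(4)] by blast
qed

lemma coh_equivalent_of_strongly_equivalent:
  assumes "delta_complex X" "delta_complex Y" "strongly_equivalent X Y"
  shows "coh_equivalent X Y"
  using assms(3) coh_homotopic_of_equivclp[OF assms(1,1)] coh_homotopic_of_equivclp[OF assms(2,2)]
  unfolding strongly_equivalent_def coh_equivalent_def map_equiv_def by metis

section \<open>Induced subcomplexes and the retraction of a strong collapse\<close>

text \<open>The full subcomplex on the vertices in \<open>S\<close>. Deletion of a vertex is an
  instance, and restricting twice is restricting to an intersection, so every complex reached from
  \<open>X\<close> by collapses is described by one vertex set.\<close>

definition induced :: "'a dcomplex \<Rightarrow> 'a set \<Rightarrow> 'a dcomplex" where
  "induced X S = mk_dc {\<sigma> \<in> simplices X. verts X \<sigma> \<subseteq> S} (verts X) (dface X)"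

lemma face_data_induced:
  assumes X: "delta_complex X"
  shows "face_data {\<sigma> \<in> simplices X. verts X \<sigma> \<subseteq> S} (verts X) (dface X)"
  unfolding face_data_def
proof (intro ballI conjI impI)
  fix \<sigma> assume "\<sigma> \<in> {\<sigma> \<in> simplices X. verts X \<sigma> \<subseteq> S}"
  then have \<sigma>: "\<sigma> \<in> simplices X" "verts X \<sigma> \<subseteq> S" by auto
  show "finite (verts X \<sigma>)" "verts X \<sigma> \<noteq> {}"
    using finite_verts[OF X \<sigma>(1)] verts_nonempty[OF X \<sigma>(1)] by auto
  show "verts X \<sigma> = {\<sigma>}" if "card (verts X \<sigma>) = 1"
    by (rule verts_card_1[OF X \<sigma>(1) that])
  fix v assume v: "v \<in> verts X \<sigma>"
  show "verts X v = {v}" by (rule verts_vertex[OF X \<sigma>(1) v])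
  then show "v \<in> {\<sigma> \<in> simplices X. verts X \<sigma> \<subseteq> S}"
    using vertex_of_simplex[OF X \<sigma>(1) v] v \<sigma>(2) by auto
  show "verts X (dface X v \<sigma>) = verts X \<sigma> - {v}" if "2 \<le> card (verts X \<sigma>)"
    by (rule verts_dface[OF X \<sigma>(1) v that])
  then show "dface X v \<sigma> \<in> {\<sigma> \<in> simplices X. verts X \<sigma> \<subseteq> S}" if "2 \<le> card (verts X \<sigma>)"
    using dface_simplex[OF X \<sigma>(1) v that] that \<sigma>(2) by auto
  show "dface X v (dface X w \<sigma>) = dface X w (dface X v \<sigma>)"
    if "w \<in> verts X \<sigma>" "v \<noteq> w \<and> 3 \<le> card (verts X \<sigma>)" for w
    using dface_commute[OF X \<sigma>(1) v] that by blast
qed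

lemma
  assumes X: "delta_complex X"
  shows delta_complex_induced: "delta_complex (induced X S)"
    and simplices_induced: "simplices (induced X S) = {\<sigma> \<in> simplices X. verts X \<sigma> \<subseteq> S}"
  using delta_complex_mk_dc[OF face_data_induced[OF X]] simplices_mk_dc[OF face_data_induced[OF X]]
  unfolding induced_def .

lemma verts_induced: "\<sigma> \<in> simplices X \<Longrightarrow> verts X \<sigma> \<subseteq> S \<Longrightarrow> verts (induced X S) \<sigma> = verts X \<sigma>"
  unfolding induced_def by (simp add: verts_mk_dc)

text \<open>A bound on the vertices of \<open>\<sigma>\<close> bounds those of its faces too. To
  obtain a face relation in the subcomplex, a face with the right vertices is produced there and
  recognised as \<open>\<tau>\<close> by uniqueness of faces in \<open>X\<close>.\<close>

lemma face_le_induced_iff: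
  assumes X: "delta_complex X"
  shows "face_le (induced X S) \<tau> \<sigma> \<longleftrightarrow> face_le X \<tau> \<sigma> \<and> verts X \<sigma> \<subseteq> S"
proof -
  let ?I = "induced X S"
  note I = delta_complex_induced[OF X, of S]
  have le: "face_le X \<tau> \<sigma>" if "face_le ?I \<tau> \<sigma>" for \<tau> \<sigma>
    using I that
  proof (induction rule: face_le_induct)
    case refl
    then show ?case using simplices_induced[OF X] by (simp add: face_le_refl)
  next
    case (step \<rho> \<sigma>)
    then obtain v where v: "\<sigma> \<in> simplices ?I" "2 \<le> card (verts ?I \<sigma>)" "v \<in> verts ?I \<sigma>" "\<rho> = dface ?I v \<sigma>"
      unfolding elem_face_iff[OF I] by auto
    then have \<sigma>: "\<sigma> \<in> simplices X" "verts X \<sigma> \<subseteq> S" using simplices_induced[OF X] by auto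
    note ve = verts_induced[OF \<sigma>]
    have "dface ?I v \<sigma> = dface X v \<sigma>"
      unfolding induced_def using \<sigma> v(2,3) ve by (intro dface_mk_dc) auto
    then have "elem_face X \<rho> \<sigma>" unfolding elem_face_iff[OF X] using v(2,3,4) ve \<sigma> by auto
    from face_le_trans[OF step(3) elem_face_le[OF X this]] show ?case .
  qed
  show ?thesis
  proof
    assume a: "face_le ?I \<tau> \<sigma>"
    show "face_le X \<tau> \<sigma> \<and> verts X \<sigma> \<subseteq> S"
      using le[OF a] face_le_simplices(2)[OF a] simplices_induced[OF X] by auto
  next
    assume a: "face_le X \<tau> \<sigma> \<and> verts X \<sigma> \<subseteq> S"
    then have \<sigma>: "\<sigma> \<in> simplices X" "verts X \<sigma> \<subseteq> S" "\<sigma> \<in> simplices ?I"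
      using face_le_simplices(2)[of X \<tau> \<sigma>] simplices_induced[OF X] by auto
    have t: "\<tau> \<in> simplices X" using face_le_simplices(1) a by metis
    have "verts X \<tau> \<subseteq> verts ?I \<sigma>" using face_le_verts[OF X] a verts_induced[OF \<sigma>(1,2)] by simp
    then obtain \<rho> where \<rho>: "face_le ?I \<rho> \<sigma>" "verts ?I \<rho> = verts X \<tau>"
      using face_exists[OF I \<sigma>(3)] verts_nonempty[OF X t] by metis
    have "\<rho> \<in> simplices X" "verts X \<rho> \<subseteq> S"
      using face_le_simplices(1)[OF \<rho>(1)] simplices_induced[OF X] by auto
    then have "\<rho> = \<tau>" using face_unique[OF X le[OF \<rho>(1)], of \<tau>] a \<rho>(2) verts_induced by metis
    then show "face_le ?I \<tau> \<sigma>" using \<rho>(1) by simp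
  qed
qed

lemma vertices_induced:
  assumes "delta_complex X"
  shows "simps (induced X S) 0 = simps X 0 \<inter> S"
proof (rule set_eqI)
  fix v
  show "v \<in> simps (induced X S) 0 \<longleftrightarrow> v \<in> simps X 0 \<inter> S"
  proof
    assume "v \<in> simps (induced X S) 0"
    then have "v \<in> simplices X" "verts X v \<subseteq> S" "verts (induced X S) v = {v}"
      unfolding vertex_iff[OF delta_complex_induced[OF assms]] simplices_induced[OF assms] by blast+
    then show "v \<in> simps X 0 \<inter> S" using verts_induced[of v X S] vertex_iff[OF assms, of v] by simp
  next
    assume "v \<in> simps X 0 \<inter> S"
    then have "v \<in> simplices X" "verts X v = {v}" "v \<in> S" unfolding Int_iff vertex_iff[OF assms] by blast+
    then show "v \<in> simps (induced X S) 0"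
      using verts_induced[of v X S]
      unfolding vertex_iff[OF delta_complex_induced[OF assms]] simplices_induced[OF assms] by simp
  qed
qed

lemma induced_vertices:
  assumes "delta_complex X"
  shows "induced X (simps X 0) = X"
proof -
  have "{\<sigma> \<in> simplices X. verts X \<sigma> \<subseteq> simps X 0} = simplices X"
    using verts_subset[OF assms] by blast
  then show ?thesis unfolding induced_def using mk_dc_of_delta_complex[OF assms] by simp
qed

lemma induced_induced:
  assumes "delta_complex X"
  shows "induced (induced X S) T = induced X (S \<inter> T)"
  unfolding induced_def[of "induced X S"] induced_def[of X "S \<inter> T"]
proof (rule mk_dc_cong)
  show "{\<sigma> \<in> simplices (induced X S). verts (induced X S) \<sigma> \<subseteq> T}
      = {\<sigma> \<in> simplices X. verts X \<sigma> \<subseteq> S \<inter> T}"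
    unfolding simplices_induced[OF assms] using verts_induced by fastforce
  fix \<sigma> assume "\<sigma> \<in> {\<sigma> \<in> simplices (induced X S). verts (induced X S) \<sigma> \<subseteq> T}"
  then have \<sigma>: "\<sigma> \<in> simplices X" "verts X \<sigma> \<subseteq> S" unfolding simplices_induced[OF assms] by auto
  show v: "verts (induced X S) \<sigma> = verts X \<sigma>" using verts_induced[OF \<sigma>] .
  show "dface (induced X S) w \<sigma> = dface X w \<sigma>"
    if "w \<in> verts (induced X S) \<sigma>" "2 \<le> card (verts (induced X S) \<sigma>)" for w
    using that unfolding v unfolding induced_def using \<sigma> by (intro dface_mk_dc) auto
qed

lemma delete_vertex_eq_induced:
  assumes X: "delta_complex X" and v: "v \<in> simps X 0"
  shows "delete_vertex X v = induced X (simps X 0 - {v})"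
proof -
  define S where "S n = {\<sigma> \<in> simps X n. \<not> face_le X v \<sigma>}" for n
  let ?P = "{\<sigma> \<in> simplices X. verts X \<sigma> \<subseteq> simps X 0 - {v}}"
  have P: "\<sigma> \<in> ?P \<longleftrightarrow> \<sigma> \<in> simplices X \<and> \<not> face_le X v \<sigma>" for \<sigma>
    using vertex_face_le_iff[OF X v, of \<sigma>] verts_subset[OF X, of \<sigma>] by auto
  have S: "S n = {\<sigma> \<in> ?P. card (verts X \<sigma>) = n + 1}" for n
    using P simps_iff[OF X, of _ n] unfolding S_def by blast
  have U: "(\<Union>n. S n) = ?P" unfolding set_eq_iff P unfolding S_def simplices_def by blast
  have "(\<Union>n \<in> {1..}. {\<sigma> \<in> S n. w \<in> verts X \<sigma>}) = {\<sigma> \<in> ?P. w \<in> verts X \<sigma> \<and> 2 \<le> card (verts X \<sigma>)}" for w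
  proof -
    have "\<exists>n\<ge>1. card (verts X \<sigma>) = n + 1" if "2 \<le> card (verts X \<sigma>)" for \<sigma>
      using that by (intro exI[of _ "card (verts X \<sigma>) - 1"]) simp
    then show ?thesis unfolding S by fastforce
  qed
  then have "delete_vertex X v = \<lparr>simps = S, verts = restrict (verts X) ?P, dface = \<lambda>w. restrict (dface X w)
      {\<sigma> \<in> ?P. w \<in> verts X \<sigma> \<and> 2 \<le> card (verts X \<sigma>)}\<rparr>"
    unfolding delete_vertex_def Let_def S_def[symmetric] U by simp
  then show ?thesis unfolding induced_def mk_dc_def S .
qed

lemma elem_strong_collapse_iff:
  assumes "delta_complex X"
  shows "elem_strong_collapse X Y \<longleftrightarrow> (\<exists>v v'. dominated_by X v v' \<and> Y = induced X (simps X 0 - {v}))"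
proof -
  have "dominated_by X v v' \<Longrightarrow> delete_vertex X v = induced X (simps X 0 - {v})" for v v'
    by (rule delete_vertex_eq_induced[OF assms]) (simp add: dominated_by_def)
  then show ?thesis unfolding elem_strong_collapse_def by metis
qed

text \<open>Lets a map change between the two codomains as the same function; in particular the
  inclusion of a full subcomplex is \<open>id\<close>.\<close>

lemma delta_map_induced_iff:
  assumes W: "delta_complex W" and X: "delta_complex X"
  shows "delta_map W (induced X S) f \<longleftrightarrow>
    delta_map W X f \<and> (\<forall>\<sigma>\<in>simplices W. verts X (f \<sigma>) \<subseteq> S)" (is "?L \<longleftrightarrow> ?R")
proof
  note I = delta_complex_induced[OF X, of S]
  assume f: ?L
  note fi = delta_map_in[OF W I f, unfolded simplices_induced[OF X]]
    and fv = delta_map_verts_eq[OF W I f] and fm = delta_map_mono[OF W I f, unfolded face_le_induced_iff[OF X]]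
  have "verts X (f \<sigma>) = f ` verts W \<sigma>" if "\<sigma> \<in> simplices W" for \<sigma>
    using fi[OF that] fv[OF that] verts_induced[of "f \<sigma>" X S] by simp
  then show ?R using delta_mapI[OF W X, of f] fi fm by simp
next
  note I = delta_complex_induced[OF X, of S]
  assume R: ?R
  then have f: "delta_map W X f" and S: "\<And>\<sigma>. \<sigma> \<in> simplices W \<Longrightarrow> verts X (f \<sigma>) \<subseteq> S" by auto
  note fi = delta_map_in[OF W X f] and fv = delta_map_verts_eq[OF W X f] and fm = delta_map_mono[OF W X f]
  show ?L
  proof (rule delta_mapI[OF W I])
    show "f \<sigma> \<in> simplices (induced X S)" if "\<sigma> \<in> simplices W" for \<sigma>
      using fi[OF that] S[OF that] by (simp add: simplices_induced[OF X])
    show "verts (induced X S) (f \<sigma>) = f ` verts W \<sigma>" if "\<sigma> \<in> simplices W" for \<sigma>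
      using verts_induced[OF fi[OF that] S[OF that]] fv[OF that] by simp
    show "face_le (induced X S) (f \<tau>) (f \<sigma>)" if "face_le W \<tau> \<sigma>" for \<tau> \<sigma>
      using fm[OF that] S[OF face_le_simplices(2)[OF that]] by (simp add: face_le_induced_iff[OF X])
  qed
qed

text \<open>Uniqueness of the joining simplex survives because induced subcomplexes are full.\<close>

lemma contiguous_induced:
  assumes W: "delta_complex W" and X: "delta_complex X" and fg: "contiguous W (induced X S) f g"
  shows "contiguous W X f g"
  unfolding contiguous_def
proof (intro conjI ballI)
  have f: "delta_map W X f" "\<And>\<sigma>. \<sigma> \<in> simplices W \<Longrightarrow> verts X (f \<sigma>) \<subseteq> S"
    and g: "delta_map W X g" "\<And>\<sigma>. \<sigma> \<in> simplices W \<Longrightarrow> verts X (g \<sigma>) \<subseteq> S"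
    using fg delta_map_induced_iff[OF W X] unfolding contiguous_def by auto
  then show "delta_map W X f" "delta_map W X g" by auto
  fix \<sigma> assume \<sigma>: "\<sigma> \<in> simplices W"
  have vf: "verts (induced X S) (f \<sigma>) = verts X (f \<sigma>)" "verts (induced X S) (g \<sigma>) = verts X (g \<sigma>)"
    using verts_induced delta_map_in[OF W X f(1) \<sigma>] delta_map_in[OF W X g(1) \<sigma>] f(2)[OF \<sigma>] g(2)[OF \<sigma>]
    by metis+
  have "\<tau> \<in> simplices (induced X S) \<and>
         verts (induced X S) \<tau> = verts (induced X S) (f \<sigma>) \<union> verts (induced X S) (g \<sigma>) \<and>
         face_le (induced X S) (f \<sigma>) \<tau> \<and> face_le (induced X S) (g \<sigma>) \<tau> \<longleftrightarrow>
      \<tau> \<in> simplices X \<and> verts X \<tau> = verts X (f \<sigma>) \<union> verts X (g \<sigma>) \<and>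
         face_le X (f \<sigma>) \<tau> \<and> face_le X (g \<sigma>) \<tau>" for \<tau>
    using f(2)[OF \<sigma>] g(2)[OF \<sigma>] verts_induced[of \<tau> X S]
    by (auto simp: simplices_induced[OF X] face_le_induced_iff[OF X] vf)
  note eq = this
  have "\<exists>!\<tau>. \<tau> \<in> simplices (induced X S) \<and>
         verts (induced X S) \<tau> = verts (induced X S) (f \<sigma>) \<union> verts (induced X S) (g \<sigma>) \<and>
         face_le (induced X S) (f \<sigma>) \<tau> \<and> face_le (induced X S) (g \<sigma>) \<tau>"
    using fg \<sigma> unfolding contiguous_def by blast
  then show "\<exists>!\<tau>. \<tau> \<in> simplices X \<and> verts X \<tau> = verts X (f \<sigma>) \<union> verts X (g \<sigma>) \<and>
      face_le X (f \<sigma>) \<tau> \<and> face_le X (g \<sigma>) \<tau>"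
    unfolding eq .
qed

text \<open>Contiguity is a condition on the pairs \<open>f \<sigma>\<close>,
  \<open>g \<sigma>\<close>, one simplex at a time; precomposition merely evaluates it at the
  simplices \<open>k \<sigma>\<close>, so uniqueness is kept on this side.\<close>

lemma contiguous_comp_right:
  assumes W: "delta_complex W" and X: "delta_complex X" and Y: "delta_complex Y"
    and fg: "contiguous X Y f g" and k: "delta_map W X k"
  shows "contiguous W Y (f \<circ> k) (g \<circ> k)"
  using fg delta_map_comp[OF W X Y k] delta_map_in[OF W X k]
  unfolding contiguous_def by simp

text \<open>The retraction pushes \<open>v\<close> to \<open>v'\<close>: a simplex
  \<open>\<sigma>\<close> containing \<open>v\<close> is enlarged by \<open>v'\<close> to
  \<open>T \<sigma>\<close> and then replaced by the face of \<open>T \<sigma>\<close> opposite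
  \<open>v\<close>. Uniqueness in the definition of domination makes \<open>T\<close>, hence the
  retraction, monotone, and it makes the contiguity with the identity genuine.\<close>

lemma dominated_vertex_retraction:
  assumes X: "delta_complex X" and dom: "dominated_by X v v'"
  shows "\<exists>r. delta_map X (induced X (simps X 0 - {v})) r \<and>
    (\<forall>\<sigma>\<in>simplices (induced X (simps X 0 - {v})). r \<sigma> = \<sigma>) \<and> contiguous X X r id"
proof -
  have v: "v \<in> simps X 0" and v': "v' \<in> simps X 0" "v' \<noteq> v" using dom by (auto simp: dominated_by_def)
  define Q where "Q \<sigma> \<tau> \<longleftrightarrow> \<tau> \<in> simplices X \<and> verts X \<tau> = verts X \<sigma> \<union> {v'} \<and> face_le X \<sigma> \<tau>" for \<sigma> \<tau>
  define T where "T \<sigma> = (THE \<tau>. Q \<sigma> \<tau>)" for \<sigma>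
  have ex1: "\<exists>!\<tau>. Q \<sigma> \<tau>" if "\<sigma> \<in> simplices X" "v \<in> verts X \<sigma>" for \<sigma>
    using dom that vertex_face_le_iff[OF X v that(1)] unfolding dominated_by_def Q_def by simp
  have Q: "Q \<sigma> (T \<sigma>)" if "\<sigma> \<in> simplices X" "v \<in> verts X \<sigma>" for \<sigma>
    unfolding T_def by (rule theI'[OF ex1[OF that]])
  have T: "T \<sigma> \<in> simplices X" "verts X (T \<sigma>) = insert v' (verts X \<sigma>)" "face_le X \<sigma> (T \<sigma>)"
    if "\<sigma> \<in> simplices X" "v \<in> verts X \<sigma>" for \<sigma>
    using Q[OF that] unfolding Q_def by auto
  have Tmono: "face_le X (T \<tau>) (T \<sigma>)"
    if ts: "face_le X \<tau> \<sigma>" and vt: "v \<in> verts X \<tau>" for \<tau> \<sigma>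
  proof -
    note s = face_le_simplices[OF ts]
    have vs: "v \<in> verts X \<sigma>" using face_le_verts[OF X ts] vt by blast
    have sub: "insert v' (verts X \<tau>) \<subseteq> verts X (T \<sigma>)"
      using face_le_verts[OF X ts] T(2)[OF s(2) vs] by auto
    \<comment> \<open>Cut \<open>T \<sigma>\<close> down to \<open>v'\<close> and the vertices of
      \<open>\<tau>\<close>: the result contains \<open>\<tau>\<close>, so uniqueness identifies it
      with \<open>T \<tau>\<close>.\<close>
    obtain \<rho> where \<rho>: "face_le X \<rho> (T \<sigma>)" "verts X \<rho> = insert v' (verts X \<tau>)"
      using face_exists[OF X T(1)[OF s(2) vs] sub] by auto
    have "face_le X \<tau> \<rho>"
      using face_le_of_verts[OF X face_le_trans[OF ts T(3)[OF s(2) vs]] \<rho>(1)] \<rho>(2) by auto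
    then have "Q \<tau> \<rho>" using \<rho>(2) face_le_simplices(1)[OF \<rho>(1)] by (simp add: Q_def)
    then have "T \<tau> = \<rho>" using ex1[OF s(1) vt] Q[OF s(1) vt] by auto
    then show ?thesis using \<rho>(1) by simp
  qed
  \<comment> \<open>If \<open>v'\<close> already lies in \<open>\<sigma>\<close>, then
    \<open>T \<sigma>\<close> is \<open>\<sigma>\<close>, and \<open>r \<sigma>\<close> is its face
    opposite \<open>v\<close>. As \<open>v'\<close> differs from \<open>v\<close>, the prescribed
    vertex set is never empty.\<close>
  define r where "r \<sigma> = (if v \<in> verts X \<sigma> then span_face X (insert v' (verts X \<sigma>) - {v}) (T \<sigma>) else \<sigma>)" for \<sigma>
  have r1: "face_le X (r \<sigma>) (T \<sigma>)" "verts X (r \<sigma>) = insert v' (verts X \<sigma>) - {v}"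
    if "\<sigma> \<in> simplices X" "v \<in> verts X \<sigma>" for \<sigma>
    unfolding r_def using span_face[OF X T(1)[OF that], of "insert v' (verts X \<sigma>) - {v}"] T(2)[OF that]
      that(2) v'(2) by auto
  have r2: "r \<sigma> = \<sigma>" if "v \<notin> verts X \<sigma>" for \<sigma> using that by (simp add: r_def)
  have rin: "r \<sigma> \<in> simplices X" if "\<sigma> \<in> simplices X" for \<sigma>
    using face_le_simplices(1)[OF r1(1)[OF that]] r2[of \<sigma>] that by (cases "v \<in> verts X \<sigma>") auto
  have vv: "verts X v = {v}" "v \<in> simplices X" using v vertex_iff[OF X, of v] by auto
  have rv: "r v = v'"
  proof -
    have "verts X (r v) = {v'}" using r1(2)[of v] vv v'(2) by auto
    then have "{r v} = {v'}" using verts_card_1[OF X rin[OF vv(2)]] by simp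
    then show ?thesis by simp
  qed
  have ru: "r u = u" if "u \<in> simps X 0" "u \<noteq> v" for u
    using that vertex_iff[OF X, of u] by (intro r2) auto
  have rverts: "verts X (r \<sigma>) = r ` verts X \<sigma>" if \<sigma>: "\<sigma> \<in> simplices X" for \<sigma>
  proof -
    have "r ` (verts X \<sigma> - {v}) = verts X \<sigma> - {v}"
      using ru verts_subset[OF X \<sigma>] by (force simp: image_iff)
    then show ?thesis
      using r1(2)[OF \<sigma>] r2[of \<sigma>] rv v'(2) image_insert[of r v "verts X \<sigma> - {v}"]
      by (cases "v \<in> verts X \<sigma>") (auto simp: insert_absorb)
  qed
  have rmono: "face_le X (r \<tau>) (r \<sigma>)" if ts: "face_le X \<tau> \<sigma>" for \<tau> \<sigma>
  proof -
    note s = face_le_simplices[OF ts] and sub = face_le_verts[OF X ts]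
    consider "v \<notin> verts X \<sigma>" | "v \<notin> verts X \<tau>" "v \<in> verts X \<sigma>" | "v \<in> verts X \<tau>" by blast
    then show ?thesis
    proof cases
      case 1
      then have "v \<notin> verts X \<tau>" using sub by blast
      then show ?thesis using ts r2[OF 1] r2[of \<tau>] by simp
    next
      case 2
      \<comment> \<open>The mixed case: \<open>r\<close> fixes \<open>\<tau>\<close> but moves
        \<open>\<sigma>\<close>. Both \<open>\<tau>\<close> and \<open>r \<sigma>\<close> are faces
        of \<open>T \<sigma>\<close>, so their vertex sets decide.\<close>
      have "face_le X \<tau> (T \<sigma>)" by (rule face_le_trans[OF ts T(3)[OF s(2) 2(2)]])
      moreover have "verts X \<tau> \<subseteq> verts X (r \<sigma>)" using r1(2)[OF s(2) 2(2)] sub 2(1) by auto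
      ultimately show ?thesis
        using face_le_of_verts[OF X _ r1(1)[OF s(2) 2(2)]] r2[OF 2(1)] by simp
    next
      case 3
      then have 4: "v \<in> verts X \<sigma>" using sub by blast
      have "verts X (r \<tau>) \<subseteq> verts X (r \<sigma>)" using r1(2)[OF s(1) 3] r1(2)[OF s(2) 4] sub by auto
      then show ?thesis
        using face_le_of_verts[OF X face_le_trans[OF r1(1)[OF s(1) 3] Tmono[OF ts 3]] r1(1)[OF s(2) 4]]
        by simp
    qed
  qed
  have rmap: "delta_map X X r" by (rule delta_mapI[OF X X rin rverts rmono])
  have rS: "verts X (r \<sigma>) \<subseteq> simps X 0 - {v}" if \<sigma>: "\<sigma> \<in> simplices X" for \<sigma>
    using r1(2)[OF \<sigma>] r2[of \<sigma>] verts_subset[OF X \<sigma>] v' by (cases "v \<in> verts X \<sigma>") auto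
  have "contiguous X X r id"
    unfolding contiguous_def
  proof (intro conjI ballI rmap delta_map_id[OF X])
    fix \<sigma> assume \<sigma>: "\<sigma> \<in> simplices X"
    show "\<exists>!\<tau>. \<tau> \<in> simplices X \<and> verts X \<tau> = verts X (r \<sigma>) \<union> verts X (id \<sigma>) \<and>
       face_le X (r \<sigma>) \<tau> \<and> face_le X (id \<sigma>) \<tau>"
    proof (cases "v \<in> verts X \<sigma>")
      case True
      \<comment> \<open>Restoring \<open>v\<close> leaves \<open>v'\<close> as the only possible
        addition, so a simplex joining \<open>r \<sigma>\<close> and \<open>\<sigma>\<close> is one
        of those that domination declares unique.\<close>
      have u: "verts X (r \<sigma>) \<union> verts X \<sigma> = verts X \<sigma> \<union> {v'}" using r1(2)[OF \<sigma> True] True by auto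
      show ?thesis
      proof (rule ex1I[of _ "T \<sigma>"])
        show "T \<sigma> \<in> simplices X \<and> verts X (T \<sigma>) = verts X (r \<sigma>) \<union> verts X (id \<sigma>) \<and>
           face_le X (r \<sigma>) (T \<sigma>) \<and> face_le X (id \<sigma>) (T \<sigma>)"
          using T[OF \<sigma> True] r1(1)[OF \<sigma> True] u by simp
        fix \<tau> assume "\<tau> \<in> simplices X \<and> verts X \<tau> = verts X (r \<sigma>) \<union> verts X (id \<sigma>) \<and>
           face_le X (r \<sigma>) \<tau> \<and> face_le X (id \<sigma>) \<tau>"
        then have "Q \<sigma> \<tau>" using u by (simp add: Q_def)
        then show "\<tau> = T \<sigma>" using ex1[OF \<sigma> True] Q[OF \<sigma> True] by auto
      qed
    next
      case False
      show ?thesis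
      proof (rule ex1I[of _ \<sigma>])
        show "\<sigma> \<in> simplices X \<and> verts X \<sigma> = verts X (r \<sigma>) \<union> verts X (id \<sigma>) \<and>
           face_le X (r \<sigma>) \<sigma> \<and> face_le X (id \<sigma>) \<sigma>"
          using r2[OF False] \<sigma> face_le_refl[OF \<sigma>] by simp
        fix \<tau> assume a: "\<tau> \<in> simplices X \<and> verts X \<tau> = verts X (r \<sigma>) \<union> verts X (id \<sigma>) \<and>
           face_le X (r \<sigma>) \<tau> \<and> face_le X (id \<sigma>) \<tau>"
        then show "\<tau> = \<sigma>" using face_le_verts_eq[OF X, of \<sigma> \<tau>] r2[OF False] by simp
      qed
    qed
  qed
  moreover have "delta_map X (induced X (simps X 0 - {v})) r"
    unfolding delta_map_induced_iff[OF X X] using rmap rS by simp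
  moreover have "r \<sigma> = \<sigma>" if "\<sigma> \<in> simplices (induced X (simps X 0 - {v}))" for \<sigma>
    using that r2[of \<sigma>] unfolding simplices_induced[OF X] by blast
  ultimately show ?thesis by blast
qed

section \<open>Cores\<close>

text \<open>The common value is itself a joining simplex, and it is the only one because a face with
  all the vertices is the whole simplex.\<close>

lemma contiguous_of_eq:
  assumes X: "delta_complex X" and Y: "delta_complex Y" and f: "delta_map X Y f"
    and eq: "\<And>\<sigma>. \<sigma> \<in> simplices X \<Longrightarrow> f \<sigma> = g \<sigma>"
  shows "contiguous X Y f g"
  unfolding contiguous_def
proof (intro conjI ballI f delta_map_cong[OF X Y f eq])
  fix \<sigma> assume \<sigma>: "\<sigma> \<in> simplices X"
  show "\<exists>!\<tau>. \<tau> \<in> simplices Y \<and> verts Y \<tau> = verts Y (f \<sigma>) \<union> verts Y (g \<sigma>) \<and>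
      face_le Y (f \<sigma>) \<tau> \<and> face_le Y (g \<sigma>) \<tau>"
  proof (rule ex1I[of _ "f \<sigma>"])
    show "f \<sigma> \<in> simplices Y \<and> verts Y (f \<sigma>) = verts Y (f \<sigma>) \<union> verts Y (g \<sigma>) \<and>
      face_le Y (f \<sigma>) (f \<sigma>) \<and> face_le Y (g \<sigma>) (f \<sigma>)"
      using eq[OF \<sigma>] delta_map_in[OF X Y f \<sigma>] by (simp add: face_le_refl)
    fix \<tau> assume "\<tau> \<in> simplices Y \<and> verts Y \<tau> = verts Y (f \<sigma>) \<union> verts Y (g \<sigma>) \<and>
      face_le Y (f \<sigma>) \<tau> \<and> face_le Y (g \<sigma>) \<tau>"
    then show "\<tau> = f \<sigma>" using face_le_verts_eq[OF Y, of "f \<sigma>" \<tau>] eq[OF \<sigma>] by simp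
  qed
qed

text \<open>Each collapse contributes a retraction \<open>q\<close> of the current subcomplex
  \<open>Y\<close>. Its contiguity with the identity survives precomposition with \<open>r\<close>
  and, as \<open>Y\<close> is full in \<open>X\<close>, also the passage from \<open>Y\<close> to
  \<open>X\<close>; thus genuine contiguity is kept along the whole sequence.\<close>

lemma strong_collapse_retraction:
  assumes X: "delta_complex X" and c: "strong_collapse X Y"
  shows "\<exists>S r. Y = induced X S \<and> delta_map X Y r \<and> (\<forall>\<sigma>\<in>simplices Y. r \<sigma> = \<sigma>) \<and>
    equivclp (contiguous X X) r id"
  using c unfolding strong_collapse_def
proof induction
  case base
  then show ?case using induced_vertices[OF X] delta_map_id[OF X] by (metis id_apply equivclp_refl)
next
  case (step Y Z)
  then obtain S r where Y_eq: "Y = induced X S" and r: "delta_map X Y r"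
    and rY: "\<forall>\<sigma>\<in>simplices Y. r \<sigma> = \<sigma>" and eq: "equivclp (contiguous X X) r id" by blast
  have Y: "delta_complex Y" unfolding Y_eq by (rule delta_complex_induced[OF X])
  obtain v v' where v: "dominated_by Y v v'" and Z_eq: "Z = induced Y (simps Y 0 - {v})"
    using step(2) unfolding elem_strong_collapse_iff[OF Y] by blast
  have Z: "delta_complex Z" unfolding Z_eq by (rule delta_complex_induced[OF Y])
  obtain q where q: "delta_map Y Z q" "\<forall>\<sigma>\<in>simplices Z. q \<sigma> = \<sigma>" "contiguous Y Y q id"
    using dominated_vertex_retraction[OF Y v] unfolding Z_eq by blast
  have "contiguous X Y (q \<circ> r) (id \<circ> r)" by (rule contiguous_comp_right[OF X Y Y q(3) r])
  then have "contiguous X X (q \<circ> r) r" using contiguous_induced[OF X X] unfolding Y_eq by simp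
  then have "equivclp (contiguous X X) (q \<circ> r) id"
    using eq by (metis equivclp_trans r_into_equivclp)
  moreover have "Z = induced X (S \<inter> (simps Y 0 - {v}))"
    unfolding Z_eq unfolding Y_eq by (rule induced_induced[OF X])
  moreover have "(q \<circ> r) \<sigma> = \<sigma>" if "\<sigma> \<in> simplices Z" for \<sigma>
  proof -
    have "\<sigma> \<in> simplices Y" using that unfolding Z_eq simplices_induced[OF Y] by blast
    then show ?thesis using rY q(2) that by simp
  qed
  ultimately show ?case using delta_map_comp[OF X Y Z r q(1)] by blast
qed

lemma coh_equivalent_of_strong_collapse:
  assumes X: "delta_complex X" and c: "strong_collapse X Y"
  shows "coh_equivalent X Y"
proof -
  obtain S r where Y_eq: "Y = induced X S" and r: "delta_map X Y r"
    and rY: "\<forall>\<sigma>\<in>simplices Y. r \<sigma> = \<sigma>" and eq: "equivclp (contiguous X X) r id"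
    using strong_collapse_retraction[OF assms] by blast
  have Y: "delta_complex Y" unfolding Y_eq by (rule delta_complex_induced[OF X])
  have i: "delta_map Y X id"
    using delta_map_induced_iff[OF Y X, of S id] delta_map_id[OF Y] unfolding Y_eq by blast
  have "coh_contiguous Y Y (r \<circ> id) id"
    by (rule coh_contiguous_of_eq[OF Y Y delta_map_comp[OF Y X Y i r]]) (simp add: rY)
  then show ?thesis
    unfolding coh_equivalent_def using r i coh_homotopic_of_equivclp[OF X X eq]
    by (intro exI[of _ r] exI[of _ id]) simp
qed

text \<open>The round trips cancel: \<open>s\<close> fixes the simplices coming from
  \<open>f\<close>, and \<open>g\<close> undoes \<open>f\<close>, so what remains on
  \<open>X\<close> is the retraction \<open>r\<close>, which is already linked to the identity. In
  this way no contiguity is ever postcomposed with \<open>f\<close> or \<open>g\<close>.\<close>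

lemma strongly_equivalent_of_collapses:
  assumes X: "delta_complex X" and Y: "delta_complex Y"
    and cX: "strong_collapse X X'" and cY: "strong_collapse Y Y'"
    and f: "delta_map X' Y' f" and g: "delta_map Y' X' g"
    and gf: "\<forall>\<sigma>\<in>simplices X'. g (f \<sigma>) = \<sigma>" and fg: "\<forall>\<sigma>\<in>simplices Y'. f (g \<sigma>) = \<sigma>"
  shows "strongly_equivalent X Y"
proof -
  obtain S r where X'_eq: "X' = induced X S" and r: "delta_map X X' r"
    and rX: "\<forall>\<sigma>\<in>simplices X'. r \<sigma> = \<sigma>" and r_eq: "equivclp (contiguous X X) r id"
    using strong_collapse_retraction[OF X cX] by blast
  obtain T s where Y'_eq: "Y' = induced Y T" and s: "delta_map Y Y' s"
    and sY: "\<forall>\<sigma>\<in>simplices Y'. s \<sigma> = \<sigma>" and s_eq: "equivclp (contiguous Y Y) s id"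
    using strong_collapse_retraction[OF Y cY] by blast
  have X': "delta_complex X'" unfolding X'_eq by (rule delta_complex_induced[OF X])
  have Y': "delta_complex Y'" unfolding Y'_eq by (rule delta_complex_induced[OF Y])
  let ?F = "f \<circ> r" and ?G = "g \<circ> s"
  have F: "delta_map X Y ?F"
    using delta_map_comp[OF X X' Y' r f] unfolding Y'_eq delta_map_induced_iff[OF X Y] by blast
  have G: "delta_map Y X ?G"
    using delta_map_comp[OF Y Y' X' s g] unfolding X'_eq delta_map_induced_iff[OF Y X] by blast
  have "(?G \<circ> ?F) \<sigma> = r \<sigma>" if "\<sigma> \<in> simplices X" for \<sigma>
    using delta_map_in[OF X X' r that] delta_map_in[OF X' Y' f] sY gf by simp
  then have "contiguous X X (?G \<circ> ?F) r"
    by (rule contiguous_of_eq[OF X X delta_map_comp[OF X Y X F G]])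
  moreover have "(?F \<circ> ?G) \<sigma> = s \<sigma>" if "\<sigma> \<in> simplices Y" for \<sigma>
    using delta_map_in[OF Y Y' s that] delta_map_in[OF Y' X' g] rX fg by simp
  then have "contiguous Y Y (?F \<circ> ?G) s"
    by (rule contiguous_of_eq[OF Y Y delta_map_comp[OF Y X Y G F]])
  ultimately have "equivclp (contiguous X X) (?G \<circ> ?F) id" "equivclp (contiguous Y Y) (?F \<circ> ?G) id"
    using r_eq s_eq by (metis equivclp_trans r_into_equivclp)+
  then show ?thesis
    unfolding strongly_equivalent_def map_equiv_def
    using F G delta_map_comp[OF X Y X F G] delta_map_comp[OF Y X Y G F] delta_map_id[OF X] delta_map_id[OF Y]
    by blast
qed

section \<open>Minimal complexes: existence and rigidity\<close>

definition minimal_dc :: "'a dcomplex \<Rightarrow> bool" where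
  "minimal_dc X \<longleftrightarrow> (\<nexists>v v'. dominated_by X v v')"

lemma finite_delta_complex_induced:
  "finite_delta_complex X \<Longrightarrow> finite_delta_complex (induced X S)"
  unfolding finite_delta_complex_def by (simp add: delta_complex_induced simplices_induced)

lemma finite_delta_complex_strong_collapse:
  assumes "finite_delta_complex X" "strong_collapse X Y"
  shows "finite_delta_complex Y"
proof -
  have "delta_complex X" using assms(1) by (simp add: finite_delta_complex_def)
  then obtain S where "Y = induced X S" using strong_collapse_retraction[OF _ assms(2)] by blast
  then show ?thesis using finite_delta_complex_induced[OF assms(1)] by simp
qed

text \<open>Each elementary collapse removes at least the simplex \<open>v\<close> itself, so the
  number of simplices drops.\<close>

lemma core_exists:
  assumes "finite_delta_complex X"
  shows "\<exists>X'. strong_collapse X X' \<and> minimal_dc X'"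
  using assms
proof (induction "card (simplices X)" arbitrary: X rule: less_induct)
  case less
  show ?case
  proof (cases "minimal_dc X")
    case True
    then show ?thesis unfolding strong_collapse_def by blast
  next
    case False
    then obtain v v' where v: "dominated_by X v v'" unfolding minimal_dc_def by blast
    have X: "delta_complex X" "finite (simplices X)"
      using less.prems unfolding finite_delta_complex_def by auto
    let ?Y = "induced X (simps X 0 - {v})"
    have c: "elem_strong_collapse X ?Y" unfolding elem_strong_collapse_iff[OF X(1)] using v by blast
    have "v \<in> simps X 0" using v unfolding dominated_by_def by blast
    then have "v \<in> simplices X" "verts X v = {v}" unfolding vertex_iff[OF X(1)] by auto
    then have "simplices ?Y \<subset> simplices X" unfolding simplices_induced[OF X(1)] by auto
    then have "card (simplices ?Y) < card (simplices X)" by (rule psubset_card_mono[OF X(2)])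
    from less.hyps[OF this finite_delta_complex_induced[OF less.prems]]
    obtain X' where "strong_collapse ?Y X'" "minimal_dc X'" by blast
    then show ?thesis using c unfolding strong_collapse_def by (meson converse_rtranclp_into_rtranclp)
  qed
qed

text \<open>Assume that \<open>h\<close> moves a vertex \<open>v\<close> of \<open>\<sigma>\<close>.
  The extension of \<open>\<sigma>\<close> by \<open>h v\<close> is cut out of
  \<open>T \<sigma>\<close>, and it is unique because \<open>T\<close> is monotone. Once all
  vertices are fixed, \<open>\<sigma>\<close> and \<open>h \<sigma>\<close> are faces of
  \<open>T \<sigma>\<close> with the same vertices. The map \<open>g\<close> is only required to fix
  the simplices, which is all that a preceding step of a chain can provide.\<close>

lemma minimal_dc_coh_contiguous:
  assumes X: "delta_complex X" and min: "minimal_dc X"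
    and gh: "coh_contiguous X X g h" and g: "\<And>\<sigma>. \<sigma> \<in> simplices X \<Longrightarrow> g \<sigma> = \<sigma>"
    and \<sigma>: "\<sigma> \<in> simplices X"
  shows "h \<sigma> = \<sigma>"
proof (rule coh_contiguousE[OF gh])
  fix T
  assume h: "delta_map X X h"
    and T: "\<And>\<sigma>. \<sigma> \<in> simplices X \<Longrightarrow> verts X (T \<sigma>) = verts X (g \<sigma>) \<union> verts X (h \<sigma>)"
      "\<And>\<sigma>. \<sigma> \<in> simplices X \<Longrightarrow> face_le X (g \<sigma>) (T \<sigma>)"
      "\<And>\<sigma>. \<sigma> \<in> simplices X \<Longrightarrow> face_le X (h \<sigma>) (T \<sigma>)"
    and mono: "\<And>\<tau> \<sigma>. face_le X \<tau> \<sigma> \<Longrightarrow> face_le X (T \<tau>) (T \<sigma>)"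
  note hv = delta_map_verts_eq[OF X X h] and hi = delta_map_in[OF X X h]
  have fix_vertex: "h v = v" if v: "v \<in> simps X 0" for v
  proof (rule ccontr)
    assume ne: "h v \<noteq> v"
    have v1: "v \<in> simplices X" "verts X v = {v}" using v unfolding vertex_iff[OF X] by auto
    have hv0: "h v \<in> simps X 0" unfolding vertex_iff[OF X] using hi[OF v1(1)] hv[OF v1(1)] v1(2) by simp
    have "\<exists>!\<tau>. \<tau> \<in> simplices X \<and> verts X \<tau> = verts X \<sigma> \<union> {h v} \<and> face_le X \<sigma> \<tau>"
      if \<sigma>: "\<sigma> \<in> simplices X" and "face_le X v \<sigma>" for \<sigma>
    proof -
      have "v \<in> verts X \<sigma>" using that vertex_face_le_iff[OF X v] by blast
      then have "verts X \<sigma> \<union> {h v} \<subseteq> verts X (T \<sigma>)" using T(1)[OF \<sigma>] hv[OF \<sigma>] g[OF \<sigma>] by auto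
      then obtain \<rho> where \<rho>: "face_le X \<rho> (T \<sigma>)" "verts X \<rho> = verts X \<sigma> \<union> {h v}"
        using face_exists[OF X face_le_simplices(2)[OF T(2)[OF \<sigma>]], of "verts X \<sigma> \<union> {h v}"] by auto
      have le: "face_le X \<sigma> \<rho>"
        using face_le_of_verts[OF X _ \<rho>(1), of \<sigma>] T(2)[OF \<sigma>] g[OF \<sigma>] \<rho>(2) by auto
      show ?thesis
      proof (rule ex1I[of _ \<rho>])
        show "\<rho> \<in> simplices X \<and> verts X \<rho> = verts X \<sigma> \<union> {h v} \<and> face_le X \<sigma> \<rho>"
          using \<rho>(2) le face_le_simplices(2)[OF le] by blast
        fix \<tau> assume \<tau>: "\<tau> \<in> simplices X \<and> verts X \<tau> = verts X \<sigma> \<union> {h v} \<and> face_le X \<sigma> \<tau>"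
        \<comment> \<open>A competing extension \<open>\<tau>\<close> contains
          \<open>\<sigma>\<close>, so monotonicity puts \<open>T \<sigma>\<close>, and with it
          \<open>\<rho>\<close>, below \<open>T \<tau>\<close>. Since \<open>\<tau>\<close> lies
          there as well, both are faces of one simplex.\<close>
        then have "face_le X \<tau> (T \<tau>)" using T(2)[of \<tau>] g[of \<tau>] by simp
        moreover have "face_le X \<rho> (T \<tau>)" using \<tau> face_le_trans[OF \<rho>(1) mono] by blast
        ultimately show "\<tau> = \<rho>" using face_unique[OF X] \<tau> \<rho>(2) by metis
      qed
    qed
    then have "dominated_by X v (h v)" unfolding dominated_by_def using v hv0 ne by blast
    then show False using min unfolding minimal_dc_def by blast
  qed
  then have "h ` verts X \<sigma> = verts X \<sigma>" using verts_subset[OF X \<sigma>] by (force simp: image_iff)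
  then have v: "verts X (h \<sigma>) = verts X \<sigma>" "verts X (T \<sigma>) = verts X \<sigma>"
    using hv[OF \<sigma>] T(1)[OF \<sigma>] g[OF \<sigma>] by auto
  show "h \<sigma> = \<sigma>" using face_unique[OF X T(3)[OF \<sigma>] T(2)[OF \<sigma>]] g[OF \<sigma>] v by simp
qed

text \<open>The chain is read starting from \<open>id\<close>: rigidity passes from each map to the
  next, so every map in it fixes all simplices.\<close>

lemma minimal_dc_coh_homotopic:
  assumes X: "delta_complex X" "minimal_dc X" and h: "coh_homotopic X X h id" and \<sigma>: "\<sigma> \<in> simplices X"
  shows "h \<sigma> = \<sigma>"
proof -
  have "coh_homotopic X X id h" by (rule coh_homotopic_sym[OF h])
  then have "\<forall>\<sigma>\<in>simplices X. h \<sigma> = \<sigma>"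
  proof induction
    case (step g h)
    then show ?case using minimal_dc_coh_contiguous[OF X step(2)] by blast
  qed simp
  then show ?thesis using \<sigma> by blast
qed

lemma minimal_dc_coh_equivalent:
  assumes "delta_complex X" "minimal_dc X" "delta_complex Y" "minimal_dc Y" "coh_equivalent X Y"
  shows "\<exists>f g. delta_map X Y f \<and> delta_map Y X g \<and>
    (\<forall>\<sigma>\<in>simplices X. g (f \<sigma>) = \<sigma>) \<and> (\<forall>\<sigma>\<in>simplices Y. f (g \<sigma>) = \<sigma>)"
proof -
  obtain f g where fg: "delta_map X Y f" "delta_map Y X g"
    "coh_homotopic X X (g \<circ> f) id" "coh_homotopic Y Y (f \<circ> g) id"
    using assms(5) unfolding coh_equivalent_def by blast
  then show ?thesis
    using minimal_dc_coh_homotopic[OF assms(1,2) fg(3)] minimal_dc_coh_homotopic[OF assms(3,4) fg(4)]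
    by (intro exI[of _ f] exI[of _ g]) simp
qed

section \<open>Isomorphisms\<close>

text \<open>Bijectivity on simplices makes the inverse monotone too, since faces are then reflected
  as well as preserved (\<open>dc_iso_face_le_iff\<close>).\<close>

definition dc_iso :: "'a dcomplex \<Rightarrow> 'b dcomplex \<Rightarrow> ('a \<Rightarrow> 'b) \<Rightarrow> bool" where
  "dc_iso X Y f \<longleftrightarrow> delta_map X Y f \<and> bij_betw f (simplices X) (simplices Y)"

lemma dc_isoD:
  assumes "dc_iso X Y f"
  shows "delta_map X Y f" "inj_on f (simplices X)" "f ` simplices X = simplices Y"
  using assms by (auto simp: dc_iso_def bij_betw_def)

lemma inj_on_verts:
  assumes "delta_complex X" "inj_on f (simplices X)" "\<sigma> \<in> simplices X"
  shows "inj_on f (verts X \<sigma>)"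
  by (rule inj_on_subset[OF assms(2)]) (use vertex_of_simplex[OF assms(1,3)] in blast)

text \<open>To reflect a face relation, take the face of \<open>\<sigma>\<close> on the vertices of
  \<open>\<tau>\<close>: its image and \<open>f \<tau>\<close> are faces of
  \<open>f \<sigma>\<close> with the same vertices, so they agree and injectivity applies.\<close>

lemma dc_iso_face_le_iff:
  assumes X: "delta_complex X" and Y: "delta_complex Y" and f: "dc_iso X Y f"
    and \<tau>: "\<tau> \<in> simplices X" and \<sigma>: "\<sigma> \<in> simplices X"
  shows "face_le Y (f \<tau>) (f \<sigma>) \<longleftrightarrow> face_le X \<tau> \<sigma>"
proof
  note fm = dc_isoD(1)[OF f] and inj = dc_isoD(2)[OF f]
  note fv = delta_map_verts_eq[OF X Y fm]
  assume le: "face_le Y (f \<tau>) (f \<sigma>)"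
  have "f ` verts X \<tau> \<subseteq> f ` verts X \<sigma>" using face_le_verts[OF Y le] fv[OF \<sigma>] fv[OF \<tau>] by simp
  then have "verts X \<tau> \<subseteq> verts X \<sigma>"
    using inj_on_image_mem_iff[OF inj _ subsetI, OF vertex_of_simplex[OF X \<tau>] vertex_of_simplex[OF X \<sigma>]]
    by blast
  then obtain \<rho> where \<rho>: "face_le X \<rho> \<sigma>" "verts X \<rho> = verts X \<tau>"
    using face_exists[OF X \<sigma> _ verts_nonempty[OF X \<tau>]] by blast
  note \<rho>s = face_le_simplices(1)[OF \<rho>(1)]
  have "f \<rho> = f \<tau>"
    by (rule face_unique[OF Y delta_map_mono[OF X Y fm \<rho>(1)] le]) (simp add: fv[OF \<tau>] fv[OF \<rho>s] \<rho>(2))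
  then have "\<rho> = \<tau>" using inj_onD[OF inj _ \<rho>s \<tau>] by simp
  then show "face_le X \<tau> \<sigma>" using \<rho>(1) by simp
qed (rule delta_map_mono[OF X Y dc_isoD(1)[OF f]])

lemma dc_iso_comp:
  assumes "delta_complex X" "delta_complex Y" "delta_complex Z" "dc_iso X Y f" "dc_iso Y Z g"
  shows "dc_iso X Z (g \<circ> f)"
  using assms(4,5) delta_map_comp[OF assms(1-3)] bij_betw_trans unfolding dc_iso_def by blast

lemma dc_isoI_inverse:
  assumes X: "delta_complex X" and Y: "delta_complex Y"
    and f: "delta_map X Y f" and g: "delta_map Y X g"
    and gf: "\<forall>\<sigma>\<in>simplices X. g (f \<sigma>) = \<sigma>" and fg: "\<forall>\<sigma>\<in>simplices Y. f (g \<sigma>) = \<sigma>"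
  shows "dc_iso X Y f"
proof -
  have "bij_betw f (simplices X) (simplices Y)"
    by (rule bij_betw_byWitness[where f' = g])
      (use gf fg delta_map_in[OF X Y f] delta_map_in[OF Y X g] in blast)+
  then show ?thesis using f unfolding dc_iso_def by blast
qed

lemma dc_iso_dface:
  assumes X: "delta_complex X" and Y: "delta_complex Y" and f: "dc_iso X Y f"
    and \<sigma>: "\<sigma> \<in> simplices X" and w: "w \<in> verts X \<sigma>" and c: "2 \<le> card (verts X \<sigma>)"
  shows "dface Y (f w) (f \<sigma>) = f (dface X w \<sigma>)"
proof -
  have n: "\<sigma> \<in> simps X (card (verts X \<sigma>) - 1)" "1 \<le> card (verts X \<sigma>) - 1"
    using \<sigma> c by (auto simp: simps_iff[OF X])
  have "\<forall>u\<in>verts X \<sigma> - {w}. f w \<noteq> f u"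
    using inj_on_verts[OF X dc_isoD(2)[OF f] \<sigma>] w by (auto simp: inj_on_def)
  then show ?thesis using delta_map_dface[OF dc_isoD(1)[OF f] n w] by simp
qed

text \<open>The map forces the structure of its target: vertices and faces of
  \<open>f \<sigma>\<close> are the images of those of \<open>\<sigma>\<close>. This yields literal
  equality of complexes where an isomorphism would not do.\<close>

lemma dc_iso_unique:
  assumes X: "delta_complex X" and Y: "delta_complex Y" and Y': "delta_complex Y'"
    and f: "dc_iso X Y f" and g: "dc_iso X Y' g"
    and eq: "\<And>\<sigma>. \<sigma> \<in> simplices X \<Longrightarrow> f \<sigma> = g \<sigma>"
  shows "Y = Y'"
proof -
  have im: "g ` simplices X = f ` simplices X" using eq by (intro image_cong) auto
  have vY: "verts Y (f \<sigma>) = f ` verts X \<sigma>" if "\<sigma> \<in> simplices X" for \<sigma>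
    using delta_map_verts_eq[OF X Y dc_isoD(1)[OF f] that] .
  have g: "dc_iso X Y' f"
  proof -
    have "delta_map X Y' f" by (rule delta_map_cong[OF X Y' dc_isoD(1)[OF g]]) (simp add: eq)
    moreover have "bij_betw f (simplices X) (simplices Y')"
      using g bij_betw_cong[of "simplices X" f g] eq unfolding dc_iso_def by blast
    ultimately show ?thesis by (simp add: dc_iso_def)
  qed
  have vY': "verts Y' (f \<sigma>) = f ` verts X \<sigma>" if "\<sigma> \<in> simplices X" for \<sigma>
    using delta_map_verts_eq[OF X Y' dc_isoD(1)[OF g] that] .
  have "mk_dc (simplices Y) (verts Y) (dface Y) = mk_dc (simplices Y') (verts Y') (dface Y')"
  proof (rule mk_dc_cong)
    show "simplices Y = simplices Y'" using dc_isoD(3)[OF f] dc_isoD(3)[OF g] by simp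
    fix \<sigma>' assume "\<sigma>' \<in> simplices Y"
    then obtain \<sigma> where \<sigma>: "\<sigma> \<in> simplices X" "\<sigma>' = f \<sigma>" using dc_isoD(3)[OF f] by blast
    show "verts Y \<sigma>' = verts Y' \<sigma>'" using vY vY' \<sigma> by simp
    fix w' assume w': "w' \<in> verts Y \<sigma>'" and c: "2 \<le> card (verts Y \<sigma>')"
    obtain w where w: "w \<in> verts X \<sigma>" "w' = f w" using w' vY[OF \<sigma>(1)] \<sigma>(2) by auto
    have c': "2 \<le> card (verts X \<sigma>)"
      using c vY[OF \<sigma>(1)] \<sigma>(2) card_image[OF inj_on_verts[OF X dc_isoD(2)[OF f] \<sigma>(1)]] by simp
    show "dface Y w' \<sigma>' = dface Y' w' \<sigma>'"
      using dc_iso_dface[OF X Y f \<sigma>(1) w(1) c'] dc_iso_dface[OF X Y' g \<sigma>(1) w(1) c'] w(2) \<sigma>(2) by simp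
  qed
  then show ?thesis unfolding mk_dc_of_delta_complex[OF Y] mk_dc_of_delta_complex[OF Y'] .
qed

text \<open>Transport of structure along an injective renaming of simplices. It supplies copies of a
  complex in another type or on prescribed names.\<close>

lemma dc_iso_image_exists:
  assumes X: "delta_complex X" and inj: "inj_on f (simplices X)"
  shows "\<exists>Y. delta_complex Y \<and> dc_iso X Y f"
proof -
  define h where "h = inv_into (simplices X) f"
  define P where "P = f ` simplices X"
  define V where "V = (\<lambda>x. f ` verts X (h x))"
  define D where "D = (\<lambda>w x. f (dface X (h w) (h x)))"
  have h: "h (f \<sigma>) = \<sigma>" if "\<sigma> \<in> simplices X" for \<sigma> unfolding h_def by (rule inv_into_f_f[OF inj that])
  have V: "V (f \<sigma>) = f ` verts X \<sigma>" if "\<sigma> \<in> simplices X" for \<sigma> unfolding V_def h[OF that] ..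
  have D: "D (f w) (f \<sigma>) = f (dface X w \<sigma>)" if "\<sigma> \<in> simplices X" "w \<in> verts X \<sigma>" for w \<sigma>
    unfolding D_def h[OF that(1)] h[OF vertex_of_simplex[OF X that]] ..
  have c: "card (V (f \<sigma>)) = card (verts X \<sigma>)" if "\<sigma> \<in> simplices X" for \<sigma>
    unfolding V[OF that] by (rule card_image[OF inj_on_verts[OF X inj that]])
  have fd: "face_data P V D"
    unfolding face_data_def
  proof (intro ballI conjI impI)
    fix x assume "x \<in> P"
    then obtain \<sigma> where \<sigma>: "\<sigma> \<in> simplices X" and x: "x = f \<sigma>" unfolding P_def by blast
    note Vx = V[OF \<sigma>]
    show "finite (V x)" "V x \<noteq> {}"
      unfolding x Vx using finite_verts[OF X \<sigma>] verts_nonempty[OF X \<sigma>] by auto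
    show "V x = {x}" if "card (V x) = 1"
    proof -
      have "verts X \<sigma> = {\<sigma>}" using verts_card_1[OF X \<sigma>] that unfolding x c[OF \<sigma>] by blast
      then show ?thesis unfolding x Vx by simp
    qed
    fix v assume "v \<in> V x"
    then obtain u where u: "u \<in> verts X \<sigma>" and v: "v = f u" unfolding x Vx by blast
    note us = vertex_of_simplex[OF X \<sigma> u]
    show "v \<in> P" unfolding v P_def using us by blast
    show "V v = {v}" unfolding v V[OF us] verts_vertex[OF X \<sigma> u] by simp
    show "D v x \<in> P" if "2 \<le> card (V x)"
      using that dface_simplex[OF X \<sigma> u] unfolding x c[OF \<sigma>] v D[OF \<sigma> u] P_def by blast
    show "V (D v x) = V x - {v}" if "2 \<le> card (V x)"
    proof -
      have c2: "2 \<le> card (verts X \<sigma>)" using that unfolding x c[OF \<sigma>] .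
      have "f ` (verts X \<sigma> - {u}) = f ` verts X \<sigma> - {f u}"
        using inj_on_image_set_diff[OF inj_on_verts[OF X inj \<sigma>], of "verts X \<sigma>" "{u}"] u by simp
      then show ?thesis
        unfolding x v D[OF \<sigma> u] Vx V[OF dface_simplex[OF X \<sigma> u c2]] verts_dface[OF X \<sigma> u c2] .
    qed
    fix v' assume "v' \<in> V x" and ne: "v \<noteq> v' \<and> 3 \<le> card (V x)"
    then obtain u' where u': "u' \<in> verts X \<sigma>" and v': "v' = f u'" unfolding x Vx by blast
    have c3: "3 \<le> card (verts X \<sigma>)" and uu: "u \<noteq> u'" using ne unfolding x c[OF \<sigma>] v v' by auto
    have c2: "2 \<le> card (verts X \<sigma>)" using c3 by simp
    have "u \<in> verts X (dface X u' \<sigma>)" "u' \<in> verts X (dface X u \<sigma>)"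
      unfolding verts_dface[OF X \<sigma> u c2] verts_dface[OF X \<sigma> u' c2] using u u' uu by auto
    then have "D v (D v' x) = f (dface X u (dface X u' \<sigma>))" "D v' (D v x) = f (dface X u' (dface X u \<sigma>))"
      unfolding x v v' D[OF \<sigma> u] D[OF \<sigma> u']
      using D[OF dface_simplex[OF X \<sigma> u c2]] D[OF dface_simplex[OF X \<sigma> u' c2]] by auto
    then show "D v (D v' x) = D v' (D v x)" using dface_commute[OF X \<sigma> u u' uu c3] by simp
  qed
  let ?Y = "mk_dc P V D"
  have Y: "delta_complex ?Y" by (rule delta_complex_mk_dc[OF fd])
  have sY: "simplices ?Y = f ` simplices X" using simplices_mk_dc[OF fd] by (simp add: P_def)
  have vY: "verts ?Y (f \<sigma>) = f ` verts X \<sigma>" if "\<sigma> \<in> simplices X" for \<sigma>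
    using verts_mk_dc[of "f \<sigma>" P V D] V[OF that] that unfolding P_def by simp
  have "delta_map X ?Y f"
  proof (rule delta_mapI[OF X Y])
    show "f \<sigma> \<in> simplices ?Y" if "\<sigma> \<in> simplices X" for \<sigma> using that sY by blast
    show "verts ?Y (f \<sigma>) = f ` verts X \<sigma>" if "\<sigma> \<in> simplices X" for \<sigma> by (rule vY[OF that])
    show "face_le ?Y (f \<tau>) (f \<sigma>)" if "face_le X \<tau> \<sigma>" for \<tau> \<sigma>
      using X that
    proof (induction rule: face_le_induct)
      case refl
      then show ?case using sY by (intro face_le_refl) blast
    next
      case (step \<rho> \<sigma>)
      then obtain w where w: "\<sigma> \<in> simplices X" "w \<in> verts X \<sigma>" "2 \<le> card (verts X \<sigma>)" "\<rho> = dface X w \<sigma>"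
        unfolding elem_face_iff[OF X] by blast
      have fw: "f \<sigma> \<in> P" "f w \<in> V (f \<sigma>)" "2 \<le> card (V (f \<sigma>))"
        using w(1-3) c[OF w(1)] V[OF w(1)] unfolding P_def by simp_all
      have "f \<rho> = dface ?Y (f w) (f \<sigma>)" using dface_mk_dc[of "f \<sigma>" P "f w" V D, OF fw] D[OF w(1,2)] w(4) by simp
      moreover have "verts ?Y (f \<sigma>) = V (f \<sigma>)" by (rule verts_mk_dc[OF fw(1)])
      ultimately have "elem_face ?Y (f \<rho>) (f \<sigma>)"
        unfolding elem_face_iff[OF Y] using fw simplices_mk_dc[OF fd] by auto
      from face_le_trans[OF step(3) elem_face_le[OF Y this]] show ?case .
    qed
  qed
  moreover have "bij_betw f (simplices X) (simplices ?Y)"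
    unfolding sY by (rule inj_on_imp_bij_betw[OF inj])
  ultimately show ?thesis using Y unfolding dc_iso_def by blast
qed

section \<open>Domination under isomorphism and restriction\<close>

lemma dc_iso_dominated_by:
  assumes X: "delta_complex X" and Y: "delta_complex Y" and f: "dc_iso X Y f"
    and dom: "dominated_by X v v'"
  shows "dominated_by Y (f v) (f v')"
proof -
  note fm = dc_isoD(1)[OF f] and inj = dc_isoD(2)[OF f] and im = dc_isoD(3)[OF f]
  have v: "v \<in> simps X 0" and v': "v' \<in> simps X 0" "v' \<noteq> v" using dom by (auto simp: dominated_by_def)
  have vs: "v \<in> simplices X" "v' \<in> simplices X" using v v' vertex_iff[OF X] by auto
  have vertex: "f u \<in> simps Y 0" if "u \<in> simps X 0" for u
    using that delta_map_in[OF X Y fm, of u] delta_map_verts_eq[OF X Y fm, of u]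
    unfolding vertex_iff[OF X] vertex_iff[OF Y] by simp
  have "f v' \<noteq> f v" using v'(2) inj_onD[OF inj _ vs(2,1)] by blast
  moreover have "\<exists>!\<tau>. \<tau> \<in> simplices Y \<and> verts Y \<tau> = verts Y \<sigma>' \<union> {f v'} \<and> face_le Y \<sigma>' \<tau>"
    if \<sigma>': "\<sigma>' \<in> simplices Y" and le: "face_le Y (f v) \<sigma>'" for \<sigma>'
  proof -
    obtain \<sigma> where \<sigma>: "\<sigma> \<in> simplices X" "\<sigma>' = f \<sigma>" using \<sigma>' im by blast
    have "face_le X v \<sigma>" using le dc_iso_face_le_iff[OF X Y f vs(1) \<sigma>(1)] \<sigma>(2) by simp
    then have ex: "\<exists>!\<tau>. \<tau> \<in> simplices X \<and> verts X \<tau> = verts X \<sigma> \<union> {v'} \<and> face_le X \<sigma> \<tau>"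
      using dom \<sigma>(1) unfolding dominated_by_def by blast
    have iff: "f \<tau> \<in> simplices Y \<and> verts Y (f \<tau>) = verts Y \<sigma>' \<union> {f v'} \<and> face_le Y \<sigma>' (f \<tau>) \<longleftrightarrow>
        verts X \<tau> = verts X \<sigma> \<union> {v'} \<and> face_le X \<sigma> \<tau>" if \<tau>: "\<tau> \<in> simplices X" for \<tau>
    proof -
      have "f ` verts X \<tau> = f ` (verts X \<sigma> \<union> {v'}) \<longleftrightarrow> verts X \<tau> = verts X \<sigma> \<union> {v'}"
        by (rule inj_on_image_eq_iff[OF inj])
          (use vertex_of_simplex[OF X \<tau>] vertex_of_simplex[OF X \<sigma>(1)] vs in auto)
      then show ?thesis
        unfolding \<sigma>(2) dc_iso_face_le_iff[OF X Y f \<sigma>(1) \<tau>] delta_map_verts_eq[OF X Y fm \<tau>]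
          delta_map_verts_eq[OF X Y fm \<sigma>(1)]
        using delta_map_in[OF X Y fm \<tau>] by simp
    qed
    obtain \<tau> where \<tau>: "\<tau> \<in> simplices X" "verts X \<tau> = verts X \<sigma> \<union> {v'} \<and> face_le X \<sigma> \<tau>"
      using ex by blast
    show ?thesis
    proof (rule ex1I[of _ "f \<tau>"])
      show "f \<tau> \<in> simplices Y \<and> verts Y (f \<tau>) = verts Y \<sigma>' \<union> {f v'} \<and> face_le Y \<sigma>' (f \<tau>)"
        using iff[OF \<tau>(1)] \<tau>(2) by blast
      fix \<rho>' assume \<rho>': "\<rho>' \<in> simplices Y \<and> verts Y \<rho>' = verts Y \<sigma>' \<union> {f v'} \<and> face_le Y \<sigma>' \<rho>'"
      then obtain \<rho> where \<rho>: "\<rho> \<in> simplices X" "\<rho>' = f \<rho>" using im by blast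
      then have "\<rho> = \<tau>" using iff[OF \<rho>(1)] \<rho>' ex \<tau> by blast
      then show "\<rho>' = f \<tau>" using \<rho>(2) by simp
    qed
  qed
  ultimately show ?thesis unfolding dominated_by_def using vertex v v' by blast
qed

text \<open>An extension of \<open>\<sigma>\<close> by \<open>v'\<close> has its vertices in
  \<open>S\<close> as soon as \<open>\<sigma>\<close> does, so the full subcomplex offers the same
  candidates as \<open>X\<close>.\<close>

lemma dominated_by_induced:
  assumes X: "delta_complex X" and dom: "dominated_by X v v'" and S: "v \<in> S" "v' \<in> S"
  shows "dominated_by (induced X S) v v'"
proof -
  have v: "v \<in> simps X 0" "v' \<in> simps X 0" "v' \<noteq> v" using dom by (auto simp: dominated_by_def)
  have "\<exists>!\<tau>. \<tau> \<in> simplices (induced X S) \<and> verts (induced X S) \<tau> = verts (induced X S) \<sigma> \<union> {v'} \<and>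
      face_le (induced X S) \<sigma> \<tau>"
    if "\<sigma> \<in> simplices (induced X S)" "face_le (induced X S) v \<sigma>" for \<sigma>
  proof -
    have \<sigma>: "\<sigma> \<in> simplices X" "verts X \<sigma> \<subseteq> S" "face_le X v \<sigma>"
      using that unfolding simplices_induced[OF X] face_le_induced_iff[OF X] by auto
    have "\<tau> \<in> simplices (induced X S) \<and> verts (induced X S) \<tau> = verts (induced X S) \<sigma> \<union> {v'} \<and>
        face_le (induced X S) \<sigma> \<tau> \<longleftrightarrow>
        \<tau> \<in> simplices X \<and> verts X \<tau> = verts X \<sigma> \<union> {v'} \<and> face_le X \<sigma> \<tau>" for \<tau>
      using verts_induced[OF \<sigma>(1,2)] verts_induced[of \<tau> X S] \<sigma>(2) S
      by (auto simp: simplices_induced[OF X] face_le_induced_iff[OF X])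
    then show ?thesis using dom \<sigma> unfolding dominated_by_def by simp
  qed
  then show ?thesis unfolding dominated_by_def vertices_induced[OF X] using v S by blast
qed

text \<open>Since \<open>p v\<close> lies outside \<open>D\<close>, every dominating vertex stays
  alive while the vertices of \<open>D\<close> are removed one by one, and domination is inherited
  by each intermediate full subcomplex. Applied to all vertices of one end of the cylinder, this
  collapses it to the other end.\<close>

lemma strong_collapse_dominated_set:
  assumes X: "delta_complex X" and "finite D"
    and "\<And>v. v \<in> D \<Longrightarrow> dominated_by X v (p v) \<and> p v \<notin> D"
  shows "strong_collapse X (induced X (simps X 0 - D))"
proof -
  have "strong_collapse X (induced X (simps X 0 - D'))" if "D' \<subseteq> D" for D'
    using finite_subset[OF that assms(2)] that
  proof (induction D' rule: finite_induct)
    case empty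
    then show ?case using induced_vertices[OF X] by (simp add: strong_collapse_def)
  next
    case (insert v D')
    let ?Y = "induced X (simps X 0 - D')"
    have dom: "dominated_by X v (p v)" "p v \<notin> D" using insert.prems assms(3) by auto
    have Y: "delta_complex ?Y" by (rule delta_complex_induced[OF X])
    have "dominated_by ?Y v (p v)"
      by (rule dominated_by_induced[OF X dom(1)])
        (use dom insert in \<open>auto simp: dominated_by_def\<close>)
    then have "elem_strong_collapse ?Y (induced ?Y (simps ?Y 0 - {v}))"
      unfolding elem_strong_collapse_iff[OF Y] by blast
    moreover have "induced ?Y (simps ?Y 0 - {v}) = induced X (simps X 0 - insert v D')"
      unfolding induced_induced[OF X] vertices_induced[OF X] by (rule arg_cong[where f = "induced X"]) blast
    ultimately show ?case using insert.IH insert.prems unfolding strong_collapse_def by auto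
  qed
  then show ?thesis by blast
qed

section \<open>The cylinder\<close>

lemma span_face_span_face:
  assumes X: "delta_complex X" and \<sigma>: "\<sigma> \<in> simplices X" and "B \<subseteq> A" "A \<subseteq> verts X \<sigma>" "B \<noteq> {}"
  shows "span_face X B (span_face X A \<sigma>) = span_face X B \<sigma>"
proof -
  have A: "face_le X (span_face X A \<sigma>) \<sigma>" "verts X (span_face X A \<sigma>) = A"
    using span_face[OF X \<sigma> assms(4)] assms(3,5) by auto
  have "B \<subseteq> verts X (span_face X A \<sigma>)" using A(2) assms(3) by simp
  then have B: "face_le X (span_face X B (span_face X A \<sigma>)) (span_face X A \<sigma>)"
    "verts X (span_face X B (span_face X A \<sigma>)) = B"
    using span_face[OF X face_le_simplices(1)[OF A(1)] _ assms(5)] by auto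
  show ?thesis using span_face_eqI[OF X face_le_trans[OF B(1) A(1)] B(2)] by simp
qed

text \<open>
  The simplex \<open>(\<sigma>, A, B)\<close> of the cylinder over \<open>X\<close> is \<open>\<sigma>\<close> with the vertices in \<open>A\<close> placed at the
  top and those in \<open>B\<close> at the bottom end; a vertex may occur at both ends.
\<close>

definition top_vertex :: "'a \<Rightarrow> 'a \<times> 'a set \<times> 'a set" where
  "top_vertex v = (v, {v}, {})"

definition bot_vertex :: "'a \<Rightarrow> 'a \<times> 'a set \<times> 'a set" where
  "bot_vertex v = (v, {}, {v})"

definition cyl_simplices :: "'a dcomplex \<Rightarrow> ('a \<times> 'a set \<times> 'a set) set" where
  "cyl_simplices X = {(\<sigma>, A, B). \<sigma> \<in> simplices X \<and> A \<union> B = verts X \<sigma>}"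

fun cyl_verts :: "'a \<times> 'a set \<times> 'a set \<Rightarrow> ('a \<times> 'a set \<times> 'a set) set" where
  "cyl_verts (\<sigma>, A, B) = top_vertex ` A \<union> bot_vertex ` B"

text \<open>A vertex to be removed is \<open>(v, {v}, {})\<close> or \<open>(v, {}, {v})\<close>, so
  the set differences erase just one copy of \<open>v\<close>. The carrier shrinks only when no copy
  of \<open>v\<close> is left; otherwise \<open>span_face\<close> returns \<open>\<sigma>\<close>
  itself.\<close>

fun cyl_face :: "'a dcomplex \<Rightarrow> 'a \<times> 'a set \<times> 'a set \<Rightarrow> 'a \<times> 'a set \<times> 'a set \<Rightarrow> 'a \<times> 'a set \<times> 'a set" where
  "cyl_face X (_, A', B') (\<sigma>, A, B) = (span_face X ((A - A') \<union> (B - B')) \<sigma>, A - A', B - B')"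

definition cylinder :: "'a dcomplex \<Rightarrow> ('a \<times> 'a set \<times> 'a set) dcomplex" where
  "cylinder X = mk_dc (cyl_simplices X) cyl_verts (cyl_face X)"

lemma cyl_simplices_iff: "(\<sigma>, A, B) \<in> cyl_simplices X \<longleftrightarrow> \<sigma> \<in> simplices X \<and> A \<union> B = verts X \<sigma>"
  by (simp add: cyl_simplices_def)

lemma top_bot_vertex_simps [simp]:
  "top_vertex v = top_vertex w \<longleftrightarrow> v = w" "bot_vertex v = bot_vertex w \<longleftrightarrow> v = w"
  "top_vertex v \<noteq> bot_vertex w" "bot_vertex w \<noteq> top_vertex v"
  by (auto simp: top_vertex_def bot_vertex_def)

lemma vertex_in_cyl_verts [simp]:
  "top_vertex v \<in> cyl_verts (\<sigma>, A, B) \<longleftrightarrow> v \<in> A" "bot_vertex v \<in> cyl_verts (\<sigma>, A, B) \<longleftrightarrow> v \<in> B"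
  by auto

lemma cyl_verts_subset_iff: "cyl_verts (\<sigma>, A, B) \<subseteq> cyl_verts (\<tau>, A', B') \<longleftrightarrow> A \<subseteq> A' \<and> B \<subseteq> B'"
proof
  assume s: "cyl_verts (\<sigma>, A, B) \<subseteq> cyl_verts (\<tau>, A', B')"
  show "A \<subseteq> A' \<and> B \<subseteq> B'"
    using subsetD[OF s, of "top_vertex _"] subsetD[OF s, of "bot_vertex _"]
    unfolding vertex_in_cyl_verts by blast
next
  show "A \<subseteq> A' \<and> B \<subseteq> B' \<Longrightarrow> cyl_verts (\<sigma>, A, B) \<subseteq> cyl_verts (\<tau>, A', B')" by auto
qed

lemma cyl_verts_eq_iff: "cyl_verts (\<sigma>, A, B) = cyl_verts (\<tau>, A', B') \<longleftrightarrow> A = A' \<and> B = B'"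
  unfolding set_eq_subset cyl_verts_subset_iff by blast

lemma cyl_verts_vertex [simp]:
  "cyl_verts (top_vertex v) = {top_vertex v}" "cyl_verts (bot_vertex v) = {bot_vertex v}"
  by (simp_all add: top_vertex_def[of v] bot_vertex_def[of v])

lemma cyl_face_verts:
  assumes "w \<in> cyl_verts (\<sigma>, A, B)" "w = (u, A', B')"
  shows "cyl_verts (\<rho>, A - A', B - B') = cyl_verts (\<sigma>, A, B) - {w}"
  using assms by (auto simp: top_vertex_def bot_vertex_def)

text \<open>Both orders of deletion leave the same \<open>A\<close> and \<open>B\<close>, and an
  iterated passage to faces depends only on the final vertex set. The counts 2 and 3 ensure that
  this set is nonempty, as \<open>span_face\<close> requires.\<close>

lemma face_data_cylinder:
  assumes X: "delta_complex X"
  shows "face_data (cyl_simplices X) cyl_verts (cyl_face X)"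
  unfolding face_data_def
proof (intro ballI conjI impI)
  fix c assume "c \<in> cyl_simplices X"
  then obtain \<sigma> A B where c: "c = (\<sigma>, A, B)" and \<sigma>: "\<sigma> \<in> simplices X" and AB: "A \<union> B = verts X \<sigma>"
    unfolding cyl_simplices_def by blast
  have fin: "finite A" "finite B" using finite_verts[OF X \<sigma>] unfolding AB[symmetric] by auto
  show fc: "finite (cyl_verts c)" unfolding c using fin by simp
  show ne: "cyl_verts c \<noteq> {}" unfolding c using verts_nonempty[OF X \<sigma>] unfolding AB[symmetric] by auto
  show "cyl_verts c = {c}" if one: "card (cyl_verts c) = 1"
  proof -
    obtain x where x: "cyl_verts c = {x}" using one card_1_singletonE by blast
    then have "x \<in> cyl_verts c" by simp
    then consider v where "x = top_vertex v" | v where "x = bot_vertex v" unfolding c by auto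
    then show ?thesis
    proof cases
      case 1
      then have "cyl_verts (\<sigma>, A, B) = cyl_verts (v, {v}, {})" using x c by simp
      then have AB': "A = {v}" "B = {}" unfolding cyl_verts_eq_iff by auto
      then have "verts X \<sigma> = {v}" using AB by simp
      then have "v = \<sigma>" using verts_card_1[OF X \<sigma>] by simp
      then show ?thesis using x 1 c AB' by (simp add: top_vertex_def)
    next
      case 2
      then have "cyl_verts (\<sigma>, A, B) = cyl_verts (v, {}, {v})" using x c by simp
      then have AB': "A = {}" "B = {v}" unfolding cyl_verts_eq_iff by auto
      then have "verts X \<sigma> = {v}" using AB by simp
      then have "v = \<sigma>" using verts_card_1[OF X \<sigma>] by simp
      then show ?thesis using x 2 c AB' by (simp add: bot_vertex_def)
    qed
  qed
  fix w assume w: "w \<in> cyl_verts c"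
  then consider v where "w = top_vertex v" "v \<in> A" | v where "w = bot_vertex v" "v \<in> B" unfolding c by auto
  then have wv: "w \<in> cyl_simplices X \<and> cyl_verts w = {w}"
  proof cases
    case (1 v)
    then have "v \<in> verts X \<sigma>" using AB by blast
    then show ?thesis
      using 1 vertex_of_simplex[OF X \<sigma>] verts_vertex[OF X \<sigma>]
      by (simp add: top_vertex_def[of v] cyl_simplices_iff)
  next
    case (2 v)
    then have "v \<in> verts X \<sigma>" using AB by blast
    then show ?thesis
      using 2 vertex_of_simplex[OF X \<sigma>] verts_vertex[OF X \<sigma>]
      by (simp add: bot_vertex_def[of v] cyl_simplices_iff)
  qed
  then show "w \<in> cyl_simplices X" "cyl_verts w = {w}" by auto
  obtain u A' B' where w_eq: "w = (u, A', B')" by (cases w)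
  have Dw: "cyl_verts (cyl_face X w c) = cyl_verts c - {w}"
    using cyl_face_verts[of w \<sigma> A B u A' B'] w unfolding c w_eq by simp
  then show "cyl_verts (cyl_face X w c) = cyl_verts c - {w}" .
  have card_D: "card (cyl_verts c - {w}) = card (cyl_verts c) - 1" using w fc by simp
  show "cyl_face X w c \<in> cyl_simplices X" if c2: "2 \<le> card (cyl_verts c)"
  proof -
    have "cyl_verts (cyl_face X w c) \<noteq> {}" unfolding Dw using c2 card_D by force
    then have "(A - A') \<union> (B - B') \<noteq> {}" unfolding c w_eq by simp
    then have "face_le X (span_face X ((A - A') \<union> (B - B')) \<sigma>) \<sigma>"
      "verts X (span_face X ((A - A') \<union> (B - B')) \<sigma>) = (A - A') \<union> (B - B')"
      using span_face[OF X \<sigma>, of "(A - A') \<union> (B - B')"] AB by auto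
    then show ?thesis unfolding c w_eq by (simp add: cyl_simplices_iff face_le_simplices(1))
  qed
  fix w' assume w': "w' \<in> cyl_verts c" and ne: "w \<noteq> w' \<and> 3 \<le> card (cyl_verts c)"
  obtain u' A'' B'' where w'_eq: "w' = (u', A'', B'')" by (cases w')
  have "cyl_verts (cyl_face X w' c) = cyl_verts c - {w'}"
    using cyl_face_verts[of w' \<sigma> A B u' A'' B''] w' unfolding c w'_eq by simp
  moreover have "w \<in> cyl_verts (cyl_face X w' c)" using calculation w ne by blast
  ultimately have "cyl_verts (cyl_face X w (cyl_face X w' c)) = cyl_verts c - {w'} - {w}"
    using cyl_face_verts[of w _ "A - A''" "B - B''" u A' B'] unfolding c w_eq w'_eq by simp
  moreover obtain \<rho> where "cyl_face X w (cyl_face X w' c) = (\<rho>, A - A'' - A', B - B'' - B')"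
    unfolding c w_eq w'_eq by simp
  ultimately have "cyl_verts (\<rho>, A - A'' - A', B - B'' - B') = cyl_verts c - {w'} - {w}" by simp
  moreover have "card {w', w} < card (cyl_verts c)" using ne by (auto simp: card_insert_if)
  then have "\<not> cyl_verts c \<subseteq> {w', w}" using card_mono[of "{w', w}" "cyl_verts c"] by auto
  ultimately have "cyl_verts (\<rho>, A - A'' - A', B - B'' - B') \<noteq> {}" by blast
  then have "(A - A'' - A') \<union> (B - B'' - B') \<noteq> {}" unfolding cyl_verts.simps by blast
  then have ne': "(A - A' - A'') \<union> (B - B' - B'') \<noteq> {}" by blast
  have comm: "A - A'' - A' = A - A' - A''" "B - B'' - B' = B - B' - B''" by auto
  have "span_face X ((A - A' - A'') \<union> (B - B' - B'')) (span_face X ((A - A') \<union> (B - B')) \<sigma>)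
     = span_face X ((A - A' - A'') \<union> (B - B' - B'')) \<sigma>"
    by (rule span_face_span_face[OF X \<sigma> _ _ ne']) (use AB in auto)
  moreover have "span_face X ((A - A' - A'') \<union> (B - B' - B'')) (span_face X ((A - A'') \<union> (B - B'')) \<sigma>)
     = span_face X ((A - A' - A'') \<union> (B - B' - B'')) \<sigma>"
    by (rule span_face_span_face[OF X \<sigma> _ _ ne']) (use AB in auto)
  ultimately show "cyl_face X w (cyl_face X w' c) = cyl_face X w' (cyl_face X w c)"
    unfolding c w_eq w'_eq by (simp add: comm)
qed

lemma
  assumes X: "delta_complex X"
  shows delta_complex_cylinder: "delta_complex (cylinder X)"
    and simplices_cylinder: "simplices (cylinder X) = cyl_simplices X"
  unfolding cylinder_def
  using delta_complex_mk_dc[OF face_data_cylinder[OF X]] simplices_mk_dc[OF face_data_cylinder[OF X]] .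

lemma verts_cylinder: "c \<in> cyl_simplices X \<Longrightarrow> verts (cylinder X) c = cyl_verts c"
  unfolding cylinder_def by (rule verts_mk_dc)

lemma simplices_induced_cylinder:
  assumes X: "delta_complex X"
  shows "simplices (induced (cylinder X) S) = {c \<in> cyl_simplices X. cyl_verts c \<subseteq> S}"
  unfolding simplices_induced[OF delta_complex_cylinder[OF X]] simplices_cylinder[OF X]
  by (rule Collect_cong) (metis verts_cylinder)

lemma finite_cyl_simplices:
  assumes X: "delta_complex X" and fin: "finite (simplices X)"
  shows "finite (cyl_simplices X)"
proof (rule finite_subset)
  show "cyl_simplices X \<subseteq> simplices X \<times> Pow (simplices X) \<times> Pow (simplices X)"
    using vertex_of_simplex[OF X] unfolding cyl_simplices_def by blast
  show "finite (simplices X \<times> Pow (simplices X) \<times> Pow (simplices X))" using fin by simp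
qed

text \<open>Every deletion replaces the carrier by one of its faces.\<close>

lemma face_le_cylinder_fst:
  assumes X: "delta_complex X" and le: "face_le (cylinder X) a c"
  shows "face_le X (fst a) (fst c)"
  using delta_complex_cylinder[OF X] le
proof (induction rule: face_le_induct)
  case refl
  then show ?case by (auto simp: simplices_cylinder[OF X] cyl_simplices_def face_le_refl)
next
  case (step b c)
  note C = delta_complex_cylinder[OF X]
  obtain w where w: "c \<in> cyl_simplices X" "2 \<le> card (cyl_verts c)" "w \<in> cyl_verts c" "b = dface (cylinder X) w c"
    using step(2) verts_cylinder[of c X] unfolding elem_face_iff[OF C] simplices_cylinder[OF X] by auto
  have b: "b = cyl_face X w c" unfolding w(4) cylinder_def by (rule dface_mk_dc; rule w)
  have "b \<in> cyl_simplices X"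
    using elem_face_simplices(1)[OF C step(2)] unfolding simplices_cylinder[OF X] .
  obtain \<sigma> A B where c: "c = (\<sigma>, A, B)" by (cases c)
  obtain u A' B' where w_eq: "w = (u, A', B')" by (cases w)
  have \<sigma>: "\<sigma> \<in> simplices X" "A \<union> B = verts X \<sigma>" using w(1) unfolding c cyl_simplices_iff by auto
  have "b \<in> simplices (cylinder X)" using \<open>b \<in> cyl_simplices X\<close> simplices_cylinder[OF X] by simp
  then have "cyl_verts b \<noteq> {}" using verts_nonempty[OF C] verts_cylinder[OF \<open>b \<in> cyl_simplices X\<close>] by metis
  then have ne: "(A - A') \<union> (B - B') \<noteq> {}" unfolding b c w_eq by simp
  have "face_le X (span_face X ((A - A') \<union> (B - B')) \<sigma>) \<sigma>"
    by (rule span_face(1)[OF X \<sigma>(1) _ ne]) (use \<sigma>(2) in auto)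
  then have "face_le X (fst b) (fst c)" unfolding b c w_eq by simp
  then show ?case by (rule face_le_trans[OF step(3)])
qed

text \<open>Distinct simplices of \<open>X\<close> may share their vertices, so the carriers have to
  be compared as well. For the converse, the face on the given vertices has a carrier below
  \<open>\<sigma>\<close> with the vertices of \<open>\<tau>\<close>, hence the carrier
  \<open>\<tau>\<close>.\<close>

lemma face_le_cylinder_iff:
  assumes X: "delta_complex X"
    and a: "(\<tau>, A', B') \<in> cyl_simplices X" and c: "(\<sigma>, A, B) \<in> cyl_simplices X"
  shows "face_le (cylinder X) (\<tau>, A', B') (\<sigma>, A, B) \<longleftrightarrow> face_le X \<tau> \<sigma> \<and> A' \<subseteq> A \<and> B' \<subseteq> B"
proof
  note C = delta_complex_cylinder[OF X]
  show "face_le X \<tau> \<sigma> \<and> A' \<subseteq> A \<and> B' \<subseteq> B" if le: "face_le (cylinder X) (\<tau>, A', B') (\<sigma>, A, B)"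
    using face_le_cylinder_fst[OF X le] face_le_verts[OF C le]
    unfolding verts_cylinder[OF a] verts_cylinder[OF c] cyl_verts_subset_iff by simp
  assume R: "face_le X \<tau> \<sigma> \<and> A' \<subseteq> A \<and> B' \<subseteq> B"
  have sub: "verts (cylinder X) (\<tau>, A', B') \<subseteq> verts (cylinder X) (\<sigma>, A, B)"
    unfolding verts_cylinder[OF a] verts_cylinder[OF c] cyl_verts_subset_iff using R by simp
  have sa: "(\<tau>, A', B') \<in> simplices (cylinder X)" and sc: "(\<sigma>, A, B) \<in> simplices (cylinder X)"
    using a c simplices_cylinder[OF X] by auto
  obtain b where b: "face_le (cylinder X) b (\<sigma>, A, B)" "verts (cylinder X) b = verts (cylinder X) (\<tau>, A', B')"
    using face_exists[OF C sc sub verts_nonempty[OF C sa]] by blast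
  obtain \<rho> A'' B'' where b_eq: "b = (\<rho>, A'', B'')" by (cases b)
  have bC: "(\<rho>, A'', B'') \<in> cyl_simplices X"
    using face_le_simplices(1)[OF b(1)] simplices_cylinder[OF X] b_eq by simp
  have AB: "A'' = A'" "B'' = B'"
    using b(2) unfolding b_eq verts_cylinder[OF bC] verts_cylinder[OF a] cyl_verts_eq_iff by auto
  have "face_le X \<rho> \<sigma>" using face_le_cylinder_fst[OF X b(1)] b_eq by simp
  moreover have "verts X \<rho> = verts X \<tau>" using a bC unfolding AB cyl_simplices_iff by metis
  ultimately have "\<rho> = \<tau>" using face_unique[OF X, of \<rho> \<sigma> \<tau>] R by blast
  then show "face_le (cylinder X) (\<tau>, A', B') (\<sigma>, A, B)" using b(1) b_eq AB by simp
qed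

text \<open>The carrier of any such extension contains \<open>\<sigma>\<close> and has the same
  vertices, so the carrier cannot change.\<close>

lemma cylinder_extension_unique:
  assumes X: "delta_complex X" and c: "(\<sigma>, A, B) \<in> cyl_simplices X"
    and c': "(\<sigma>, A', B') \<in> cyl_simplices X" and sub: "A \<subseteq> A'" "B \<subseteq> B'"
  shows "\<exists>!\<tau>. \<tau> \<in> simplices (cylinder X) \<and> verts (cylinder X) \<tau> = cyl_verts (\<sigma>, A', B') \<and>
    face_le (cylinder X) (\<sigma>, A, B) \<tau>"
proof (rule ex1I[of _ "(\<sigma>, A', B')"])
  have \<sigma>: "\<sigma> \<in> simplices X" using c unfolding cyl_simplices_iff by (rule conjunct1)
  show "(\<sigma>, A', B') \<in> simplices (cylinder X) \<and> verts (cylinder X) (\<sigma>, A', B') = cyl_verts (\<sigma>, A', B') \<and>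
      face_le (cylinder X) (\<sigma>, A, B) (\<sigma>, A', B')"
    unfolding simplices_cylinder[OF X] verts_cylinder[OF c'] face_le_cylinder_iff[OF X c c']
    using c' sub face_le_refl[OF \<sigma>] by blast
  fix t assume t: "t \<in> simplices (cylinder X) \<and> verts (cylinder X) t = cyl_verts (\<sigma>, A', B') \<and>
    face_le (cylinder X) (\<sigma>, A, B) t"
  obtain \<tau> A'' B'' where t_eq: "t = (\<tau>, A'', B'')" by (cases t)
  have tC: "(\<tau>, A'', B'') \<in> cyl_simplices X" using t t_eq simplices_cylinder[OF X] by simp
  have AB: "A'' = A'" "B'' = B'" using t unfolding t_eq verts_cylinder[OF tC] cyl_verts_eq_iff by auto
  have "face_le X \<sigma> \<tau>" using t unfolding t_eq face_le_cylinder_iff[OF X c tC] by blast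
  moreover have "verts X \<sigma> = verts X \<tau>" using tC c' unfolding AB cyl_simplices_iff by metis
  ultimately have "\<sigma> = \<tau>" by (rule face_le_verts_eq[OF X])
  then show "t = (\<sigma>, A', B')" using t_eq AB by simp
qed

section \<open>Vertices, domination and ends of the cylinder\<close>

lemma vertices_cylinder:
  assumes X: "delta_complex X"
  shows "simps (cylinder X) 0 = top_vertex ` simps X 0 \<union> bot_vertex ` simps X 0" (is "?L = ?R")
proof
  note C = delta_complex_cylinder[OF X]
  show "?L \<subseteq> ?R"
  proof
    fix c assume "c \<in> ?L"
    then have c: "c \<in> cyl_simplices X" "verts (cylinder X) c = {c}"
      unfolding vertex_iff[OF C] simplices_cylinder[OF X] by auto
    obtain \<sigma> A B where c_eq: "c = (\<sigma>, A, B)" by (cases c)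
    have "c \<in> cyl_verts c" using c(2) verts_cylinder[OF c(1)] by simp
    moreover have "A \<union> B \<subseteq> simps X 0"
      using c(1) verts_subset[OF X] unfolding c_eq cyl_simplices_iff by blast
    ultimately show "c \<in> ?R" unfolding c_eq by auto
  qed
  show "?R \<subseteq> ?L"
  proof
    fix c assume "c \<in> ?R"
    then obtain v where v: "v \<in> simps X 0" "c = top_vertex v \<or> c = bot_vertex v" by blast
    have "c \<in> cyl_simplices X"
      using v vertex_iff[OF X, of v] by (auto simp: top_vertex_def bot_vertex_def cyl_simplices_iff)
    moreover have "cyl_verts c = {c}" using v(2) by auto
    ultimately show "c \<in> ?L" unfolding vertex_iff[OF C] simplices_cylinder[OF X] by (simp add: verts_cylinder)
  qed
qed

text \<open>Adding the other copy of \<open>v\<close> leaves the carrier and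
  \<open>A \<union> B\<close> alone, so the extension exists and the carrier pins it down. The
  argument is symmetric in the two ends.\<close>

lemma cylinder_dominated:
  assumes X: "delta_complex X" and v: "v \<in> simps X 0"
  shows "dominated_by (cylinder X) (top_vertex v) (bot_vertex v)"
    and "dominated_by (cylinder X) (bot_vertex v) (top_vertex v)"
proof -
  note C = delta_complex_cylinder[OF X]
  have t: "top_vertex v \<in> simps (cylinder X) 0" and b: "bot_vertex v \<in> simps (cylinder X) 0"
    using v unfolding vertices_cylinder[OF X] by auto
  have "\<exists>!\<tau>. \<tau> \<in> simplices (cylinder X) \<and> verts (cylinder X) \<tau> = verts (cylinder X) c \<union> {bot_vertex v} \<and>
      face_le (cylinder X) c \<tau>"
    if "c \<in> simplices (cylinder X)" "face_le (cylinder X) (top_vertex v) c" for c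
  proof -
    obtain \<sigma> A B where c: "c = (\<sigma>, A, B)" by (cases c)
    have cC: "(\<sigma>, A, B) \<in> cyl_simplices X" using that(1) unfolding c simplices_cylinder[OF X] .
    have "top_vertex v \<in> cyl_verts (\<sigma>, A, B)"
      using that vertex_face_le_iff[OF C t that(1)] unfolding c verts_cylinder[OF cC] by blast
    then have "A \<union> insert v B = A \<union> B" unfolding vertex_in_cyl_verts by blast
    then have c': "(\<sigma>, A, insert v B) \<in> cyl_simplices X" using cC unfolding cyl_simplices_iff by metis
    have eq: "cyl_verts (\<sigma>, A, B) \<union> {bot_vertex v} = cyl_verts (\<sigma>, A, insert v B)" by auto
    show ?thesis
      unfolding c verts_cylinder[OF cC] eq by (rule cylinder_extension_unique[OF X cC c']) auto
  qed
  then show "dominated_by (cylinder X) (top_vertex v) (bot_vertex v)"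
    unfolding dominated_by_def using t b by simp
  have "\<exists>!\<tau>. \<tau> \<in> simplices (cylinder X) \<and> verts (cylinder X) \<tau> = verts (cylinder X) c \<union> {top_vertex v} \<and>
      face_le (cylinder X) c \<tau>"
    if "c \<in> simplices (cylinder X)" "face_le (cylinder X) (bot_vertex v) c" for c
  proof -
    obtain \<sigma> A B where c: "c = (\<sigma>, A, B)" by (cases c)
    have cC: "(\<sigma>, A, B) \<in> cyl_simplices X" using that(1) unfolding c simplices_cylinder[OF X] .
    have "bot_vertex v \<in> cyl_verts (\<sigma>, A, B)"
      using that vertex_face_le_iff[OF C b that(1)] unfolding c verts_cylinder[OF cC] by blast
    then have "insert v A \<union> B = A \<union> B" unfolding vertex_in_cyl_verts by blast
    then have c': "(\<sigma>, insert v A, B) \<in> cyl_simplices X" using cC unfolding cyl_simplices_iff by metis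
    have eq: "cyl_verts (\<sigma>, A, B) \<union> {top_vertex v} = cyl_verts (\<sigma>, insert v A, B)" by auto
    show ?thesis
      unfolding c verts_cylinder[OF cC] eq by (rule cylinder_extension_unique[OF X cC c']) auto
  qed
  then show "dominated_by (cylinder X) (bot_vertex v) (top_vertex v)"
    unfolding dominated_by_def using t b by simp
qed

text \<open>In an end, one of \<open>A\<close> and \<open>B\<close> is empty and the other is
  determined by the carrier.\<close>

lemma cylinder_ends:
  assumes X: "delta_complex X"
  shows "dc_iso X (induced (cylinder X) (top_vertex ` simps X 0)) (\<lambda>\<sigma>. (\<sigma>, verts X \<sigma>, {}))" (is "dc_iso X ?T ?t")
    and "dc_iso X (induced (cylinder X) (bot_vertex ` simps X 0)) (\<lambda>\<sigma>. (\<sigma>, {}, verts X \<sigma>))" (is "dc_iso X ?B ?b")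
proof -
  note C = delta_complex_cylinder[OF X]
  have in1: "?t \<sigma> \<in> cyl_simplices X" "?b \<sigma> \<in> cyl_simplices X" if "\<sigma> \<in> simplices X" for \<sigma>
    using that by (auto simp: cyl_simplices_iff)
  have v: "?t u = top_vertex u" "?b u = bot_vertex u" if "u \<in> simps X 0" for u
    using that vertex_iff[OF X, of u] by (auto simp: top_vertex_def bot_vertex_def)
  have im: "?t ` verts X \<sigma> = top_vertex ` verts X \<sigma>" "?b ` verts X \<sigma> = bot_vertex ` verts X \<sigma>"
    if "\<sigma> \<in> simplices X" for \<sigma>
    using v verts_subset[OF X that] by (auto intro!: image_cong)
  have mt: "delta_map X (cylinder X) ?t"
  proof (rule delta_mapI[OF X C])
    show "?t \<sigma> \<in> simplices (cylinder X)" if "\<sigma> \<in> simplices X" for \<sigma>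
      using in1[OF that] unfolding simplices_cylinder[OF X] by simp
    show "verts (cylinder X) (?t \<sigma>) = ?t ` verts X \<sigma>" if "\<sigma> \<in> simplices X" for \<sigma>
      unfolding im(1)[OF that] verts_cylinder[OF in1(1)[OF that]] by simp
    show "face_le (cylinder X) (?t \<tau>) (?t \<sigma>)" if "face_le X \<tau> \<sigma>" for \<tau> \<sigma>
      unfolding face_le_cylinder_iff[OF X in1(1)[OF face_le_simplices(1)[OF that]]
          in1(1)[OF face_le_simplices(2)[OF that]]]
      using that face_le_verts[OF X that] by simp
  qed
  have mb: "delta_map X (cylinder X) ?b"
  proof (rule delta_mapI[OF X C])
    show "?b \<sigma> \<in> simplices (cylinder X)" if "\<sigma> \<in> simplices X" for \<sigma>
      using in1[OF that] unfolding simplices_cylinder[OF X] by simp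
    show "verts (cylinder X) (?b \<sigma>) = ?b ` verts X \<sigma>" if "\<sigma> \<in> simplices X" for \<sigma>
      unfolding im(2)[OF that] verts_cylinder[OF in1(2)[OF that]] by simp
    show "face_le (cylinder X) (?b \<tau>) (?b \<sigma>)" if "face_le X \<tau> \<sigma>" for \<tau> \<sigma>
      unfolding face_le_cylinder_iff[OF X in1(2)[OF face_le_simplices(1)[OF that]]
          in1(2)[OF face_le_simplices(2)[OF that]]]
      using that face_le_verts[OF X that] by simp
  qed
  have "verts (cylinder X) (?t \<sigma>) \<subseteq> top_vertex ` simps X 0"
    "verts (cylinder X) (?b \<sigma>) \<subseteq> bot_vertex ` simps X 0" if "\<sigma> \<in> simplices X" for \<sigma>
    unfolding verts_cylinder[OF in1(1)[OF that]] verts_cylinder[OF in1(2)[OF that]]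
    using verts_subset[OF X that] by auto
  then have "delta_map X ?T ?t" "delta_map X ?B ?b"
    unfolding delta_map_induced_iff[OF X C] using mt mb by blast+
  moreover have "simplices ?T = ?t ` simplices X"
  proof -
    have "c \<in> cyl_simplices X \<and> cyl_verts c \<subseteq> top_vertex ` simps X 0 \<longleftrightarrow> c \<in> ?t ` simplices X" for c
    proof -
      obtain \<sigma> A B where c: "c = (\<sigma>, A, B)" by (cases c)
      \<comment> \<open>\<open>cyl_verts\<close> ignores the carrier, so the set of all top vertices
        is \<open>cyl_verts\<close> of a triple whose first component is arbitrary.\<close>
      have "cyl_verts c \<subseteq> top_vertex ` simps X 0 \<longleftrightarrow> A \<subseteq> simps X 0 \<and> B = {}"
        unfolding c using cyl_verts_subset_iff[of \<sigma> A B undefined "simps X 0" "{}"] by simp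
      then show ?thesis using verts_subset[OF X] unfolding c cyl_simplices_iff image_iff by auto
    qed
    then show ?thesis unfolding simplices_induced_cylinder[OF X] by blast
  qed
  moreover have "simplices ?B = ?b ` simplices X"
  proof -
    have "c \<in> cyl_simplices X \<and> cyl_verts c \<subseteq> bot_vertex ` simps X 0 \<longleftrightarrow> c \<in> ?b ` simplices X" for c
    proof -
      obtain \<sigma> A B where c: "c = (\<sigma>, A, B)" by (cases c)
      have "cyl_verts c \<subseteq> bot_vertex ` simps X 0 \<longleftrightarrow> B \<subseteq> simps X 0 \<and> A = {}"
        unfolding c using cyl_verts_subset_iff[of \<sigma> A B undefined "{}" "simps X 0"] by auto
      then show ?thesis using verts_subset[OF X] unfolding c cyl_simplices_iff image_iff by auto
    qed
    then show ?thesis unfolding simplices_induced_cylinder[OF X] by blast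
  qed
  moreover have "inj_on ?t (simplices X)" "inj_on ?b (simplices X)" by (auto simp: inj_on_def)
  ultimately show "dc_iso X ?T ?t" "dc_iso X ?B ?b"
    unfolding dc_iso_def bij_betw_def by auto
qed

lemma dc_iso_induced:
  assumes X: "delta_complex X" and Y: "delta_complex Y" and f: "dc_iso X Y f" and S: "S \<subseteq> simps X 0"
  shows "dc_iso (induced X S) (induced Y (f ` S)) f"
proof -
  note fm = dc_isoD(1)[OF f] and inj = dc_isoD(2)[OF f] and im = dc_isoD(3)[OF f]
  note I = delta_complex_induced[OF X, of S]
  have sub: "simplices (induced X S) \<subseteq> simplices X" unfolding simplices_induced[OF X] by blast
  have "delta_map (induced X S) X id"
    using delta_map_induced_iff[OF I X, of S id] delta_map_id[OF I] by blast
  from delta_map_comp[OF I X Y this fm] have m: "delta_map (induced X S) Y f" by simp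
  have sV: "S \<subseteq> simplices X" using S vertex_iff[OF X] by blast
  have iff: "verts Y (f \<sigma>) \<subseteq> f ` S \<longleftrightarrow> verts X \<sigma> \<subseteq> S" if \<sigma>: "\<sigma> \<in> simplices X" for \<sigma>
  proof
    assume "verts Y (f \<sigma>) \<subseteq> f ` S"
    then have "f ` verts X \<sigma> \<subseteq> f ` S" unfolding delta_map_verts_eq[OF X Y fm \<sigma>] .
    then show "verts X \<sigma> \<subseteq> S"
      using inj_on_image_mem_iff[OF inj vertex_of_simplex[OF X \<sigma>] sV] by blast
  next
    assume "verts X \<sigma> \<subseteq> S"
    then show "verts Y (f \<sigma>) \<subseteq> f ` S" unfolding delta_map_verts_eq[OF X Y fm \<sigma>] by (rule image_mono)
  qed
  have "delta_map (induced X S) (induced Y (f ` S)) f"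
    unfolding delta_map_induced_iff[OF I Y] using m iff simplices_induced[OF X] by blast
  moreover have "inj_on f (simplices (induced X S))" by (rule inj_on_subset[OF inj sub])
  moreover have "f ` simplices (induced X S) = simplices (induced Y (f ` S))"
    unfolding simplices_induced[OF X] simplices_induced[OF Y] im[symmetric] using iff by blast
  ultimately show ?thesis unfolding dc_iso_def bij_betw_def by blast
qed

section \<open>The strong homotopy type\<close>

lemma same_strong_homotopy_type_sym:
  assumes "same_strong_homotopy_type X Y"
  shows "same_strong_homotopy_type Y X"
proof -
  obtain n :: nat and Z where Z: "Z 0 = X" "Z n = Y" "\<forall>i\<le>n. finite_delta_complex (Z i)"
    "\<forall>i<n. strong_collapse (Z i) (Z (Suc i)) \<or> strong_collapse (Z (Suc i)) (Z i)"
    using assms unfolding same_strong_homotopy_type_def by blast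
  have "strong_collapse (Z (n - i)) (Z (n - Suc i)) \<or> strong_collapse (Z (n - Suc i)) (Z (n - i))"
    if "i < n" for i
  proof -
    \<comment> \<open>Step \<open>i\<close> of the reversed sequence is step
      \<open>n - Suc i\<close> of the original one.\<close>
    have "n - i = Suc (n - Suc i)" "n - Suc i < n" using that by auto
    then show ?thesis using Z(4) by metis
  qed
  then show ?thesis
    unfolding same_strong_homotopy_type_def using Z
    by (intro exI[of _ n] exI[of _ "\<lambda>i. Z (n - i)"]) simp
qed

lemma same_strong_homotopy_type_trans:
  assumes "same_strong_homotopy_type X Y" "same_strong_homotopy_type Y W"
  shows "same_strong_homotopy_type X W"
proof -
  obtain n :: nat and Z where Z: "Z 0 = X" "Z n = Y" "\<forall>i\<le>n. finite_delta_complex (Z i)"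
    "\<forall>i<n. strong_collapse (Z i) (Z (Suc i)) \<or> strong_collapse (Z (Suc i)) (Z i)"
    using assms(1) unfolding same_strong_homotopy_type_def by blast
  obtain m :: nat and U where U: "U 0 = Y" "U m = W" "\<forall>i\<le>m. finite_delta_complex (U i)"
    "\<forall>i<m. strong_collapse (U i) (U (Suc i)) \<or> strong_collapse (U (Suc i)) (U i)"
    using assms(2) unfolding same_strong_homotopy_type_def by blast
  \<comment> \<open>At \<open>i = n\<close> both branches give \<open>Y\<close>, so the second
    description is valid from \<open>n\<close> on and the step leaving \<open>Y\<close> falls under
    it.\<close>
  define Q where "Q i = (if i \<le> n then Z i else U (i - n))" for i
  have Q: "Q i = Z i" if "i \<le> n" for i using that by (simp add: Q_def)
  have Q': "Q i = U (i - n)" if "n \<le> i" for i using that Z(2) U(1) by (auto simp: Q_def)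
  have fin: "finite_delta_complex (Q i)" if "i \<le> n + m" for i
    using Z(3) U(3) that by (cases "i \<le> n") (simp_all add: Q Q')
  have st: "strong_collapse (Q i) (Q (Suc i)) \<or> strong_collapse (Q (Suc i)) (Q i)" if "i < n + m" for i
  proof (cases "i < n")
    case True
    then show ?thesis using Z(4) Q[of i] Q[of "Suc i"] by simp
  next
    case False
    then have "i - n < m" "Suc i - n = Suc (i - n)" using that by auto
    then show ?thesis using U(4) Q'[of i] Q'[of "Suc i"] False by simp
  qed
  have "Q 0 = X" "Q (n + m) = W" using Q[of 0] Q'[of "n + m"] Z(1) U(2) by simp_all
  then show ?thesis unfolding same_strong_homotopy_type_def using fin st by blast
qed

lemma same_strong_homotopy_type_of_collapse:
  assumes "finite_delta_complex X" "strong_collapse X Y"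
  shows "same_strong_homotopy_type X Y"
  unfolding same_strong_homotopy_type_def
  using assms finite_delta_complex_strong_collapse[OF assms]
  by (intro exI[of _ 1] exI[of _ "\<lambda>i. if i = 0 then X else Y"]) auto

section \<open>Joining isomorphic complexes\<close>

lemma injection_extension_exists:
  assumes "infinite (UNIV :: 'b set)" "finite C" "A \<subseteq> C" "inj_on f A"
  shows "\<exists>g :: 'a \<Rightarrow> 'b. inj_on g C \<and> (\<forall>x\<in>A. g x = f x)"
proof -
  have fA: "finite (f ` A)" using assms(2,3) finite_subset by blast
  have "infinite (- (f ` A))" using assms(1) fA by (simp add: Compl_eq_Diff_UNIV)
  then obtain B where B: "B \<subseteq> - (f ` A)" "card B = card (C - A)" "finite B"
    using infinite_arbitrarily_large by metis
  obtain h where h: "bij_betw h (C - A) B"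
    using finite_same_card_bij[of "C - A" B] assms(2) B by auto
  let ?g = "\<lambda>x. if x \<in> A then f x else h x"
  have "inj_on ?g C"
  proof (rule inj_onI)
    fix x y assume xy: "x \<in> C" "y \<in> C" "?g x = ?g y"
    have h_in: "h z \<in> B" if "z \<in> C" "z \<notin> A" for z using bij_betwE[OF h] that by blast
    consider "x \<in> A" "y \<in> A" | "x \<notin> A" "y \<notin> A" | "x \<in> A" "y \<notin> A" | "x \<notin> A" "y \<in> A" by blast
    then show "x = y"
    proof cases
      case 1
      then show ?thesis using xy(3) inj_onD[OF assms(4)] by simp
    next
      case 2
      then show ?thesis using xy inj_onD[OF bij_betw_imp_inj_on[OF h], of x y] by simp
    next
      case 3
      then have "f x = h y" using xy(3) by simp
      moreover have "f x \<in> f ` A" using 3 by simp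
      ultimately show ?thesis using h_in[OF xy(2)] B(1) 3 by auto
    next
      case 4
      then have "h x = f y" using xy(3) by simp
      moreover have "f y \<in> f ` A" using 4 by simp
      ultimately show ?thesis using h_in[OF xy(1)] B(1) 4 by auto
    qed
  qed
  then show ?thesis by (intro exI[of _ ?g]) simp
qed

text \<open>The cylinder over \<open>X\<close> lives in another type and has to be renamed into the
  given one. Its top end receives the names of \<open>X\<close> itself and its bottom end, through
  \<open>f\<close>, those of \<open>Y\<close>; disjointness makes this naming injective. The ends of
  the renamed cylinder \<open>Z\<close> are then equal to \<open>X\<close> and \<open>Y\<close>, not
  just isomorphic to them.\<close>

lemma same_strong_homotopy_type_of_disjoint_iso:
  fixes X Y :: "'a dcomplex"
  assumes inf: "infinite (UNIV :: 'a set)"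
    and fX: "finite_delta_complex X" and fY: "finite_delta_complex Y"
    and f: "dc_iso X Y f" and disj: "simplices X \<inter> simplices Y = {}"
  shows "same_strong_homotopy_type X Y"
proof -
  have X: "delta_complex X" "finite (simplices X)" and Y: "delta_complex Y"
    using fX fY by (auto simp: finite_delta_complex_def)
  let ?C = "cylinder X" and ?t = "\<lambda>\<sigma>. (\<sigma>, verts X \<sigma>, {} :: 'a set)"
    and ?b = "\<lambda>\<sigma>. (\<sigma>, {} :: 'a set, verts X \<sigma>)"
  note C = delta_complex_cylinder[OF X(1)]
  let ?A = "?t ` simplices X \<union> ?b ` simplices X"
  \<comment> \<open>The test \<open>B = {}\<close> separates the ends, because a bottom simplex has
    a nonempty vertex set. On mixed simplices the extension \<open>h\<close> will use fresh names
    instead of \<open>e\<close>.\<close>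
  define e where "e = (\<lambda>(\<sigma>, A :: 'a set, B :: 'a set). if B = {} then \<sigma> else f \<sigma>)"
  have et: "e (?t \<sigma>) = \<sigma>" for \<sigma> by (simp add: e_def)
  have eb: "e (?b \<sigma>) = f \<sigma>" if "\<sigma> \<in> simplices X" for \<sigma>
    using verts_nonempty[OF X(1) that] by (simp add: e_def)
  have ef: "f \<sigma> \<in> simplices Y" if "\<sigma> \<in> simplices X" for \<sigma>
    by (rule delta_map_in[OF X(1) Y dc_isoD(1)[OF f] that])
  have e_inj: "inj_on e ?A"
  proof (rule inj_onI)
    fix x y assume "x \<in> ?A" "y \<in> ?A" and e: "e x = e y"
    then obtain \<sigma> \<tau> where s: "\<sigma> \<in> simplices X" "\<tau> \<in> simplices X"
      and xy: "x = ?t \<sigma> \<or> x = ?b \<sigma>" "y = ?t \<tau> \<or> y = ?b \<tau>" by blast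
    have ne: "f \<sigma> \<noteq> \<tau>" "\<sigma> \<noteq> f \<tau>" using disj ef[OF s(1)] ef[OF s(2)] s by auto
    from xy show "x = y"
    proof (elim disjE)
      assume a: "x = ?t \<sigma>" "y = ?t \<tau>"
      then show ?thesis using e unfolding a et by simp
    next
      assume a: "x = ?t \<sigma>" "y = ?b \<tau>"
      then show ?thesis using e ne unfolding a et eb[OF s(2)] by simp
    next
      assume a: "x = ?b \<sigma>" "y = ?t \<tau>"
      then show ?thesis using e ne unfolding a et eb[OF s(1)] by simp
    next
      assume a: "x = ?b \<sigma>" "y = ?b \<tau>"
      then show ?thesis using e inj_onD[OF dc_isoD(2)[OF f] _ s] unfolding a eb[OF s(1)] eb[OF s(2)] by simp
    qed
  qed
  have "?A \<subseteq> cyl_simplices X" by (auto simp: cyl_simplices_iff)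
  \<comment> \<open>The cylinder has finitely many simplices, so the infinite ambient type has room
    for those outside the two ends.\<close>
  from injection_extension_exists[OF inf finite_cyl_simplices[OF X] this e_inj]
  obtain h where h: "inj_on h (cyl_simplices X)" "\<forall>x\<in>?A. h x = e x" by (elim exE conjE) (rule that)
  have ht: "h (?t \<sigma>) = \<sigma>" and hb: "h (?b \<sigma>) = f \<sigma>" if "\<sigma> \<in> simplices X" for \<sigma>
    using h(2) et[of \<sigma>] eb[OF that] that by simp_all
  have "inj_on h (simplices ?C)" using h(1) simplices_cylinder[OF X(1)] by simp
  from dc_iso_image_exists[OF C this]
  obtain Z where Z: "delta_complex Z" and i: "dc_iso ?C Z h" by (elim exE conjE) (rule that)
  have "simplices Z = h ` cyl_simplices X" using dc_isoD(3)[OF i] simplices_cylinder[OF X(1)] by simp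
  then have fZ: "finite_delta_complex Z"
    using Z finite_cyl_simplices[OF X] unfolding finite_delta_complex_def by simp
  \<comment> \<open>The end \<open>S\<close> is kept and the end \<open>T\<close> deleted, with
    domination carried from the cylinder to \<open>Z\<close> along \<open>h\<close>. The general
    form serves both choices of the end.\<close>
  have collapse: "strong_collapse Z (induced Z (h ` S))"
    if S: "S \<union> T = simps ?C 0" "finite T" and p: "\<And>v. v \<in> T \<Longrightarrow> dominated_by ?C v (p v) \<and> p v \<in> S"
      and "S \<inter> T = {}" for S T p
  proof -
    have ST: "S \<subseteq> cyl_simplices X" "T \<subseteq> cyl_simplices X"
      using S(1) vertex_iff[OF C] unfolding simplices_cylinder[OF X(1)] by blast+
    have vZ: "simps Z 0 = h ` simps ?C 0"
    proof -
      have "simps Z 0 = h ` {c \<in> simplices ?C. card (verts ?C c) = 1}"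
      proof -
        have c: "card (verts Z (h c)) = card (verts ?C c)" if "c \<in> simplices ?C" for c
          unfolding delta_map_verts_eq[OF C Z dc_isoD(1)[OF i] that]
          by (rule card_image[OF inj_on_verts[OF C dc_isoD(2)[OF i] that]])
        show ?thesis
          unfolding set_eq_iff simps_iff[OF Z] dc_isoD(3)[OF i, symmetric] using c by auto
      qed
      also have "{c \<in> simplices ?C. card (verts ?C c) = 1} = simps ?C 0"
        unfolding set_eq_iff simps_iff[OF C] by simp
      finally show ?thesis .
    qed
    have disj': "h ` S \<inter> h ` T = {}"
      using that(4) inj_on_image_Int[OF h(1) ST] by simp
    \<comment> \<open>The dominating vertex of \<open>h v\<close> is \<open>h (p v)\<close>;
      \<open>inv_into\<close> recovers \<open>v\<close>.\<close>
    let ?q = "\<lambda>x. h (p (inv_into T h x))"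
    have injT: "inj_on h T" by (rule inj_on_subset[OF h(1) ST(2)])
    have "dominated_by Z x (?q x) \<and> ?q x \<notin> h ` T" if x: "x \<in> h ` T" for x
    proof -
      obtain v where v: "v \<in> T" "x = h v" using x by blast
      have "?q x = h (p v)" using v injT by simp
      moreover have "dominated_by Z (h v) (h (p v))"
        using dc_iso_dominated_by[OF C Z i] p[OF v(1)] by blast
      moreover have "h (p v) \<in> h ` S" using p[OF v(1)] by blast
      ultimately show ?thesis using v(2) disj' by auto
    qed
    from strong_collapse_dominated_set[OF Z finite_imageI[OF S(2)] this]
    have "strong_collapse Z (induced Z (simps Z 0 - h ` T))" .
    moreover have "simps Z 0 - h ` T = h ` S" unfolding vZ S(1)[symmetric] using disj' by blast
    ultimately show ?thesis by simp
  qed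
  let ?T = "top_vertex ` simps X 0" and ?B = "bot_vertex ` simps X 0"
  have fin0: "finite (simps X 0)" by (rule finite_subset[OF _ X(2)]) (auto simp: simplices_def)
  have TB: "?T \<union> ?B = simps ?C 0" "?B \<union> ?T = simps ?C 0" "?T \<inter> ?B = {}" "?B \<inter> ?T = {}"
    using vertices_cylinder[OF X(1)] by auto
  \<comment> \<open>The first component of either copy of a vertex is the vertex itself, so
    \<open>top_vertex (fst v)\<close> is the copy opposite to \<open>v\<close>.\<close>
  have "dominated_by ?C v (top_vertex (fst v)) \<and> top_vertex (fst v) \<in> ?T" if "v \<in> ?B" for v
    using that cylinder_dominated(2)[OF X(1)] by (auto simp: bot_vertex_def)
  from collapse[OF TB(1) finite_imageI[OF fin0] this TB(3)]
  have c1: "strong_collapse Z (induced Z (h ` ?T))" .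
  have "dominated_by ?C v (bot_vertex (fst v)) \<and> bot_vertex (fst v) \<in> ?B" if "v \<in> ?T" for v
    using that cylinder_dominated(1)[OF X(1)] by (auto simp: top_vertex_def)
  from collapse[OF TB(2) finite_imageI[OF fin0] this TB(4)]
  have c2: "strong_collapse Z (induced Z (h ` ?B))" .
  have T0: "?T \<subseteq> simps ?C 0" and B0: "?B \<subseteq> simps ?C 0" using vertices_cylinder[OF X(1)] by auto
  note IT = delta_complex_induced[OF C, of ?T] and IB = delta_complex_induced[OF C, of ?B]
  have t_iso: "dc_iso X (induced Z (h ` ?T)) (h \<circ> ?t)"
    by (rule dc_iso_comp[OF X(1) IT delta_complex_induced[OF Z] cylinder_ends(1)[OF X(1)] dc_iso_induced[OF C Z i T0]])
  \<comment> \<open>On the simplices of \<open>X\<close> the composite \<open>h \<circ> ?t\<close>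
    is the identity, so it determines the same target as \<open>id\<close>: the top end of
    \<open>Z\<close> is \<open>X\<close> itself.\<close>
  have "dc_iso X X id" unfolding dc_iso_def using delta_map_id[OF X(1)] by simp
  from dc_iso_unique[OF X(1) X(1) delta_complex_induced[OF Z] this t_iso]
  have "X = induced Z (h ` ?T)" by (simp add: ht)
  moreover have "dc_iso X (induced Z (h ` ?B)) (h \<circ> ?b)"
    by (rule dc_iso_comp[OF X(1) IB delta_complex_induced[OF Z] cylinder_ends(2)[OF X(1)] dc_iso_induced[OF C Z i B0]])
  from dc_iso_unique[OF X(1) Y delta_complex_induced[OF Z] f this]
  have "Y = induced Z (h ` ?B)" by (simp add: hb)
  ultimately have "strong_collapse Z X" "strong_collapse Z Y" using c1 c2 by simp_all
  then show ?thesis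
    using same_strong_homotopy_type_of_collapse[OF fZ] same_strong_homotopy_type_sym
      same_strong_homotopy_type_trans by metis
qed

text \<open>\<open>X\<close> and \<open>Y\<close> may share simplices, in which case the naming of a
  cylinder with these two ends need not be injective. A copy \<open>W\<close> on names outside both
  is disjoint from each of them and serves as an intermediate complex.\<close>

lemma same_strong_homotopy_type_of_iso:
  fixes X Y :: "'a dcomplex"
  assumes inf: "infinite (UNIV :: 'a set)"
    and fX: "finite_delta_complex X" and fY: "finite_delta_complex Y"
    and f: "delta_map X Y f" and g: "delta_map Y X g"
    and gf: "\<forall>\<sigma>\<in>simplices X. g (f \<sigma>) = \<sigma>" and fg: "\<forall>\<sigma>\<in>simplices Y. f (g \<sigma>) = \<sigma>"
  shows "same_strong_homotopy_type X Y"
proof -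
  have X: "delta_complex X" "finite (simplices X)" and Y: "delta_complex Y" "finite (simplices Y)"
    using fX fY by (auto simp: finite_delta_complex_def)
  have "infinite (- (simplices X \<union> simplices Y))" using inf X(2) Y(2) by (simp add: Compl_eq_Diff_UNIV)
  then obtain B where B: "B \<subseteq> - (simplices X \<union> simplices Y)" "card B = card (simplices X)" "finite B"
    using infinite_arbitrarily_large by metis
  obtain h where h: "bij_betw h (simplices X) B"
    using finite_same_card_bij[OF X(2) B(3)] B(2) by auto
  obtain W where W: "delta_complex W" and i: "dc_iso X W h"
    using dc_iso_image_exists[OF X(1) bij_betw_imp_inj_on[OF h]] by blast
  have sW: "simplices W = B" using dc_isoD(3)[OF i] bij_betw_imp_surj_on[OF h] by simp
  have fW: "finite_delta_complex W" using W sW B(3) unfolding finite_delta_complex_def by simp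
  have "same_strong_homotopy_type X W"
    by (rule same_strong_homotopy_type_of_disjoint_iso[OF inf fX fW i]) (use sW B(1) in blast)
  moreover have "dc_iso Y W (h \<circ> g)"
    by (rule dc_iso_comp[OF Y(1) X(1) W dc_isoI_inverse[OF Y(1) X(1) g f fg gf] i])
  then have "same_strong_homotopy_type Y W"
    by (rule same_strong_homotopy_type_of_disjoint_iso[OF inf fY fW]) (use sW B(1) in blast)
  ultimately show ?thesis
    using same_strong_homotopy_type_sym same_strong_homotopy_type_trans by metis
qed

text \<open>Symmetry of coherent equivalence makes the direction of the single collapses immaterial,
  and transitivity links them.\<close>

lemma coh_equivalent_of_same_strong_homotopy_type:
  assumes "same_strong_homotopy_type X Y"
  shows "coh_equivalent X Y"
proof -
  obtain n :: nat and Z where Z: "Z 0 = X" "Z n = Y" "\<forall>i\<le>n. finite_delta_complex (Z i)"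
    "\<forall>i<n. strong_collapse (Z i) (Z (Suc i)) \<or> strong_collapse (Z (Suc i)) (Z i)"
    using assms unfolding same_strong_homotopy_type_def by blast
  have dc: "delta_complex (Z i)" if "i \<le> n" for i using Z(3) that by (simp add: finite_delta_complex_def)
  have "coh_equivalent (Z 0) (Z i)" if "i \<le> n" for i
    using that
  proof (induction i)
    case 0
    then show ?case using coh_equivalent_refl[OF dc] by simp
  next
    case (Suc i)
    have d: "delta_complex (Z 0)" "delta_complex (Z i)" "delta_complex (Z (Suc i))"
      using dc Suc.prems by auto
    have "coh_equivalent (Z i) (Z (Suc i))"
      using Z(4) Suc.prems coh_equivalent_of_strong_collapse[OF d(2), of "Z (Suc i)"]
        coh_equivalent_of_strong_collapse[OF d(3), of "Z i"] coh_equivalent_sym by (metis Suc_le_eq)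
    then show ?case using coh_equivalent_trans[OF d] Suc by simp
  qed
  then show ?thesis using Z(1,2) by blast
qed

theorem corollary3p15:
  fixes X Y :: "'a dcomplex"
  assumes "infinite (UNIV :: 'a set)"
    and "finite_delta_complex X"
    and "finite_delta_complex Y"
  shows "same_strong_homotopy_type X Y \<longleftrightarrow> strongly_equivalent X Y"
proof -
  have X: "delta_complex X" and Y: "delta_complex Y"
    using assms(2,3) by (auto simp: finite_delta_complex_def)
  obtain X' Y' where cX: "strong_collapse X X'" and mX: "minimal_dc X'"
    and cY: "strong_collapse Y Y'" and mY: "minimal_dc Y'"
    using core_exists[OF assms(2)] core_exists[OF assms(3)] by blast
  have fX': "finite_delta_complex X'" and fY': "finite_delta_complex Y'"
    using finite_delta_complex_strong_collapse assms(2,3) cX cY by blast+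
  then have X': "delta_complex X'" and Y': "delta_complex Y'" by (auto simp: finite_delta_complex_def)
  \<comment> \<open>Shared by both directions, since coherent equivalence is a common consequence of
    the two relations.\<close>
  have iso: "\<exists>f g. delta_map X' Y' f \<and> delta_map Y' X' g \<and>
      (\<forall>\<sigma>\<in>simplices X'. g (f \<sigma>) = \<sigma>) \<and> (\<forall>\<sigma>\<in>simplices Y'. f (g \<sigma>) = \<sigma>)"
    if "coh_equivalent X Y"
  proof -
    have "coh_equivalent X' X"
      by (rule coh_equivalent_sym[OF coh_equivalent_of_strong_collapse[OF X cX]])
    then have "coh_equivalent X' Y" by (rule coh_equivalent_trans[OF X' X Y _ that])
    then have "coh_equivalent X' Y'"
      by (rule coh_equivalent_trans[OF X' Y Y' _ coh_equivalent_of_strong_collapse[OF Y cY]])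
    then show ?thesis by (rule minimal_dc_coh_equivalent[OF X' mX Y' mY])
  qed
  show ?thesis
  proof
    assume "same_strong_homotopy_type X Y"
    from iso[OF coh_equivalent_of_same_strong_homotopy_type[OF this]]
    show "strongly_equivalent X Y"
      using strongly_equivalent_of_collapses[OF X Y cX cY] by blast
  next
    assume "strongly_equivalent X Y"
    from iso[OF coh_equivalent_of_strongly_equivalent[OF X Y this]]
    have "same_strong_homotopy_type X' Y'"
      using same_strong_homotopy_type_of_iso[OF assms(1) fX' fY'] by blast
    moreover have "same_strong_homotopy_type X X'" "same_strong_homotopy_type Y Y'"
      using same_strong_homotopy_type_of_collapse assms(2,3) cX cY by blast+
    ultimately show "same_strong_homotopy_type X Y"
      using same_strong_homotopy_type_sym same_strong_homotopy_type_trans by metis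
  qed
qed

end
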